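(* Let $n\ge 1$, let $\omega\subset\mathbb{R}^{2n}$ be an open set and let $\phi:\omega\to\mathbb{R}$ be a continuous function. Then $\phi$ is locally intrinsic Lipschitz in $\omega$ (that is, $\phi\in \mathrm{Lip}_{\mathbb W,\mathrm{loc}}(\omega)$) if and only if there exists $w\in L^\infty_{\mathrm{loc}}(\omega;\mathbb{R}^{2n-1})$ such that $\phi$ is a distributional solution of the system $\nabla^\phi\phi=w$ in $\omega$.
   Context: Points of $\mathbb{R}^{2n}$ (identified with the subgroup $\mathbb W=\{x_1=0\}$ of the Heisenberg group $\mathbb H^n$) are written $A=(z,t)=(z_1,\dots,z_{2n-1},t)$ with $z\in\mathbb{R}^{2n-1}$, $t\in\mathbb{R}$. Graph quasidistance. For $\phi:\omega\to\mathbb{R}$ and $A=(z,t),A'=(z',t')\in\omega$ put $$d_\phi(A,A')=|z'-z|+\Big|t'-t-\tfrac12(\phi(A)+\phi(A'))(z_n'-z_n)+\sigma(z,z')\Big|^{1/2},$$ where $\sigma(z,z')=\tfrac12\sum_{j=1}^{n-1}(z_{j+n}z_j'-z_jz_{j+n}')$ (so $\sigma=0$ if $n=1$). Intrinsic Lipschitz functions. $\phi\in \mathrm{Lip}_{\mathbb W}(\omega)$ if there is $L>0$ with $|\phi(A)-\phi(B)|\le L\,d_\phi(A,B)$ for all $A,B\in\omega$; $\phi\in\mathrm{Lip}_{\mathbb W,\mathrm{loc}}(\omega)$ if $\phi|_{\omega'}\in\mathrm{Lip}_{\mathbb W}(\omega')$ for every open $\omega'$ compactly contained in $\omega$. Vector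 fields. On $\mathbb{R}^{2n}$ let $\nabla^\phi_j=\partial_{z_j}-\tfrac12 z_{j+n}\partial_t$ for $1\le j\le n-1$; $\nabla^\phi_n=\partial_{z_n}+\phi\,\partial_t$; $\nabla^\phi_j=\partial_{z_j}+\tfrac12 z_{j-n}\partial_t$ for $n+1\le j\le 2n-1$. Distributional solution. For $w=(w_1,\dots,w_{2n-1})$, a continuous $\phi$ is a distributional solution of $\nabla^\phi\phi=w$ in $\omega$ if for every $\varphi\in C_c^\infty(\omega)$ $$\int_\omega \phi\,\nabla^\phi_j\varphi\,d\mathcal L^{2n}=-\int_\omega w_j\varphi\,d\mathcal L^{2n}\quad (j\ne n),\qquad \int_\omega\Big(\phi\,\partial_{z_n}\varphi+\tfrac12\phi^2\,\partial_t\varphi\Big)d\mathcal L^{2n}=-\int_\omega w_n\varphi\,d\mathcal L^{2n}.$$ *)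

theory Defs
  imports "HOL-Analysis.Analysis"
begin

text \<open>
  The space \<open>\<real>\<^sup>2\<^sup>n\<close> of points \<open>A = (z, t)\<close> is the type \<open>(real ^ 'k) \<times> real\<close>, where \<open>'k\<close> is a finite
  index type with \<open>2 * n - 1\<close> elements. The numbering of the coordinates of \<open>z\<close> is given by a map
  \<open>e :: nat \<Rightarrow> 'k\<close> that restricts to a bijection from \<open>{1..2 * n - 1}\<close> onto \<open>'k\<close>, so that
  \<open>z\<^sub>j = z $ e j\<close>. This form also covers \<open>n = 1\<close>, and \<open>n\<close> stays an ordinary natural number.
\<close>

definition coord_numbering :: "nat \<Rightarrow> (nat \<Rightarrow> 'k::finite) \<Rightarrow> bool"
  where "coord_numbering n e \<longleftrightarrow> bij_betw e {1..2 * n - 1} UNIV"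

definition sigma_form :: "nat \<Rightarrow> (nat \<Rightarrow> 'k::finite) \<Rightarrow> real ^ 'k \<Rightarrow> real ^ 'k \<Rightarrow> real"
  where "sigma_form n e z z' =
    1 / 2 * (\<Sum>j = 1..n - 1. z $ e (j + n) * z' $ e j - z $ e j * z' $ e (j + n))"

definition graph_dist ::
  "nat \<Rightarrow> (nat \<Rightarrow> 'k::finite) \<Rightarrow> ((real ^ 'k) \<times> real \<Rightarrow> real)
    \<Rightarrow> (real ^ 'k) \<times> real \<Rightarrow> (real ^ 'k) \<times> real \<Rightarrow> real"
  where "graph_dist n e \<phi> A A' =
    (case (A, A') of ((z, t), (z', t')) \<Rightarrow>
      norm (z' - z) +
      sqrt \<bar>t' - t - 1 / 2 * (\<phi> A + \<phi> A') * (z' $ e n - z $ e n) + sigma_form n e z z'\<bar>)"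

definition intrinsic_Lipschitz_on ::
  "nat \<Rightarrow> (nat \<Rightarrow> 'k::finite) \<Rightarrow> ((real ^ 'k) \<times> real) set \<Rightarrow> ((real ^ 'k) \<times> real \<Rightarrow> real) \<Rightarrow> bool"
  where "intrinsic_Lipschitz_on n e S \<phi> \<longleftrightarrow>
    (\<exists>L>0. \<forall>A\<in>S. \<forall>B\<in>S. \<bar>\<phi> A - \<phi> B\<bar> \<le> L * graph_dist n e \<phi> A B)"

definition compactly_contained :: "'a::topological_space set \<Rightarrow> 'a set \<Rightarrow> bool"
  where "compactly_contained S T \<longleftrightarrow> compact (closure S) \<and> closure S \<subseteq> T"

definition locally_intrinsic_Lipschitz_on ::
  "nat \<Rightarrow> (nat \<Rightarrow> 'k::finite) \<Rightarrow> ((real ^ 'k) \<times> real) set \<Rightarrow> ((real ^ 'k) \<times> real \<Rightarrow> real) \<Rightarrow> bool"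
  where "locally_intrinsic_Lipschitz_on n e \<omega> \<phi> \<longleftrightarrow>
    (\<forall>\<omega>'. open \<omega>' \<and> compactly_contained \<omega>' \<omega> \<longrightarrow> intrinsic_Lipschitz_on n e \<omega>' \<phi>)"

definition Linfty_loc :: "'a::euclidean_space set \<Rightarrow> ('a \<Rightarrow> 'b::euclidean_space) \<Rightarrow> bool"
  where "Linfty_loc \<omega> w \<longleftrightarrow>
    w \<in> borel_measurable (lebesgue_on \<omega>) \<and>
    (\<forall>\<omega>'. open \<omega>' \<and> compactly_contained \<omega>' \<omega> \<longrightarrow>
      (\<exists>C. AE x in lebesgue_on \<omega>'. norm (w x) \<le> C))"

text \<open>Class \<open>C\<^sup>k\<close>: all iterated directional derivatives up to order \<open>k\<close> exist and are continuous.\<close>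

primrec Ck :: "nat \<Rightarrow> ('a::euclidean_space \<Rightarrow> real) \<Rightarrow> bool"
  where
    "Ck 0 f \<longleftrightarrow> continuous_on UNIV f"
  | "Ck (Suc k) f \<longleftrightarrow>
      (\<forall>x. f differentiable (at x)) \<and> (\<forall>v. Ck k (\<lambda>x. frechet_derivative f (at x) v))"

text \<open>
  An element of \<open>C\<^sub>c\<^sup>\<infinity>(\<omega>)\<close> is represented by its extension by zero to the whole space.
\<close>

definition test_function :: "'a::euclidean_space set \<Rightarrow> ('a \<Rightarrow> real) \<Rightarrow> bool"
  where "test_function \<omega> \<psi> \<longleftrightarrow>
    (\<forall>k. Ck k \<psi>) \<and> compactly_contained {x. \<psi> x \<noteq> 0} \<omega>"

definition partial_z ::
  "(nat \<Rightarrow> 'k::finite) \<Rightarrow> nat \<Rightarrow> ((real ^ 'k) \<times> real \<Rightarrow> real) \<Rightarrow> (real ^ 'k) \<times> real \<Rightarrow> real"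
  where "partial_z e j \<psi> A = frechet_derivative \<psi> (at A) (axis (e j) 1, 0)"

definition partial_t :: "((real ^ 'k::finite) \<times> real \<Rightarrow> real) \<Rightarrow> (real ^ 'k) \<times> real \<Rightarrow> real"
  where "partial_t \<psi> A = frechet_derivative \<psi> (at A) (0, 1)"

text \<open>The vector field \<open>\<nabla>\<^sup>\<phi>\<^sub>j\<close>, for \<open>1 \<le> j \<le> 2 * n - 1\<close>, applied to \<open>\<psi>\<close>.\<close>

definition nabla ::
  "nat \<Rightarrow> (nat \<Rightarrow> 'k::finite) \<Rightarrow> ((real ^ 'k) \<times> real \<Rightarrow> real) \<Rightarrow> nat
    \<Rightarrow> ((real ^ 'k) \<times> real \<Rightarrow> real) \<Rightarrow> (real ^ 'k) \<times> real \<Rightarrow> real"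
  where "nabla n e \<phi> j \<psi> A =
    (if j < n then partial_z e j \<psi> A - 1 / 2 * fst A $ e (j + n) * partial_t \<psi> A
     else if j = n then partial_z e n \<psi> A + \<phi> A * partial_t \<psi> A
     else partial_z e j \<psi> A + 1 / 2 * fst A $ e (j - n) * partial_t \<psi> A)"

text \<open>
  In the equation for \<open>j = n\<close> the field \<open>\<nabla>\<^sup>\<phi>\<^sub>n\<close> is used in conservative form, since
  \<open>\<phi> \<partial>\<^sub>t\<phi> = \<partial>\<^sub>t(\<phi>\<^sup>2 / 2)\<close>; this is where the factor \<open>1 / 2\<close> comes from.
  For continuous \<open>\<phi>\<close> and \<open>w\<close> in \<open>L\<^sup>\<infinity>\<^sub>l\<^sub>o\<^sub>c\<close> all integrands are integrable.
\<close>

definition distributional_solution ::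
  "nat \<Rightarrow> (nat \<Rightarrow> 'k::finite) \<Rightarrow> ((real ^ 'k) \<times> real) set \<Rightarrow> ((real ^ 'k) \<times> real \<Rightarrow> real)
    \<Rightarrow> ((real ^ 'k) \<times> real \<Rightarrow> real ^ 'k) \<Rightarrow> bool"
  where "distributional_solution n e \<omega> \<phi> w \<longleftrightarrow>
    (\<forall>\<psi>. test_function \<omega> \<psi> \<longrightarrow>
      (\<forall>j\<in>{1..2 * n - 1} - {n}.
        (LINT A|lebesgue_on \<omega>. \<phi> A * nabla n e \<phi> j \<psi> A)
          = - (LINT A|lebesgue_on \<omega>. w A $ e j * \<psi> A)) \<and>
      (LINT A|lebesgue_on \<omega>. \<phi> A * partial_z e n \<psi> A + 1 / 2 * (\<phi> A)\<^sup>2 * partial_t \<psi> A)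
        = - (LINT A|lebesgue_on \<omega>. w A $ e n * \<psi> A))"

end

theory Submission
  imports Defs "HOL-Computational_Algebra.Polynomial" "HOL-Library.Diagonal_Subsequence"
begin

text \<open>
  From solutions to the Lipschitz condition: testing the \<open>n\<close>-th equation with a bump transported with
      constant
  slope \<open>c\<close> leaves, besides the bounded right-hand side, the term \<open>(\<phi> - c)\<^sup>2 / 2\<close> at the lower
      and at the upper end
  of the bump, with opposite signs. Its sign is favourable at one end
      and it is quadratically small where
  \<open>\<phi>\<close> is close to \<open>c\<close>, so means of \<open>\<phi>\<close> just above (or below) an Euler polygon with slopes \<open>\<phi>\<close> grow at
      most
  linearly. Two polygons started on a vertical line at different values of \<open>\<phi>\<close> would cross before \<open>\<phi>\<close>
      could
  equalise, which gives Hoelder continuity of exponent \<open>1 / 2\<close> in \<open>t\<close>; together with the Lipschitz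
      bounds along
  the other, linear fields this is the intrinsic Lipschitz condition.

  Conversely, the equations hold with \<open>w\<close> a weak* limit of difference quotients along the fields. For
      the
  nonlinear field \<open>\<phi>\<close> is first averaged over vertical segments of length \<open>h\<^sup>2\<close>: the intrinsic Lipschitz
      condition
  then bounds the \<open>t\<close>-derivative of the mean by a multiple of \<open>1 / h\<close>, so the shift \<open>t \<mapsto> t +
      h * mean\<close> has a
  bounded Jacobian and the quotients can be multiplied by it.
\<close>

section \<open>Smooth functions and bumps\<close>

text \<open>The obstacle is that a merely continuous \<open>\<phi>\<close> has no unique
  characteristics for the nonlinear field and no flow to differentiate along. Frozen slopes and
  means over plateaus ask only for the weak equation and uniform continuity. Each side of a polygon
  controls one sign of the increment, so plateaus above and below it are both needed. The exponent
  \<open>1 / 2\<close> comes from a balance: slopes that differ by \<Delta> and change at rate K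
  stay apart for a time of order \<Delta> / K, in which the polygons approach by order \<Delta>^2 /
  K. In the graph distance the vertical term contains \<open>\<phi>\<close> at both points, so
  estimates return a product of the unknown difference with the distance, which is absorbed by
  Young's inequality. For the converse, the Jacobian of the regularised shift is bounded, but need
  neither be positive nor converge pointwise to 1. The substitution rule therefore avoids
  injectivity, and integration by parts in t shows that the Jacobian tends to 1 weakly.\<close>

lemma Ck_continuous: "Ck k f \<Longrightarrow> continuous_on UNIV f"
  by (cases k) (auto simp: differentiable_imp_continuous_within continuous_on_eq_continuous_within)

lemma Ck_SucI:
  assumes "\<And>x. (f has_derivative D x) (at x)" "\<And>v. Ck k (\<lambda>x. D x v)"
  shows "Ck (Suc k) f"
proof -
  have "frechet_derivative f (at x) = D x" for x
    using frechet_derivative_at[OF assms(1)] by simp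
  then show ?thesis using assms by (auto simp: differentiable_def)
qed

lemma Ck_SucE:
  assumes "Ck (Suc k) f"
  obtains D where "\<And>x. (f has_derivative D x) (at x)" "\<And>v. Ck k (\<lambda>x. D x v)"
  using assms that[of "\<lambda>x. frechet_derivative f (at x)"] by (simp add: frechet_derivative_works)

lemma Ck_SucD: "Ck (Suc k) f \<Longrightarrow> Ck k f"
proof (induction k arbitrary: f)
  case 0
  then show ?case using Ck_continuous[OF 0] by simp
next
  case (Suc k)
  from Suc.prems show ?case by (subst Ck.simps(2)) (auto intro: Suc.IH)
qed

lemma Ck_const: "Ck k (\<lambda>x. c)"
proof (induction k arbitrary: c)
  case (Suc k)
  show ?case by (rule Ck_SucI[where D = "\<lambda>x v. 0"]) (auto intro: Suc)
qed simp

lemma Ck_bounded_linear: "bounded_linear f \<Longrightarrow> Ck k f"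
proof (cases k)
  case 0
  assume "bounded_linear f"
  then show ?thesis using 0 by (simp add: linear_continuous_on)
next
  case (Suc m)
  assume "bounded_linear f"
  then show ?thesis unfolding Suc
    by (intro Ck_SucI[where D = "\<lambda>x. f"]) (auto intro: Ck_const bounded_linear_imp_has_derivative)
qed

lemma Ck_add: "Ck k f \<Longrightarrow> Ck k g \<Longrightarrow> Ck k (\<lambda>x. f x + g x)"
proof (induction k arbitrary: f g)
  case 0
  then show ?case by (auto intro: continuous_intros)
next
  case (Suc k)
  obtain D where D: "\<And>x. (f has_derivative D x) (at x)" "\<And>v. Ck k (\<lambda>x. D x v)"
    using Ck_SucE[OF Suc.prems(1)] by metis
  obtain E where E: "\<And>x. (g has_derivative E x) (at x)" "\<And>v. Ck k (\<lambda>x. E x v)"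
    using Ck_SucE[OF Suc.prems(2)] by metis
  show ?case
    by (rule Ck_SucI[where D = "\<lambda>x v. D x v + E x v"])
       (use D E in \<open>auto intro!: derivative_eq_intros Suc.IH\<close>)
qed

lemma Ck_mult: "Ck k f \<Longrightarrow> Ck k g \<Longrightarrow> Ck k (\<lambda>x. f x * g x)"
proof (induction k arbitrary: f g)
  case 0
  then show ?case by (auto intro: continuous_intros)
next
  case (Suc k)
  obtain D where D: "\<And>x. (f has_derivative D x) (at x)" "\<And>v. Ck k (\<lambda>x. D x v)"
    using Ck_SucE[OF Suc.prems(1)] by metis
  obtain E where E: "\<And>x. (g has_derivative E x) (at x)" "\<And>v. Ck k (\<lambda>x. E x v)"
    using Ck_SucE[OF Suc.prems(2)] by metis
  note fg = Suc.prems[THEN Ck_SucD]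
  show ?case
    by (rule Ck_SucI[where D = "\<lambda>x v. f x * E x v + D x v * g x"])
       (use D E fg in \<open>auto intro!: has_derivative_mult Ck_add Suc.IH\<close>)
qed

lemma Ck_diff: "Ck k f \<Longrightarrow> Ck k g \<Longrightarrow> Ck k (\<lambda>x. f x - g x)"
  using Ck_add[of k f "\<lambda>x. (-1) * g x"] Ck_mult[OF Ck_const[of k "-1"], of g] by simp

lemma Ck_SucI_real:
  assumes "\<And>x. (f has_real_derivative f' x) (at x)" "Ck k f'"
  shows "Ck (Suc k) f"
  by (rule Ck_SucI[where D = "\<lambda>x v. f' x * v"])
     (use assms in \<open>auto intro: Ck_mult Ck_const simp: has_field_derivative_def\<close>)

text \<open>In one real variable the outer derivative is multiplication by \<open>D y 1\<close>. The
  derivative of the composite is thus a product of a composite of lower order with a derivative of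
  \<open>g\<close>, so the induction has to run over all \<open>f\<close> and \<open>g\<close> at
  once.\<close>

lemma Ck_compose:
  fixes f :: "real \<Rightarrow> real"
  shows "Ck k f \<Longrightarrow> Ck k g \<Longrightarrow> Ck k (\<lambda>x. f (g x))"
proof (induction k arbitrary: f g)
  case 0
  then show ?case by (auto intro: continuous_on_compose2)
next
  case (Suc k)
  obtain D where D: "\<And>x. (f has_derivative D x) (at x)" "\<And>v. Ck k (\<lambda>x. D x v)"
    using Ck_SucE[OF Suc.prems(1)] by metis
  obtain E where E: "\<And>x. (g has_derivative E x) (at x)" "\<And>v. Ck k (\<lambda>x. E x v)"
    using Ck_SucE[OF Suc.prems(2)] by metis
  have lin: "D y w = D y 1 * w" for y w
    using linear_cmul[OF has_derivative_linear[OF D(1)], of y w 1] by simp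
  have "((\<lambda>x. f (g x)) has_derivative (\<lambda>v. D (g x) 1 * E x v)) (at x)" for x
    using has_derivative_compose[OF E(1) D(1), of x] by (subst lin[symmetric])
  then show ?case
    by (rule Ck_SucI) (use Suc.prems(2)[THEN Ck_SucD] D E in \<open>auto intro!: Ck_mult Suc.IH[of "\<lambda>y. D y
        1"]\<close>)
qed

section \<open>A flat smooth function and compactly supported bumps\<close>

lemma exp_neg_poly_tendsto_0:
  fixes P :: "real poly"
  shows "((\<lambda>y. exp (- y) * poly P y) \<longlongrightarrow> 0) at_top"
proof -
  have "((\<lambda>y. \<Sum>i\<le>degree P. coeff P i * (y ^ i / exp y)) \<longlongrightarrow> (\<Sum>i\<le>degree P. coeff P i * 0)) at_top"
    by (intro tendsto_sum tendsto_mult tendsto_const tendsto_power_div_exp_0)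
  moreover have "(\<lambda>y. exp (- y) * poly P y) = (\<lambda>y. \<Sum>i\<le>degree P. coeff P i * (y ^ i / exp y))"
    by (auto simp: poly_altdef sum_distrib_left exp_minus field_simps)
  ultimately show ?thesis by simp
qed

definition flat_exp :: "real poly \<Rightarrow> real \<Rightarrow> real"
  where "flat_exp P x = (if x > 0 then exp (- (1 / x)) * poly P (1 / x) else 0)"

text \<open>The polynomial factor makes the family closed under differentiation: with y = 1 / x, the
  derivative of exp(-y) P(y) in x is exp(-y) y^2 (P(y) - P'(y)). Smoothness is then an induction on
  the order for all polynomials together.\<close>

lemma flat_exp_has_derivative:
  "(flat_exp P has_real_derivative flat_exp ([:0, 0, 1:] * (P - pderiv P)) x) (at x)"
proof -
  consider "x > 0" | "x < 0" | "x = 0" by linarith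
  then show ?thesis
  proof cases
    case 1
    have "((\<lambda>x. exp (- (1 / x)) * poly P (1 / x)) has_real_derivative
        flat_exp ([:0, 0, 1:] * (P - pderiv P)) x) (at x)"
      using 1 by (auto intro!: derivative_eq_intros simp: flat_exp_def field_simps power2_eq_square)
    then show ?thesis
      by (rule has_field_derivative_transform_within_open[where S = "{0<..}"])
         (use 1 in \<open>auto simp: flat_exp_def\<close>)
  next
    case 2
    have "((\<lambda>x. 0) has_real_derivative 0) (at x)" by simp
    then have "(flat_exp P has_real_derivative 0) (at x)"
      by (rule has_field_derivative_transform_within_open[where S = "{..<0}"])
         (use 2 in \<open>auto simp: flat_exp_def\<close>)
    then show ?thesis using 2 by (simp add: flat_exp_def)
  next
    case 3
    \<comment> \<open>\<open>pCons 0 P\<close> is the polynomial times its variable; the extra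
      factor is the \<open>1 / h\<close> of the difference quotient at \<open>0\<close>.\<close>
    have "((\<lambda>h. exp (- (inverse h)) * poly (pCons 0 P) (inverse h)) \<longlongrightarrow> 0) (at_right 0)"
      by (rule filterlim_compose[OF exp_neg_poly_tendsto_0 filterlim_inverse_at_top_right])
    then have "((\<lambda>h. (flat_exp P (0 + h) - flat_exp P 0) / h) \<longlongrightarrow> 0) (at_right 0)"
      by (rule Lim_transform_eventually)
         (auto simp: eventually_at_filter flat_exp_def field_simps)
    moreover have "((\<lambda>h. (flat_exp P (0 + h) - flat_exp P 0) / h) \<longlongrightarrow> 0) (at_left 0)"
      by (rule Lim_transform_eventually[OF tendsto_const])
         (auto simp: eventually_at_filter flat_exp_def)
    ultimately have "((\<lambda>h. (flat_exp P (0 + h) - flat_exp P 0) / h) \<longlongrightarrow> 0) (at 0)"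
      by (rule filterlim_split_at[rotated])
    then show ?thesis using 3 by (simp add: DERIV_def flat_exp_def)
  qed
qed

lemma Ck_flat_exp: "Ck k (flat_exp P)"
proof (induction k arbitrary: P)
  case 0
  show ?case
    by (simp add: continuous_at_imp_continuous_on DERIV_isCont[OF flat_exp_has_derivative])
next
  case (Suc k)
  show ?case by (rule Ck_SucI_real[OF flat_exp_has_derivative Suc])
qed

lemma flat_exp_1_pos: "flat_exp 1 x > 0 \<longleftrightarrow> x > 0" and flat_exp_1_nonneg: "flat_exp 1 x \<ge> 0"
  by (auto simp: flat_exp_def)

text \<open>The flat function is composed with the squared norm, a polynomial, because the norm
  itself is not differentiable at the origin.\<close>

lemma smooth_bump_exists:
  obtains \<rho> :: "'a::euclidean_space \<Rightarrow> real" where "\<And>k. Ck k \<rho>" "\<And>x. \<rho> x \<ge> 0"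
    "\<And>x. \<rho> x > 0 \<longleftrightarrow> norm x < 1"
proof
  let ?\<rho> = "\<lambda>x::'a. flat_exp 1 (1 - x \<bullet> x)"
  have "Ck k (\<lambda>x::'a. x \<bullet> x)" for k
  proof (cases k)
    case 0 then show ?thesis by (simp add: continuous_on_inner)
  next
    case (Suc m)
    have "Ck m (\<lambda>x. 2 * (x \<bullet> v))" for v :: 'a
      by (intro Ck_mult Ck_const Ck_bounded_linear bounded_linear_inner_left)
    then show ?thesis unfolding Suc
      by (intro Ck_SucI[where D = "\<lambda>x v. 2 * (x \<bullet> v)"])
         (auto intro!: derivative_eq_intros simp: inner_commute)
  qed
  then show "Ck k ?\<rho>" for k by (intro Ck_compose[OF Ck_flat_exp] Ck_diff Ck_const)
  show "?\<rho> x \<ge> 0" for x by (rule flat_exp_1_nonneg)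
  have "x \<bullet> x < 1 \<longleftrightarrow> norm x < 1" for x :: 'a
    by (metis abs_norm_cancel dot_square_norm abs_square_less_1)
  then show "?\<rho> x > 0 \<longleftrightarrow> norm x < 1" for x by (simp add: flat_exp_1_pos)
qed

lemma Ck_antiderivative:
  fixes \<rho> :: "real \<Rightarrow> real"
  assumes "\<And>k. Ck k \<rho>"
  obtains R where "\<And>k. Ck k R" "\<And>x. (R has_real_derivative \<rho> x) (at x)"
proof -
  have "\<exists>F. \<forall>x. - \<infinity> < ereal x \<longrightarrow> ereal x < \<infinity> \<longrightarrow> (F has_vector_derivative \<rho> x) (at x)"
    using Ck_continuous[OF assms[of 0]]
    by (intro einterval_antiderivative) (auto simp: continuous_on_eq_continuous_at)
  then obtain R where R: "\<And>x. (R has_real_derivative \<rho> x) (at x)"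
    by (auto simp: has_real_derivative_iff_has_vector_derivative)
  have "Ck k R" for k using Ck_SucI_real[OF R assms, THEN Ck_SucD] .
  then show thesis using that R by blast
qed

section \<open>Integration tools\<close>

lemma integrable_continuous_bounded_support:
  fixes f :: "'a::euclidean_space \<Rightarrow> real"
  assumes "continuous_on UNIV f" "bounded {x. f x \<noteq> 0}"
  shows "integrable lborel f"
proof -
  have "integrable lborel (\<lambda>x. indicator (closure {x. f x \<noteq> 0}) x *\<^sub>R f x)"
    using assms by (intro borel_integrable_compact) (auto elim: continuous_on_subset)
  moreover have "(\<lambda>x. indicator (closure {x. f x \<noteq> 0}) x *\<^sub>R f x) = f"
    using subsetD[OF closure_subset[of "{x. f x \<noteq> 0}"]] by (auto simp: indicator_def fun_eq_iff)
  ultimately show ?thesis by simp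
qed

lemma lborel_integral_translate:
  fixes f :: "'a::euclidean_space \<Rightarrow> real"
  assumes "f \<in> borel_measurable borel"
  shows "(\<integral>x. f (x + c) \<partial>lborel) = (\<integral>x. f x \<partial>lborel)"
proof -
  have "(\<integral>x. f x \<partial>lborel) = (\<integral>x. f x \<partial>distr lborel borel ((+) c))"
    by (simp add: lborel_distr_plus)
  also have "\<dots> = (\<integral>x. f (c + x) \<partial>lborel)"
    by (rule integral_distr) (use assms in auto)
  finally show ?thesis by (simp add: add.commute)
qed

text \<open>Bridge to the gauge integral over a box, where differentiation under the integral sign
  and the oriented substitution rule are available.\<close>

lemma lborel_integral_eq_cbox:
  fixes f :: "'a::euclidean_space \<Rightarrow> real"
  assumes "continuous_on UNIV f" "\<And>x. f x \<noteq> 0 \<Longrightarrow> x \<in> cbox a b"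
  shows "(\<integral>x. f x \<partial>lborel) = integral (cbox a b) f"
proof -
  have "bounded {x. f x \<noteq> 0}"
    by (intro bounded_subset[OF bounded_cbox[of a b]]) (use assms(2) in auto)
  then have "(\<integral>x. f x \<partial>lborel) = integral UNIV f"
    using integral_lborel integrable_continuous_bounded_support assms(1) by metis
  also have "\<dots> = integral UNIV (\<lambda>x. if x \<in> cbox a b then f x else 0)"
    by (intro integral_cong) (use assms(2) in auto)
  finally show ?thesis by (simp add: integral_restrict_UNIV)
qed

text \<open>One bounded set \<open>S\<close> serves all parameters in the open set \<open>U\<close>.
  Off \<open>S\<close> the function vanishes for all these parameters, hence so does its derivative,
  and both integrals reduce to a common box.\<close>

lemma leibniz_lborel:
  fixes f :: "real \<Rightarrow> 'a::euclidean_space \<Rightarrow> real"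
  assumes der: "\<And>s x. s \<in> U \<Longrightarrow> ((\<lambda>s. f s x) has_real_derivative f' s x) (at s)"
    and cf: "\<And>s. s \<in> U \<Longrightarrow> continuous_on UNIV (f s)"
    and cf': "continuous_on (U \<times> UNIV) (\<lambda>(s, x). f' s x)"
    and supp: "bounded S" "\<And>s x. s \<in> U \<Longrightarrow> x \<notin> S \<Longrightarrow> f s x = 0"
    and U: "open U" "convex U" "s \<in> U"
  shows "((\<lambda>s. \<integral>x. f s x \<partial>lborel) has_real_derivative (\<integral>x. f' s x \<partial>lborel)) (at s)"
proof -
  obtain a where a: "S \<subseteq> cbox (-a) a" using bounded_subset_cbox_symmetric[OF supp(1)] by auto
  have f'0: "f' s x = 0" if "s \<in> U" "x \<notin> S" for s x
  proof -
    have "((\<lambda>s. f s x) has_real_derivative 0) (at s)"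
      by (rule has_field_derivative_transform_within_open[where f = "\<lambda>_. 0" and S = U])
         (use that supp U in auto)
    then show ?thesis using DERIV_unique der[OF that(1)] by blast
  qed
  have 1: "(\<integral>x. f s x \<partial>lborel) = integral (cbox (-a) a) (f s)" if "s \<in> U" for s
    by (rule lborel_integral_eq_cbox) (use a cf supp that in auto)
  have "continuous_on UNIV (f' s)"
    by (rule continuous_on_compose2[OF cf', where f = "\<lambda>x. (s, x)", simplified])
       (use U in \<open>auto intro: continuous_intros\<close>)
  then have 2: "(\<integral>x. f' s x \<partial>lborel) = integral (cbox (-a) a) (f' s)"
    by (rule lborel_integral_eq_cbox) (use a f'0 U in auto)
  have "((\<lambda>s. integral (cbox (-a) a) (f s)) has_real_derivative
      integral (cbox (-a) a) (f' s)) (at s within U)"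
  proof (rule leibniz_rule_field_derivative)
    show "f s integrable_on cbox (-a) a" if "s \<in> U" for s
      by (intro integrable_continuous continuous_on_subset[OF cf[OF that]]) simp
    show "continuous_on (U \<times> cbox (- a) a) (\<lambda>(x, t). f' x t)"
      by (rule continuous_on_subset[OF cf']) auto
    show "((\<lambda>s. f s t) has_real_derivative f' s t) (at s within U)" if "s \<in> U" for s t
      by (rule DERIV_subset[OF der[OF that]]) simp
  qed (use U in auto)
  then have "((\<lambda>s. integral (cbox (-a) a) (f s)) has_real_derivative
      integral (cbox (-a) a) (f' s)) (at s)"
    using at_within_open[OF U(3,1)] by simp
  then show ?thesis unfolding 2
    by (rule has_field_derivative_transform_within_open[OF _ U(1,3)]) (simp add: 1)
qed

text \<open>By translation invariance the integral of \<open>f (x + s *\<^sub>R v)\<close> is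
  constant in \<open>s\<close>. Only a derivative along \<open>v\<close> is asked for: later
  \<open>f\<close> involves powers of vertical means of \<open>u\<close>, for which a derivative in
  \<open>t\<close> alone is known.\<close>

lemma integral_directional_derivative_0:
  fixes f :: "'a::euclidean_space \<Rightarrow> real"
  assumes der: "\<And>x. ((\<lambda>s. f (x + s *\<^sub>R v)) has_real_derivative D x) (at 0)"
    and c: "continuous_on UNIV f" "continuous_on UNIV D" and b: "bounded {x. f x \<noteq> 0}"
  shows "(\<integral>x. D x \<partial>lborel) = 0"
proof -
  obtain r where r: "\<And>x. f x \<noteq> 0 \<Longrightarrow> norm x \<le> r" using b unfolding bounded_iff by blast
  have der': "((\<lambda>s. f (x + s *\<^sub>R v)) has_real_derivative D (x + s *\<^sub>R v)) (at s)" for s x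
    using der[of "x + s *\<^sub>R v"] DERIV_shift[of "\<lambda>s. f (x + s *\<^sub>R v)" "D (x + s *\<^sub>R v)" 0 s]
    by (simp add: algebra_simps)
  have supp: "f (x + s *\<^sub>R v) = 0" if "s \<in> {-1<..<1}" "x \<notin> cball 0 (r + norm v)" for s x
  proof (rule ccontr)
    assume "f (x + s *\<^sub>R v) \<noteq> 0"
    then have "norm (x + s *\<^sub>R v) \<le> r" by (rule r)
    moreover have "norm x \<le> norm (x + s *\<^sub>R v) + norm (s *\<^sub>R v)"
      using norm_triangle_ineq4[of "x + s *\<^sub>R v" "s *\<^sub>R v"] by simp
    moreover have "norm (s *\<^sub>R v) \<le> norm v" using that(1) mult_right_mono[of "\<bar>s\<bar>" 1 "norm v"] by auto
    ultimately show False using that(2) by simp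
  qed
  have "((\<lambda>s. \<integral>x. f (x + s *\<^sub>R v) \<partial>lborel) has_real_derivative (\<integral>x. D (x + 0 *\<^sub>R v) \<partial>lborel)) (at 0)"
    by (rule leibniz_lborel[where U = "{-1<..<1}" and S = "cball 0 (r + norm v)"
        and f' = "\<lambda>s x. D (x + s *\<^sub>R v)"])
       (use der' supp in \<open>auto simp: case_prod_beta intro!: continuous_intros
          continuous_on_compose2[OF c(1)] continuous_on_compose2[OF c(2)]\<close>)
  moreover have "(\<lambda>s. \<integral>x. f (x + s *\<^sub>R v) \<partial>lborel) = (\<lambda>s. \<integral>x. f x \<partial>lborel)"
    using lborel_integral_translate borel_measurable_continuous_onI[OF c(1)] by blast
  ultimately have "((\<lambda>s::real. \<integral>x. f x \<partial>lborel) has_real_derivative (\<integral>x. D x \<partial>lborel)) (at 0)"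
    by simp
  then show ?thesis using DERIV_unique DERIV_const by blast
qed

lemma integral_dominated_bounded_support:
  fixes f :: "'a::euclidean_space \<Rightarrow> real"
  assumes m: "\<And>k. F k \<in> borel_measurable borel" "f \<in> borel_measurable borel"
    and lim: "\<And>x. (\<lambda>k. F k x) \<longlonglongrightarrow> f x"
    and b: "\<And>k x. \<bar>F k x\<bar> \<le> C" and supp: "bounded S" "\<And>k x. x \<notin> S \<Longrightarrow> F k x = 0"
  shows "(\<lambda>k. \<integral>x. F k x \<partial>lborel) \<longlonglongrightarrow> (\<integral>x. f x \<partial>lborel)"
proof (rule integral_dominated_convergence[where w = "\<lambda>x. C * indicator (closure S) x"])
  have "emeasure lborel (closure S) < \<infinity>" using supp(1) by (intro emeasure_bounded_finite) auto
  then show "integrable lborel (\<lambda>x. C * indicator (closure S) x)" by simp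
  show "AE x in lborel. norm (F k x) \<le> C * indicator (closure S) x" for k
  proof (rule AE_I2)
    fix x show "norm (F k x) \<le> C * indicator (closure S) x"
      using b[of k x] supp(2)[of x k] closure_subset[of S] by (cases "x \<in> S") (auto simp: indicator_def)
  qed
qed (use m lim in auto)

lemma lborel_integral_eq_slices:
  fixes f g :: "'a::euclidean_space \<times> real \<Rightarrow> real"
  assumes f: "integrable lborel f" and g: "integrable lborel g"
    and eq: "\<And>z. (\<integral>t. f (z, t) \<partial>lborel) = (\<integral>t. g (z, t) \<partial>lborel)"
  shows "(\<integral>x. f x \<partial>lborel) = (\<integral>x. g x \<partial>lborel)"
proof -
  have "(\<integral>x. h x \<partial>lborel) = (\<integral>z. \<integral>t. h (z, t) \<partial>lborel \<partial>lborel)"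
    if "integrable lborel h" for h :: "'a \<times> real \<Rightarrow> real"
  proof -
    have "integrable (lborel \<Otimes>\<^sub>M lborel) h" using that by (simp add: lborel_prod)
    then have "(\<integral>z. \<integral>t. h (z, t) \<partial>lborel \<partial>lborel) = integral\<^sup>L (lborel \<Otimes>\<^sub>M lborel) h"
      by (rule lborel_pair.integral_fst')
    then show ?thesis by (simp add: lborel_prod)
  qed
  then show ?thesis using f g eq by simp
qed

text \<open>Oriented substitution sees only the end values of \<open>s\<close>, so \<open>s\<close>
  may fail to be monotone. The bound on \<open>s t - t\<close> takes over: it forces
  \<open>s\<close> to carry a large interval beyond the support of \<open>f\<close> on both
  sides.\<close>

lemma lborel_substitution_real:
  fixes f s :: "real \<Rightarrow> real"
  assumes f: "continuous_on UNIV f" "bounded {t. f t \<noteq> 0}"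
    and s: "\<And>t. (s has_real_derivative s' t) (at t)" "continuous_on UNIV s'" "\<And>t. \<bar>s t - t\<bar> \<le> B"
  shows "(\<integral>t. f (s t) * s' t \<partial>lborel) = (\<integral>t. f t \<partial>lborel)"
proof -
  obtain r where r: "\<And>t. f t \<noteq> 0 \<Longrightarrow> \<bar>t\<bar> \<le> r" using f(2) unfolding bounded_iff by auto
  \<comment> \<open>Large enough that the interval from \<open>s (-N)\<close> to \<open>s N\<close>
    contains the support of \<open>f\<close> and that from \<open>-N\<close> to \<open>N\<close> the
    support of the composite.\<close>
  define N where "N = \<bar>r\<bar> + B"
  have B0: "B \<ge> 0" using s(3)[of 0] by linarith
  have sN: "s (- N) \<le> - \<bar>r\<bar>" "s N \<ge> \<bar>r\<bar>" using s(3)[of N] s(3)[of "-N"] by (auto simp: N_def abs_le_iff)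
  have cs: "continuous_on UNIV s" using s(1) by (intro continuous_at_imp_continuous_on ballI
      DERIV_isCont)
  have "((\<lambda>t. s' t *\<^sub>R f (s t)) has_integral integral {s (-N)..s N} f) {-N..N}"
  proof (rule has_integral_substitution[where c = "- N - B" and d = "N + B"])
    show "- N \<le> N" "s (- N) \<le> s N" using B0 sN by (simp_all add: N_def)
    show "s ` {-N..N} \<subseteq> {- N - B..N + B}"
    proof
      fix y assume "y \<in> s ` {-N..N}"
      then obtain t where "y = s t" "- N \<le> t" "t \<le> N" by auto
      then show "y \<in> {- N - B..N + B}" using s(3)[of t] by (simp add: abs_le_iff)
    qed
    show "continuous_on {- N - B..N + B} f" by (rule continuous_on_subset[OF f(1)]) simp
    show "(s has_real_derivative s' x) (at x within {- N..N})" for x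
        by (rule DERIV_subset[OF s(1)]) simp
  qed
  then have 1: "integral {-N..N} (\<lambda>t. s' t *\<^sub>R f (s t)) = integral {s (-N)..s N} f"
    by (rule integral_unique)
  have "(\<integral>t. f t \<partial>lborel) = integral (cbox (s (-N)) (s N)) f"
  proof (rule lborel_integral_eq_cbox[OF f(1)])
    fix t assume "f t \<noteq> 0"
    from r[OF this] sN show "t \<in> cbox (s (-N)) (s N)" by (auto simp: abs_le_iff)
  qed
  moreover have "(\<integral>t. f (s t) * s' t \<partial>lborel) = integral (cbox (-N) N) (\<lambda>t. f (s t) * s' t)"
  proof (rule lborel_integral_eq_cbox)
    show "continuous_on UNIV (\<lambda>t. f (s t) * s' t)"
      by (intro continuous_intros s continuous_on_compose2[OF f(1) cs]) auto
    fix t assume "f (s t) * s' t \<noteq> 0"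
    then have "\<bar>s t\<bar> \<le> r" using r by auto
    then show "t \<in> cbox (-N) N" using s(3)[of t] by (auto simp: N_def abs_le_iff)
  qed
  ultimately show ?thesis using 1 by (simp add: mult.commute)
qed

lemma lborel_substitution_snd:
  fixes \<Psi> s :: "'a::euclidean_space \<times> real \<Rightarrow> real"
  assumes \<Psi>: "continuous_on UNIV \<Psi>" "bounded {A. \<Psi> A \<noteq> 0}"
    and s: "\<And>z t. ((\<lambda>t. s (z, t)) has_real_derivative s' (z, t)) (at t)"
      "continuous_on UNIV s" "continuous_on UNIV s'" "\<And>A. \<bar>s A - snd A\<bar> \<le> B + norm (fst A)"
  shows "(\<integral>A. \<Psi> (fst A, s A) * s' A \<partial>lborel) = (\<integral>A. \<Psi> A \<partial>lborel)"
proof (rule lborel_integral_eq_slices)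
  show "integrable lborel \<Psi>" using \<Psi> by (rule integrable_continuous_bounded_support)
  obtain r where r: "\<And>A. \<Psi> A \<noteq> 0 \<Longrightarrow> norm A \<le> r" using \<Psi>(2) unfolding bounded_iff by auto
  have "bounded {A. \<Psi> (fst A, s A) * s' A \<noteq> 0}"
  proof (rule boundedI[of _ "3 * r + B"])
    fix A assume "A \<in> {A. \<Psi> (fst A, s A) * s' A \<noteq> 0}"
    then have "norm (fst A, s A) \<le> r" using r by auto
    then have "norm (fst A) \<le> r" "\<bar>s A\<bar> \<le> r"
      using norm_fst_le[of "fst A" "s A"] norm_snd_le[of "s A" "fst A"] by auto
    moreover have "norm A \<le> norm (fst A) + \<bar>snd A\<bar>" using norm_Pair_le[of "fst A" "snd A"] by simp
    ultimately show "norm A \<le> 3 * r + B" using s(4)[of A] by linarith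
  qed
  moreover have "continuous_on UNIV (\<lambda>A. \<Psi> (fst A, s A) * s' A)"
    by (intro continuous_intros s continuous_on_compose2[OF \<Psi>(1)]) auto
  ultimately show "integrable lborel (\<lambda>A. \<Psi> (fst A, s A) * s' A)"
    by (intro integrable_continuous_bounded_support)
  fix z
  have "continuous_on UNIV (\<lambda>t. \<Psi> (z, t))" "continuous_on UNIV (\<lambda>t. s' (z, t))"
    by (auto intro!: continuous_intros continuous_on_compose2[OF \<Psi>(1)] continuous_on_compose2[OF s(3)])
  moreover have "bounded {t. \<Psi> (z, t) \<noteq> 0}"
  proof (rule boundedI[of _ r])
    fix t assume "t \<in> {t. \<Psi> (z, t) \<noteq> 0}"
    then have "norm (z, t) \<le> r" using r by auto
    then show "norm t \<le> r" using norm_snd_le[of t z] by auto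
  qed
  ultimately have "(\<integral>t. \<Psi> (z, s (z, t)) * s' (z, t) \<partial>lborel) = (\<integral>t. \<Psi> (z, t) \<partial>lborel)"
    using s(4)[of "(z, _)"] by (intro lborel_substitution_real[where s = "\<lambda>t. s (z, t)"
        and B = "B + norm z"] s(1)) auto
  then show "(\<integral>t. \<Psi> (fst (z, t), s (z, t)) * s' (z, t) \<partial>lborel) = (\<integral>t. \<Psi> (z, t) \<partial>lborel)" by simp
qed

section \<open>Smooth plateaus\<close>

lemma Ck_translate: "Ck k f \<Longrightarrow> Ck k (\<lambda>x. f (x - a))"
proof (induction k arbitrary: f)
  case 0
  then show ?case by (auto intro!: continuous_intros continuous_on_compose2[of UNIV f])
next
  case (Suc k)
  obtain D where D: "\<And>x. (f has_derivative D x) (at x)" "\<And>v. Ck k (\<lambda>x. D x v)"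
    using Ck_SucE[OF Suc.prems] by metis
  have "((\<lambda>x. f (x - a)) has_derivative D (x - a)) (at x)" for x
    by (rule has_derivative_compose[OF _ D(1), of "\<lambda>x. x - a" "\<lambda>v. v" x UNIV])
       (auto intro!: derivative_eq_intros)
  then show ?case by (rule Ck_SucI) (rule Suc.IH[OF D(2)])
qed

lemma Ck_compose_linear:
  fixes f :: "'a::euclidean_space \<Rightarrow> real" and L :: "'b::euclidean_space \<Rightarrow> 'a"
  assumes "Ck k f" and L: "bounded_linear L"
  shows "Ck k (\<lambda>x. f (L x))"
  using assms(1)
proof (induction k arbitrary: f)
  case 0
  then show ?case
    using linear_continuous_on[OF L] by (auto intro: continuous_on_compose2[of UNIV f])
next
  case (Suc k)
  obtain D where D: "\<And>x. (f has_derivative D x) (at x)" "\<And>v. Ck k (\<lambda>x. D x v)"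
    using Ck_SucE[OF Suc.prems] by metis
  show ?case
    by (rule Ck_SucI[where D = "\<lambda>x v. D (L x) (L v)"])
       (auto intro: Suc.IH[OF D(2)] has_derivative_compose[OF bounded_linear_imp_has_derivative[OF L]
           D(1)])
qed

lemma smooth_derivative:
  assumes "\<And>k. Ck k f"
  shows "(f has_derivative frechet_derivative f (at x)) (at x)"
    and "continuous_on UNIV (\<lambda>x. frechet_derivative f (at x) v)"
    and "Ck k (\<lambda>x. frechet_derivative f (at x) v)"
proof -
  have *: "Ck (Suc k) f" for k by (rule assms)
  show "(f has_derivative frechet_derivative f (at x)) (at x)"
    using *[of 0] by (auto simp: frechet_derivative_works)
  show "continuous_on UNIV (\<lambda>x. frechet_derivative f (at x) v)"
      "Ck k (\<lambda>x. frechet_derivative f (at x) v)"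
    using *[of 0] *[of k] by auto
qed

lemma has_derivative_along_line:
  assumes "(f has_derivative D) (at (x + s *\<^sub>R v))"
  shows "((\<lambda>s. f (x + s *\<^sub>R v)) has_real_derivative D v) (at s)"
proof -
  have "((\<lambda>s. f (x + s *\<^sub>R v)) has_derivative (\<lambda>h. D (h *\<^sub>R v))) (at s)"
    by (rule has_derivative_compose[where g = f and f = "\<lambda>s. x + s *\<^sub>R v" and s = UNIV])
       (use assms in \<open>auto intro!: derivative_eq_intros\<close>)
  moreover have "(\<lambda>h. D (h *\<^sub>R v)) = (*) (D v)"
    using linear_scale[OF has_derivative_linear[OF assms]] by (auto simp: mult.commute)
  ultimately show ?thesis by (simp add: has_field_derivative_def)
qed

lemma integral_pos_continuous:
  fixes f :: "'a::euclidean_space \<Rightarrow> real"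
  assumes "continuous_on UNIV f" "bounded {x. f x \<noteq> 0}" "\<And>x. f x \<ge> 0" "f a > 0"
  shows "(\<integral>x. f x \<partial>lborel) > 0"
proof -
  have "(\<integral>x. f x \<partial>lborel) \<noteq> 0"
  proof
    assume "(\<integral>x. f x \<partial>lborel) = 0"
    then have "AE x in lborel. f x = 0"
      using integral_nonneg_eq_0_iff_AE[of lborel f] integrable_continuous_bounded_support assms by auto
    then have "AE x in lebesgue. f x = 0" by (rule AE_completion)
    then have "negligible {x. f x \<noteq> 0}" by (auto simp: completion.AE_iff_null_sets
        negligible_iff_null_sets
       Collect_neg_eq[symmetric] eventually_ae_filter intro: completion.complete2)
    moreover have "open {x. f x \<noteq> 0}" by (rule open_Collect_neq) (use assms in auto)
    ultimately show False using open_not_negligible assms(4) by force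
  qed
  moreover have "(\<integral>x. f x \<partial>lborel) \<ge> 0" by (rule integral_nonneg_AE) (use assms in auto)
  ultimately show ?thesis by simp
qed

text \<open>
  A smooth plateau \<open>\<eta>\<close> around the vertical segment from \<open>0\<close> to \<open>(0, \<epsilon>)\<close>; its derivative in direction
  \<open>(0, 1)\<close> consists of a positive bump at the lower end and a negative one at the upper end.
\<close>

definition plateau ::
  "real \<Rightarrow> real \<Rightarrow> ('a::euclidean_space \<times> real \<Rightarrow> real) \<Rightarrow> ('a \<times> real \<Rightarrow> real) \<Rightarrow> bool"
  where "plateau \<kappa> \<epsilon> \<eta> b \<longleftrightarrow>
    (\<forall>k. Ck k \<eta>) \<and> (\<forall>A. \<eta> A \<ge> 0) \<and> continuous_on UNIV b \<and> (\<forall>A. b A \<ge> 0) \<and>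
    (\<forall>A. frechet_derivative \<eta> (at A) (0, 1) = b A - b (A - (0, \<epsilon>))) \<and>
    (\<forall>A. b A \<noteq> 0 \<longrightarrow> norm A \<le> 2 * \<kappa>) \<and> (\<forall>A. \<eta> A \<noteq> 0 \<longrightarrow> norm A \<le> 2 * \<kappa> + \<epsilon>) \<and>
    (\<integral>A. b A \<partial>lborel) = 1 \<and> (\<integral>A. \<eta> A \<partial>lborel) = \<epsilon>"

text \<open>A bump \<open>Z\<close> in the space variable is multiplied by the difference of two
  shifted copies of an antiderivative \<open>R\<close> of a bump, which is a smoothed indicator of
  an interval. Its derivative in \<open>t\<close> is the difference of the two bumps. Dividing both
  functions by the mass \<open>c\<close> of \<open>b0\<close> turns the end bump into a probability
  density.\<close>

lemma plateau_exists:
  fixes \<kappa> \<epsilon> :: real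
  assumes \<kappa>: "\<kappa> > 0" and \<epsilon>: "\<epsilon> > 0"
  obtains \<eta> b :: "'a::euclidean_space \<times> real \<Rightarrow> real" where "plateau \<kappa> \<epsilon> \<eta> b"
proof -
  obtain Z :: "'a \<Rightarrow> real" where Z: "\<And>k. Ck k Z" "\<And>x. Z x \<ge> 0" "\<And>x. Z x > 0 \<longleftrightarrow> norm x < 1"
    using smooth_bump_exists by metis
  obtain \<rho> :: "real \<Rightarrow> real" where \<rho>: "\<And>k. Ck k \<rho>" "\<And>x. \<rho> x \<ge> 0" "\<And>x. \<rho> x > 0 \<longleftrightarrow> norm x < 1"
    using smooth_bump_exists by metis
  obtain R where R: "\<And>k. Ck k R" "\<And>x. (R has_real_derivative \<rho> x) (at x)"
    using Ck_antiderivative[OF \<rho>(1)] by metis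
  have R_diff: "\<exists>\<xi>. x < \<xi> \<and> \<xi> < y \<and> R y - R x = (y - x) * \<rho> \<xi>" if "x < y" for x y
    using MVT2[OF that, of R \<rho>] R(2) by auto
  have R_mono: "R x \<le> R y" if xy: "x \<le> y" for x y
  proof (cases "x = y")
    case False
    then obtain \<xi> where "R y - R x = (y - x) * \<rho> \<xi>" using R_diff[of x y] xy by auto
    moreover have "(y - x) * \<rho> \<xi> \<ge> 0" using xy \<rho>(2) by simp
    ultimately show ?thesis by linarith
  qed simp
  \<comment> \<open>\<open>R\<close> is constant on either side of the interval from -1 to 1, so the
    two shifted copies cancel below and above the thickened segment; this gives the support of
    \<open>\<eta>0\<close>.\<close>
  have R_const: "R x = R y" if out: "(x \<le> -1 \<and> y \<le> -1) \<or> (x \<ge> 1 \<and> y \<ge> 1)" for x y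
  proof -
    have "R x = R y" if xy: "x < y" "(x \<le> -1 \<and> y \<le> -1) \<or> (x \<ge> 1 \<and> y \<ge> 1)" for x y
    proof -
      obtain \<xi> where "x < \<xi>" "\<xi> < y" "R y - R x = (y - x) * \<rho> \<xi>" using R_diff[OF xy(1)] by auto
      moreover from this have "\<rho> \<xi> = 0" using \<rho>(2)[of \<xi>] \<rho>(3)[of \<xi>] xy(2) by auto
      ultimately show ?thesis by simp
    qed
    note * = this
    show ?thesis
    proof (cases x y rule: linorder_cases)
      case less
      then show ?thesis using out by (rule *)
    next
      case greater
      moreover have "(y \<le> -1 \<and> x \<le> -1) \<or> (y \<ge> 1 \<and> x \<ge> 1)" using out by blast
      ultimately show ?thesis using *[of y x] by simp
    qed simp
  qed
  define b0 :: "'a \<times> real \<Rightarrow> real" where "b0 A = Z (fst A /\<^sub>R \<kappa>) * \<rho> (snd A / \<kappa>)" for A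
  define \<eta>0 :: "'a \<times> real \<Rightarrow> real" where
    "\<eta>0 A = Z (fst A /\<^sub>R \<kappa>) * (\<kappa> * (R (snd A / \<kappa>) - R ((snd A - \<epsilon>) / \<kappa>)))" for A
  have CkZ: "Ck k (\<lambda>A::'a \<times> real. Z (fst A /\<^sub>R \<kappa>))" for k
    by (rule Ck_compose_linear[OF Z(1)]) (intro bounded_linear_intros)
  have CkL: "Ck k (\<lambda>A::'a \<times> real. f ((snd A - c) / \<kappa>))" if "\<And>k. Ck k f" for k c and f :: "real \<Rightarrow> real"
    unfolding divide_inverse
    by (rule Ck_compose[OF that])
       (intro Ck_mult Ck_diff Ck_const Ck_bounded_linear bounded_linear_snd)
  have Ckb0: "Ck k b0" for k
    unfolding b0_def using CkL[OF \<rho>(1), of k 0] by (auto intro: Ck_mult CkZ)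
  have Ck\<eta>0: "Ck k \<eta>0" for k
    unfolding \<eta>0_def using CkL[OF R(1), of k 0] CkL[OF R(1), of k \<epsilon>]
    by (auto intro!: Ck_mult CkZ Ck_const Ck_diff)
  have b0_nn: "b0 A \<ge> 0" for A unfolding b0_def using Z(2) \<rho>(2) by simp
  have \<eta>0_nn: "\<eta>0 A \<ge> 0" for A
    unfolding \<eta>0_def using Z(2) \<kappa> \<epsilon> by (intro mult_nonneg_nonneg) (auto intro!: R_mono
        divide_right_mono)
  have Zsupp: "norm z < \<kappa>" if "Z (z /\<^sub>R \<kappa>) \<noteq> 0" for z
    using Z(2,3)[of "z /\<^sub>R \<kappa>"] that \<kappa> by (auto simp: less_le field_simps)
  have b0_supp: "norm (fst A) < \<kappa> \<and> \<bar>snd A\<bar> < \<kappa>" if "b0 A \<noteq> 0" for A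
    using that Zsupp[of "fst A"] \<rho>(2,3)[of "snd A / \<kappa>"] \<kappa> by (auto simp: b0_def less_le field_simps)
  have \<eta>0_supp: "norm (fst A) < \<kappa> \<and> - \<kappa> < snd A \<and> snd A < \<epsilon> + \<kappa>" if "\<eta>0 A \<noteq> 0" for A
  proof (intro conjI)
    show "norm (fst A) < \<kappa>" using that Zsupp[of "fst A"] by (auto simp: \<eta>0_def)
    have ne: "R (snd A / \<kappa>) \<noteq> R ((snd A - \<epsilon>) / \<kappa>)" using that by (auto simp: \<eta>0_def)
    show "- \<kappa> < snd A"
    proof (rule ccontr)
      assume "\<not> ?thesis"
      then have "snd A / \<kappa> \<le> -1" "(snd A - \<epsilon>) / \<kappa> \<le> -1" using \<kappa> \<epsilon> by (auto simp: field_simps)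
      with R_const ne show False by blast
    qed
    show "snd A < \<epsilon> + \<kappa>"
    proof (rule ccontr)
      assume "\<not> ?thesis"
      then have "snd A / \<kappa> \<ge> 1" "(snd A - \<epsilon>) / \<kappa> \<ge> 1" using \<kappa> \<epsilon> by (auto simp: field_simps)
      with R_const ne show False by blast
    qed
  qed
  have norm_le: "norm A \<le> norm (fst A) + \<bar>snd A\<bar>" for A :: "'a \<times> real"
    using norm_Pair_le[of "fst A" "snd A"] by simp
  have b0_norm: "norm A \<le> 2 * \<kappa>" if "b0 A \<noteq> 0" for A using b0_supp[OF that] norm_le[of A] by auto
  have \<eta>0_norm: "norm A \<le> 2 * \<kappa> + \<epsilon>" if "\<eta>0 A \<noteq> 0" for A
    using \<eta>0_supp[OF that] norm_le[of A] \<epsilon> \<kappa> by auto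
  have bb0: "bounded {A. b0 A \<noteq> 0}" by (rule boundedI[of _ "2 * \<kappa>"]) (use b0_norm in auto)
  have b\<eta>0: "bounded {A. \<eta>0 A \<noteq> 0}" by (rule boundedI[of _ "2 * \<kappa> + \<epsilon>"]) (use \<eta>0_norm in auto)
  note cb0 = Ck_continuous[OF Ckb0] and c\<eta>0 = Ck_continuous[OF Ck\<eta>0]
  define c where "c = (\<integral>A. b0 A \<partial>lborel)"
  have c: "c > 0" unfolding c_def
    by (rule integral_pos_continuous[OF cb0 bb0 b0_nn, of "(0, 0)"])
       (use Z(3)[of 0] \<rho>(3)[of 0] in \<open>auto simp: b0_def\<close>)
  have line: "((\<lambda>s. \<eta>0 (A + s *\<^sub>R (0, 1))) has_real_derivative
      b0 (A + s *\<^sub>R (0, 1)) - b0 (A + s *\<^sub>R (0, 1) - (0, \<epsilon>))) (at s)" for A s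
  proof -
    have d: "((\<lambda>s. R ((snd A + s - c) / \<kappa>)) has_real_derivative
        \<rho> ((snd A + s - c) / \<kappa>) * (1 / \<kappa>)) (at s)" for c
      by (rule DERIV_chain2[OF R(2)]) (use \<kappa> in \<open>auto intro!: derivative_eq_intros\<close>)
    show ?thesis
      unfolding \<eta>0_def b0_def using d[of 0] d[of \<epsilon>]
      by (auto intro!: derivative_eq_intros simp: algebra_simps less_imp_neq[OF \<kappa>, symmetric])
  qed
  have fr: "frechet_derivative \<eta>0 (at A) (0, 1) = b0 A - b0 (A - (0, \<epsilon>))" for A
  proof -
    have "((\<lambda>s. \<eta>0 (A + s *\<^sub>R (0, 1))) has_real_derivative frechet_derivative \<eta>0 (at A) (0, 1)) (at 0)"
      using has_derivative_along_line[of \<eta>0 "frechet_derivative \<eta>0 (at A)" A 0 "(0, 1)"]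
        smooth_derivative(1)[OF Ck\<eta>0, of A] by (simp flip: zero_prod_def)
    moreover have "((\<lambda>s. \<eta>0 (A + s *\<^sub>R (0, 1))) has_real_derivative b0 A - b0 (A - (0, \<epsilon>))) (at 0)"
      using line[of A 0] by (simp flip: zero_prod_def)
    ultimately show ?thesis by (rule DERIV_unique)
  qed
  \<comment> \<open>The \<open>t\<close>-derivative of \<open>snd A * \<eta>0 A\<close> has integral
    zero. This expresses the mass of \<open>\<eta>0\<close> as the difference of the first moments
    of the two end bumps, which are translates of each other by \<open>\<epsilon>\<close>.\<close>
  have int\<eta>: "(\<integral>A. \<eta>0 A \<partial>lborel) = \<epsilon> * c"
  proof -
    let ?g = "\<lambda>A. (snd A + \<epsilon>) * b0 A"
    have bsh: "bounded {A. b0 (A - (0, \<epsilon>)) \<noteq> 0}"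
    proof (rule boundedI[of _ "2 * \<kappa> + \<epsilon>"])
      fix A assume "A \<in> {A. b0 (A - (0, \<epsilon>)) \<noteq> 0}"
      then show "norm A \<le> 2 * \<kappa> + \<epsilon>" using b0_supp[of "A - (0, \<epsilon>)"] norm_le[of A] \<epsilon> by auto
    qed
    have csh: "continuous_on UNIV (\<lambda>A. b0 (A - (0, \<epsilon>)))"
      by (intro continuous_on_compose2[OF cb0] continuous_intros) auto
    have i: "integrable lborel (\<lambda>A. f A * b0 A)" "integrable lborel (\<lambda>A. f A * b0 (A - (0, \<epsilon>)))"
      if f: "continuous_on UNIV f" for f :: "'a \<times> real \<Rightarrow> real"
    proof -
      have "bounded {A. f A * b0 A \<noteq> 0}" "bounded {A. f A * b0 (A - (0, \<epsilon>)) \<noteq> 0}"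
        by (rule bounded_subset[OF bb0], force) (rule bounded_subset[OF bsh], force)
      then show "integrable lborel (\<lambda>A. f A * b0 A)" "integrable lborel (\<lambda>A. f A * b0 (A - (0, \<epsilon>)))"
        using continuous_on_mult[OF f cb0] continuous_on_mult[OF f csh]
        by (simp_all add: integrable_continuous_bounded_support)
    qed
    have i1: "integrable lborel (\<lambda>A. snd A * b0 A)" "integrable lborel (\<lambda>A. snd A * b0 (A - (0, \<epsilon>)))"
        "integrable lborel \<eta>0" "integrable lborel b0" "integrable lborel ?g"
      using i(1)[of snd] i(2)[of snd] i(1)[of "\<lambda>A. 1"] i(1)[of "\<lambda>A. snd A + \<epsilon>"]
        integrable_continuous_bounded_support[OF c\<eta>0 b\<eta>0]
      by (auto simp: continuous_on_snd continuous_on_add)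
    have "(\<integral>A. (\<eta>0 A + snd A * (b0 A - b0 (A - (0, \<epsilon>)))) \<partial>lborel) = 0"
    proof (rule integral_directional_derivative_0[where f = "\<lambda>A. snd A * \<eta>0 A" and v = "(0, 1)"])
      show "((\<lambda>s. snd (A + s *\<^sub>R (0, 1)) * \<eta>0 (A + s *\<^sub>R (0, 1))) has_real_derivative
          \<eta>0 A + snd A * (b0 A - b0 (A - (0, \<epsilon>)))) (at 0)" for A
        using line[of A 0] by (auto intro!: derivative_eq_intros simp: algebra_simps simp flip:
            zero_prod_def)
    next
      show "bounded {A. snd A * \<eta>0 A \<noteq> 0}" by (rule bounded_subset[OF b\<eta>0]) auto
    qed (intro continuous_intros c\<eta>0 cb0 csh)+
    also have "(\<integral>A. (\<eta>0 A + snd A * (b0 A - b0 (A - (0, \<epsilon>)))) \<partial>lborel) =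
        (\<integral>A. \<eta>0 A \<partial>lborel) + ((\<integral>A. snd A * b0 A \<partial>lborel) - (\<integral>A. snd A * b0 (A - (0, \<epsilon>)) \<partial>lborel))"
      using i1 by (simp add: right_diff_distrib)
    also have "(\<integral>A. snd A * b0 (A - (0, \<epsilon>)) \<partial>lborel) = (\<integral>A. ?g A \<partial>lborel)"
      using lborel_integral_translate[of ?g "- (0, \<epsilon>)"] borel_measurable_integrable[OF i1(5)]
      by (simp add: diff_conv_add_uminus del: add_uminus_conv_diff)
    also have "\<dots> = (\<integral>A. snd A * b0 A \<partial>lborel) + \<epsilon> * c"
      using i1 by (simp add: distrib_right c_def)
    finally show ?thesis by simp
  qed
  have Ck: "Ck k (\<lambda>A. inverse c * \<eta>0 A)" for k by (intro Ck_mult Ck_const Ck\<eta>0)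
  have fr': "frechet_derivative (\<lambda>A. inverse c * \<eta>0 A) (at A) (0, 1) =
      inverse c * b0 A - inverse c * b0 (A - (0, \<epsilon>))" for A
  proof -
    have "((\<lambda>A. inverse c * \<eta>0 A) has_derivative (\<lambda>v. inverse c * frechet_derivative \<eta>0 (at A) v)) (at
        A)"
      by (intro has_derivative_mult_right smooth_derivative(1) Ck\<eta>0)
    then show ?thesis using frechet_derivative_at fr by (metis right_diff_distrib)
  qed
  have "plateau \<kappa> \<epsilon> (\<lambda>A. inverse c * \<eta>0 A) (\<lambda>A. inverse c * b0 A)"
    unfolding plateau_def
    by (intro conjI allI Ck fr' continuous_intros cb0)
       (use c \<eta>0_nn b0_nn b0_norm \<eta>0_norm in \<open>simp_all add: int\<eta> c_def[symmetric]\<close>)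
  then show thesis by (rule that)
qed

lemma plateau_facts:
  fixes \<eta> b :: "'a::euclidean_space \<times> real \<Rightarrow> real"
  assumes "plateau \<kappa> \<epsilon> \<eta> b"
  shows "Ck k \<eta>" "\<eta> A \<ge> 0" "continuous_on UNIV b" "b A \<ge> 0"
    "frechet_derivative \<eta> (at A) (0, 1) = b A - b (A - (0, \<epsilon>))"
    "b A \<noteq> 0 \<Longrightarrow> norm A \<le> 2 * \<kappa>" "\<eta> A \<noteq> 0 \<Longrightarrow> norm A \<le> 2 * \<kappa> + \<epsilon>"
    "(\<integral>A. b A \<partial>lborel) = 1" "(\<integral>A. \<eta> A \<partial>lborel) = \<epsilon>"
  using assms unfolding plateau_def by blast+

section \<open>Transport along characteristics\<close>

text \<open>The coefficient of \<open>\<partial>\<^sub>t\<close> in the linear field with index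
  \<open>j \<noteq> n\<close>.\<close>

definition drift :: "nat \<Rightarrow> (nat \<Rightarrow> 'k::finite) \<Rightarrow> nat \<Rightarrow> real ^ 'k \<Rightarrow> real"
  where "drift n e j z = (if j < n then - (1 / 2) * z $ e (j + n) else 1 / 2 * z $ e (j - n))"

text \<open>Brings all equations into the single form
  \<open>\<partial>\<^sub>z u + \<partial>\<^sub>t flux = w\<close>. The drift may be taken under
  the \<open>t\<close>-derivative because it does not depend on \<open>t\<close>.\<close>

definition flux ::
  "nat \<Rightarrow> (nat \<Rightarrow> 'k::finite) \<Rightarrow> ((real ^ 'k) \<times> real \<Rightarrow> real) \<Rightarrow> nat \<Rightarrow> (real ^ 'k) \<times> real \<Rightarrow> real"
  where "flux n e u j A = (if j = n then (u A)\<^sup>2 / 2 else drift n e j (fst A) * u A)"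

lemma continuous_on_drift [continuous_intros]:
  "continuous_on S f \<Longrightarrow> continuous_on S (\<lambda>x. drift n e j (f x))"
  unfolding drift_def by (cases "j < n") (auto intro!: continuous_intros)

lemma continuous_on_flux:
  "continuous_on S u \<Longrightarrow> continuous_on S (flux n e u j)"
  unfolding flux_def by (cases "j = n") (auto intro!: continuous_intros)

text \<open>Here \<open>u\<close> stands for a bounded global extension of \<open>\<phi>\<close>
  from a ball. Of the right-hand side only its bound on \<open>G\<close> matters, so the equations
  are replaced by an inequality against nonnegative test functions.\<close>

locale weak_balance_law =
  fixes n :: nat and e :: "nat \<Rightarrow> 'k::finite" and u :: "(real ^ 'k) \<times> real \<Rightarrow> real"
    and G :: "((real ^ 'k) \<times> real) set" and B C :: real
  assumes n1: "n \<ge> 1" and num: "coord_numbering n e" and cu: "continuous_on UNIV u"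
    and bu: "\<And>A. \<bar>u A\<bar> \<le> B" and C0: "C \<ge> 0"
    and weak: "\<And>\<psi> j. test_function G \<psi> \<Longrightarrow> (\<And>A. \<psi> A \<ge> 0) \<Longrightarrow> j \<in> {1..2 * n - 1} \<Longrightarrow>
      \<bar>\<integral>A. u A * partial_z e j \<psi> A + flux n e u j A * partial_t \<psi> A \<partial>lborel\<bar> \<le> C * (\<integral>A. \<psi> A \<partial>lborel)"
begin

text \<open>Moving the plateau differentiates it in direction \<open>- v\<close>. Adding the weak
  expression of the plateau, of size at most \<open>C * \<epsilon>\<close>, cancels the space
  derivative and leaves \<open>flux - c * u\<close> against the \<open>t\<close>-derivative, that
  is, against the two end bumps. The constant \<open>k\<close> costs nothing since that
  \<open>t\<close>-derivative has integral zero; it is used to complete the square when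
  \<open>j = n\<close>.\<close>

lemma plateau_transport_derivative:
  assumes pl: "plateau \<kappa> \<epsilon> \<eta> b" and j: "j \<in> {1..2 * n - 1}" and v: "v = (axis (e j) 1, c)"
    and sub: "cball (Q + s *\<^sub>R v) (2 * \<kappa> + \<epsilon>) \<subseteq> G"
    and E: "\<And>A. E A = flux n e u j A - c * u A + k"
  shows "\<exists>M'. ((\<lambda>s. \<integral>A. u A * \<eta> (A - (Q + s *\<^sub>R v)) \<partial>lborel) has_real_derivative M') (at s) \<and>
    \<bar>M' - ((\<integral>A. E A * b (A - (Q + s *\<^sub>R v)) \<partial>lborel) -
           (\<integral>A. E A * b (A - (Q + s *\<^sub>R v + (0, \<epsilon>))) \<partial>lborel))\<bar> \<le> C * \<epsilon>"
proof -
  note pl = plateau_facts[OF pl]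
  define D where "D A w = frechet_derivative \<eta> (at A) w" for A w
  have der\<eta>: "(\<eta> has_derivative D A) (at A)" for A
    unfolding D_def by (rule smooth_derivative(1)) (rule pl(1))
  have cD: "continuous_on UNIV (\<lambda>A. D A w)" for w
    unfolding D_def by (rule smooth_derivative(2)) (rule pl(1))
  have c\<eta>: "continuous_on UNIV \<eta>" by (rule Ck_continuous[OF pl(1)])
  have cE: "continuous_on UNIV E"
    unfolding E by (intro continuous_intros continuous_on_flux cu)
  define P where "P = Q + s *\<^sub>R v"
  define \<psi> where "\<psi> A = \<eta> (A - P)" for A
  have der\<psi>: "(\<psi> has_derivative D (A - P)) (at A)" for A
    unfolding \<psi>_def
    by (rule has_derivative_compose[OF _ der\<eta>, of "\<lambda>x. x - P"
        "\<lambda>v. v" A UNIV]) (auto intro!: derivative_eq_intros)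
  have fr: "frechet_derivative \<psi> (at A) = D (A - P)" for A
    using frechet_derivative_at[OF der\<psi>] by simp
  have supp\<psi>: "A \<in> cball P (2 * \<kappa> + \<epsilon>)" if "\<psi> A \<noteq> 0" for A
    using pl(7) that by (auto simp: \<psi>_def dist_norm norm_minus_commute)
  have test: "test_function G \<psi>"
    unfolding test_function_def compactly_contained_def
  proof (intro conjI allI)
    show "Ck k \<psi>" for k unfolding \<psi>_def by (rule Ck_translate) (rule pl(1))
    have *: "closure {x. \<psi> x \<noteq> 0} \<subseteq> cball P (2 * \<kappa> + \<epsilon>)"
      by (rule closure_minimal) (use supp\<psi> in auto)
    then show "closure {x. \<psi> x \<noteq> 0} \<subseteq> G" using sub by (auto simp: P_def)
    show "compact (closure {x. \<psi> x \<noteq> 0})"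
      using bounded_subset[OF bounded_cball *] by (simp add: compact_eq_bounded_closed)
  qed
  have D0: "D x w = 0" if "norm x > 2 * \<kappa> + \<epsilon>" for x w
  proof -
    have "(\<eta> has_derivative (\<lambda>_. 0)) (at x)"
    proof (rule has_derivative_transform_within_open[where f = "\<lambda>_. 0"])
      show "open {x. norm x > 2 * \<kappa> + \<epsilon>}" by (intro open_Collect_less continuous_intros)
    qed (use that pl(7) in force)+
    from has_derivative_unique[OF der\<eta> this] show ?thesis by simp
  qed
  have bD: "bounded {A. D (A - R) w \<noteq> 0}" for w R
  proof (rule boundedI[of _ "2 * \<kappa> + \<epsilon> + norm R"])
    fix A assume "A \<in> {A. D (A - R) w \<noteq> 0}"
    then have "norm (A - R) \<le> 2 * \<kappa> + \<epsilon>" using D0[of "A - R" w] by force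
    then show "norm A \<le> 2 * \<kappa> + \<epsilon> + norm R" using norm_triangle_sub[of A R] by simp
  qed
  have bb: "bounded {A. b (A - R) \<noteq> 0}" for R
  proof (rule boundedI[of _ "2 * \<kappa> + norm R"])
    fix A assume "A \<in> {A. b (A - R) \<noteq> 0}"
    then have "norm (A - R) \<le> 2 * \<kappa>" using pl(6) by blast
    then show "norm A \<le> 2 * \<kappa> + norm R" using norm_triangle_sub[of A R] by simp
  qed
  have ib: "integrable lborel (\<lambda>A. f A * b (A - R))" if "continuous_on UNIV f" for f R
    by (rule integrable_continuous_bounded_support)
       (auto intro!: continuous_intros that continuous_on_compose2[OF pl(3)] bounded_subset[OF bb[of
           R]])
  have iD: "integrable lborel (\<lambda>A. f A * D (A - R) w)" if "continuous_on UNIV f" for f R w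
    by (rule integrable_continuous_bounded_support)
       (auto intro!: continuous_intros that continuous_on_compose2[OF cD] bounded_subset[OF bD[of R w]])
  have linD: "D A v = D A (axis (e j) 1, 0) + c * D A (0, 1)" for A
  proof -
    have "v = (axis (e j) 1, 0) + c *\<^sub>R (0, 1)" by (simp add: v)
    moreover note linear_add[OF has_derivative_linear[OF der\<eta>], of A "(axis (e j) 1, 0)" "c *\<^sub>R (0, 1)"]
      linear_scale[OF has_derivative_linear[OF der\<eta>], of A c "(0, 1)"]
    ultimately show ?thesis by (simp only: real_scaleR_def)
  qed
  define M' where "M' = (\<integral>A. u A * - D (A - (Q + s *\<^sub>R v)) v \<partial>lborel)"
  have deriv: "((\<lambda>s. \<integral>A. u A * \<eta> (A - (Q + s *\<^sub>R v)) \<partial>lborel) has_real_derivative M') (at s)"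
    unfolding M'_def
  proof (rule leibniz_lborel[where U = "{s - 1<..<s + 1}"
      and S = "cball 0 (2 * \<kappa> + \<epsilon> + norm Q + (\<bar>s\<bar> + 1) * norm v)"])
    fix r A
    have "((\<lambda>r. \<eta> ((A - Q) + r *\<^sub>R - v)) has_real_derivative D ((A - Q) + r *\<^sub>R - v) (- v)) (at r)"
      by (rule has_derivative_along_line) (rule der\<eta>)
    then have "((\<lambda>r. \<eta> (A - (Q + r *\<^sub>R v))) has_real_derivative - D (A - (Q + r *\<^sub>R v)) v) (at r)"
      using linear_neg[OF has_derivative_linear[OF der\<eta>]] by (simp add: algebra_simps)
    then show "((\<lambda>r. u A * \<eta> (A - (Q + r *\<^sub>R v))) has_real_derivative
        u A * - D (A - (Q + r *\<^sub>R v)) v) (at r)"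
      by (rule DERIV_cmult)
  next
    fix r and A :: "(real ^ 'k) \<times> real"
    assume r: "r \<in> {s - 1<..<s + 1}" and A: "A \<notin> cball 0 (2 * \<kappa> + \<epsilon> + norm Q + (\<bar>s\<bar> + 1) * norm v)"
    have "norm (r *\<^sub>R v) \<le> (\<bar>s\<bar> + 1) * norm v" using r by (auto intro!: mult_right_mono)
    then have "norm (Q + r *\<^sub>R v) \<le> norm Q + (\<bar>s\<bar> + 1) * norm v" using norm_triangle_le[of Q "r *\<^sub>R v"]
        by simp
    then have "norm (A - (Q + r *\<^sub>R v)) > 2 * \<kappa> + \<epsilon>" using A norm_triangle_sub[of A "Q + r *\<^sub>R v"]
        by simp
    then show "u A * \<eta> (A - (Q + r *\<^sub>R v)) = 0" using pl(7)[of "A - (Q + r *\<^sub>R v)"] by force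
  qed (auto simp: case_prod_beta intro!: continuous_intros continuous_on_compose2[OF cu]
        continuous_on_compose2[OF c\<eta>] continuous_on_compose2[OF cD])
  define W where "W = (\<integral>A. u A * partial_z e j \<psi> A + flux n e u j A * partial_t \<psi> A \<partial>lborel)"
  have W: "\<bar>W\<bar> \<le> C * \<epsilon>"
  proof -
    have "(\<integral>A. \<psi> A \<partial>lborel) = \<epsilon>"
      using lborel_integral_translate[of \<eta> "- P"] pl(9) borel_measurable_continuous_onI[OF c\<eta>]
      by (simp add: \<psi>_def)
    then show ?thesis unfolding W_def using weak[OF test _ j] pl(2) by (simp add: \<psi>_def)
  qed
  have "(\<integral>A. 1 * D (A - P) (0, 1) \<partial>lborel) = 0"
  proof (rule integral_directional_derivative_0[where f = \<psi> and v = "(0, 1)"])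
    show "((\<lambda>s. \<psi> (x + s *\<^sub>R (0, 1))) has_real_derivative 1 * D (x - P) (0, 1)) (at 0)" for x
      using has_derivative_along_line[of \<psi> "D (x - P)" x 0 "(0, 1)"] der\<psi>[of x]
          by (simp flip: zero_prod_def)
    show "bounded {x. \<psi> x \<noteq> 0}"
      by (rule bounded_subset[OF bounded_cball[of P "2 * \<kappa> + \<epsilon>"]]) (use supp\<psi> in auto)
  qed (auto simp: \<psi>_def intro!: continuous_intros continuous_on_compose2[OF cD]
      continuous_on_compose2[OF c\<eta>])
  then have k0: "(\<integral>A. k * D (A - P) (0, 1) \<partial>lborel) = 0" by simp
  have fl: "continuous_on UNIV (flux n e u j)" by (rule continuous_on_flux[OF cu])
  have "M' + W = (\<integral>A. - (u A * D (A - P) v) + (u A * partial_z e j \<psi> A +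
      flux n e u j A * partial_t \<psi> A) \<partial>lborel)"
    unfolding M'_def W_def P_def[symmetric] partial_z_def partial_t_def fr
    by (subst Bochner_Integration.integral_add)
       (use iD[OF cu] iD[OF fl] in auto)
  also have "\<dots> = (\<integral>A. (E A * D (A - P) (0, 1)) - k * D (A - P) (0, 1) \<partial>lborel)"
    by (rule Bochner_Integration.integral_cong)
       (auto simp: linD fr partial_z_def partial_t_def E algebra_simps)
  also have "\<dots> = (\<integral>A. E A * D (A - P) (0, 1) \<partial>lborel)"
    using k0 iD[OF cE] iD[OF continuous_on_const, of k] by simp
  also have "\<dots> = (\<integral>A. E A * b (A - P) - E A * b (A - (P + (0, \<epsilon>))) \<partial>lborel)"
    unfolding D_def pl(5) by (simp add: algebra_simps)
  also have "\<dots> = (\<integral>A. E A * b (A - P) \<partial>lborel) - (\<integral>A. E A * b (A - (P + (0, \<epsilon>))) \<partial>lborel)"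
    using ib[OF cE] by simp
  finally show ?thesis using deriv W by (intro exI[of _ M']) (simp add: P_def)
qed

lemma integral_times_bump_le:
  assumes "plateau \<kappa> \<epsilon> \<eta> b" "continuous_on UNIV E" "\<And>A. dist A P \<le> 2 * \<kappa> \<Longrightarrow> E A \<le> \<delta>"
  shows "(\<integral>A. E A * b (A - P) \<partial>lborel) \<le> \<delta>"
proof -
  note pl = plateau_facts[OF assms(1)]
  have supp: "dist A P \<le> 2 * \<kappa>" if "b (A - P) \<noteq> 0" for A
    using pl(6)[OF that] by (simp add: dist_norm)
  have bb: "bounded {A. b (A - P) \<noteq> 0}"
    by (rule bounded_subset[OF bounded_cball[of P "2 * \<kappa>"]]) (use supp in \<open>auto simp: dist_commute\<close>)
  have i: "integrable lborel (\<lambda>A. f A * b (A - P))" if "continuous_on UNIV f" for f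
    by (rule integrable_continuous_bounded_support)
       (auto intro!: continuous_intros that continuous_on_compose2[OF pl(3)] bounded_subset[OF bb])
  have "(\<integral>A. E A * b (A - P) \<partial>lborel) \<le> (\<integral>A. \<delta> * b (A - P) \<partial>lborel)"
  proof (rule integral_mono[OF i[OF assms(2)] i[OF continuous_on_const]])
    fix A show "E A * b (A - P) \<le> \<delta> * b (A - P)"
      using assms(3)[OF supp, of A] pl(4)[of "A - P"] by (cases "b (A - P) =
          0") (auto intro: mult_right_mono)
  qed
  also have "\<dots> = \<delta>"
    using lborel_integral_translate[of b "- P"] pl(8) borel_measurable_continuous_onI[OF pl(3)] by simp
  finally show ?thesis .
qed

lemma integral_times_bump_ge:
  assumes "plateau \<kappa> \<epsilon> \<eta> b" "continuous_on UNIV E" "\<And>A. dist A P \<le> 2 * \<kappa> \<Longrightarrow> E A \<ge> - \<delta>"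
  shows "(\<integral>A. E A * b (A - P) \<partial>lborel) \<ge> - \<delta>"
  using integral_times_bump_le[OF assms(1), of "\<lambda>A. - E A" P \<delta>] assms(2,3)
  by (fastforce intro: continuous_intros)

text \<open>The derivative is known only up to an error at each time separately. The mean value
  theorem selects one time and so avoids integrating the end terms in \<open>s\<close>.\<close>

lemma plateau_transport_mean_value:
  assumes pl: "plateau \<kappa> \<epsilon> \<eta> b" and j: "j \<in> {1..2 * n - 1}" and v: "v = (axis (e j) 1, c)"
      and \<tau>: "\<tau> \<ge> 0"
    and sub: "\<And>s. 0 \<le> s \<Longrightarrow> s \<le> \<tau> \<Longrightarrow> cball (Q + s *\<^sub>R v) (2 * \<kappa> + \<epsilon>) \<subseteq> G"
    and E: "\<And>A. E A = flux n e u j A - c * u A + k"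
    and m: "\<And>P. m P = (\<integral>A. u A * \<eta> (A - P) \<partial>lborel)"
  obtains s where "0 \<le> s" "s \<le> \<tau>"
    "\<bar>m (Q + \<tau> *\<^sub>R v) - m Q - \<tau> * ((\<integral>A. E A * b (A - (Q + s *\<^sub>R v)) \<partial>lborel) -
       (\<integral>A. E A * b (A - (Q + s *\<^sub>R v + (0, \<epsilon>))) \<partial>lborel))\<bar> \<le> C * \<epsilon> * \<tau>"
proof -
  let ?M = "\<lambda>s. m (Q + s *\<^sub>R v)"
  let ?D = "\<lambda>s. (\<integral>A. E A * b (A - (Q + s *\<^sub>R v)) \<partial>lborel) -
    (\<integral>A. E A * b (A - (Q + s *\<^sub>R v + (0, \<epsilon>))) \<partial>lborel)"
  have "\<forall>s\<in>{0..\<tau>}. \<exists>M'. (?M has_real_derivative M') (at s) \<and> \<bar>M' - ?D s\<bar> \<le> C * \<epsilon>"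
    unfolding m using plateau_transport_derivative[OF pl j v sub E] by simp
  from bchoice[OF this] obtain M' where
    "\<forall>s\<in>{0..\<tau>}. (?M has_real_derivative M' s) (at s) \<and> \<bar>M' s - ?D s\<bar> \<le> C * \<epsilon>" ..
  then have M': "\<And>s. 0 \<le> s \<Longrightarrow> s \<le> \<tau> \<Longrightarrow> (?M has_real_derivative M' s) (at s)"
      "\<And>s. 0 \<le> s \<Longrightarrow> s \<le> \<tau> \<Longrightarrow> \<bar>M' s - ?D s\<bar> \<le> C * \<epsilon>" by simp_all
  have "\<exists>s. 0 \<le> s \<and> s \<le> \<tau> \<and> m (Q + \<tau> *\<^sub>R v) - m Q = \<tau> * M' s"
  proof (cases "\<tau> = 0")
    case False
    then obtain s where "0 < s" "s < \<tau>" "?M \<tau> - ?M 0 = (\<tau> - 0) * M' s"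
      using MVT2[of 0 \<tau> ?M M'] M'(1) \<tau> by (metis less_le)
    then show ?thesis by (intro exI[of _ s]) simp
  qed auto
  then obtain s where s: "0 \<le> s" "s \<le> \<tau>" "m (Q + \<tau> *\<^sub>R v) - m Q = \<tau> * M' s" by blast
  have "\<bar>\<tau> * M' s - \<tau> * ?D s\<bar> = \<bar>M' s - ?D s\<bar> * \<tau>" 
    using \<tau> by (simp add: abs_mult flip: right_diff_distrib)
  also have "\<dots> \<le> C * \<epsilon> * \<tau>" using M'(2)[OF s(1,2)] \<tau> by (rule mult_right_mono)
  finally show thesis using s by (intro that) simp_all
qed

text \<open>The lower end bump enters with a plus sign and the upper one with a minus sign, so
  \<open>E\<close> must be bounded above at the lower end and below at the upper end. For the
  opposite inequality the two ends exchange roles.\<close>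

lemma plateau_transport_le:
  assumes pl: "plateau \<kappa> \<epsilon> \<eta> b" and j: "j \<in> {1..2 * n - 1}" and v: "v = (axis (e j) 1, c)"
      and \<tau>: "\<tau> \<ge> 0"
    and sub: "\<And>s. 0 \<le> s \<Longrightarrow> s \<le> \<tau> \<Longrightarrow> cball (Q + s *\<^sub>R v) (2 * \<kappa> + \<epsilon>) \<subseteq> G"
    and E: "\<And>A. E A = flux n e u j A - c * u A + k"
    and m: "\<And>P. m P = (\<integral>A. u A * \<eta> (A - P) \<partial>lborel)"
    and d1: "\<And>s A. 0 \<le> s \<Longrightarrow> s \<le> \<tau> \<Longrightarrow> dist A (Q + s *\<^sub>R v) \<le> 2 * \<kappa> \<Longrightarrow> E A \<le> \<delta>"
    and d2: "\<And>s A. 0 \<le> s \<Longrightarrow> s \<le> \<tau> \<Longrightarrow> dist A (Q + s *\<^sub>R v + (0, \<epsilon>)) \<le> 2 * \<kappa> \<Longrightarrow> E A \<ge> - \<delta>'"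
  shows "m (Q + \<tau> *\<^sub>R v) - m Q \<le> (C * \<epsilon> + \<delta> + \<delta>') * \<tau>"
proof -
  have cE: "continuous_on UNIV E"
    unfolding E by (intro continuous_intros continuous_on_flux cu)
  let ?I = "\<lambda>s. (\<integral>A. E A * b (A - (Q + s *\<^sub>R v)) \<partial>lborel)"
  let ?J = "\<lambda>s. (\<integral>A. E A * b (A - (Q + s *\<^sub>R v + (0, \<epsilon>))) \<partial>lborel)"
  obtain s where s: "0 \<le> s" "s \<le> \<tau>" "\<bar>m (Q + \<tau> *\<^sub>R v) - m Q - \<tau> * (?I s - ?J s)\<bar> \<le> C * \<epsilon> * \<tau>"
    by (rule plateau_transport_mean_value[OF pl j v \<tau> sub E m])
  have "?I s \<le> \<delta>" by (rule integral_times_bump_le[OF pl cE d1[OF s(1,2)]])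
  moreover have "?J s \<ge> - \<delta>'" by (rule integral_times_bump_ge[OF pl cE d2[OF s(1,2)]])
  ultimately have "\<tau> * (?I s - ?J s) \<le> \<tau> * (\<delta> + \<delta>')" using \<tau> by (intro mult_left_mono) auto
  then show ?thesis using s(3) by (simp add: abs_le_iff algebra_simps)
qed

lemma plateau_transport_ge:
  assumes pl: "plateau \<kappa> \<epsilon> \<eta> b" and j: "j \<in> {1..2 * n - 1}" and v: "v = (axis (e j) 1, c)"
      and \<tau>: "\<tau> \<ge> 0"
    and sub: "\<And>s. 0 \<le> s \<Longrightarrow> s \<le> \<tau> \<Longrightarrow> cball (Q + s *\<^sub>R v) (2 * \<kappa> + \<epsilon>) \<subseteq> G"
    and E: "\<And>A. E A = flux n e u j A - c * u A + k"
    and m: "\<And>P. m P = (\<integral>A. u A * \<eta> (A - P) \<partial>lborel)"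
    and d1: "\<And>s A. 0 \<le> s \<Longrightarrow> s \<le> \<tau> \<Longrightarrow> dist A (Q + s *\<^sub>R v) \<le> 2 * \<kappa> \<Longrightarrow> E A \<ge> - \<delta>'"
    and d2: "\<And>s A. 0 \<le> s \<Longrightarrow> s \<le> \<tau> \<Longrightarrow> dist A (Q + s *\<^sub>R v + (0, \<epsilon>)) \<le> 2 * \<kappa> \<Longrightarrow> E A \<le> \<delta>"
  shows "m Q - m (Q + \<tau> *\<^sub>R v) \<le> (C * \<epsilon> + \<delta> + \<delta>') * \<tau>"
proof -
  have cE: "continuous_on UNIV E"
    unfolding E by (intro continuous_intros continuous_on_flux cu)
  let ?I = "\<lambda>s. (\<integral>A. E A * b (A - (Q + s *\<^sub>R v)) \<partial>lborel)"
  let ?J = "\<lambda>s. (\<integral>A. E A * b (A - (Q + s *\<^sub>R v + (0, \<epsilon>))) \<partial>lborel)"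
  obtain s where s: "0 \<le> s" "s \<le> \<tau>" "\<bar>m (Q + \<tau> *\<^sub>R v) - m Q - \<tau> * (?I s - ?J s)\<bar> \<le> C * \<epsilon> * \<tau>"
    by (rule plateau_transport_mean_value[OF pl j v \<tau> sub E m])
  have "?I s \<ge> - \<delta>'" by (rule integral_times_bump_ge[OF pl cE d1[OF s(1,2)]])
  moreover have "?J s \<le> \<delta>" by (rule integral_times_bump_le[OF pl cE d2[OF s(1,2)]])
  ultimately have "\<tau> * (?J s - ?I s) \<le> \<tau> * (\<delta> + \<delta>')" using \<tau> by (intro mult_left_mono) auto
  then show ?thesis using s(3) by (simp add: abs_le_iff algebra_simps)
qed

lemma plateau_mean_close:
  assumes pl: "plateau \<kappa> \<epsilon> \<eta> b" and "\<And>A. dist A P \<le> 2 * \<kappa> + \<epsilon> \<Longrightarrow> \<bar>u A - a\<bar> \<le> \<omega>"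
  shows "\<bar>(\<integral>A. u A * \<eta> (A - P) \<partial>lborel) - a * \<epsilon>\<bar> \<le> \<omega> * \<epsilon>"
proof -
  note pl = plateau_facts[OF pl]
  have c\<eta>: "continuous_on UNIV \<eta>" by (rule Ck_continuous[OF pl(1)])
  have supp: "dist A P \<le> 2 * \<kappa> + \<epsilon>" if "\<eta> (A - P) \<noteq> 0" for A
    using pl(7)[OF that] by (simp add: dist_norm)
  have bb: "bounded {A. \<eta> (A - P) \<noteq> 0}"
    by (rule bounded_subset[OF bounded_cball[of P "2 * \<kappa> + \<epsilon>"]]) (use supp in \<open>auto simp: dist_commute\<close>)
  have i: "integrable lborel (\<lambda>A. f A * \<eta> (A - P))" if "continuous_on UNIV f" for f
    by (rule integrable_continuous_bounded_support)
       (auto intro!: continuous_intros that continuous_on_compose2[OF c\<eta>] bounded_subset[OF bb])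
  have I\<eta>: "(\<integral>A. r * \<eta> (A - P) \<partial>lborel) = r * \<epsilon>" for r
    using lborel_integral_translate[of \<eta> "- P"] pl(9) borel_measurable_continuous_onI[OF c\<eta>] by simp
  have *: "\<bar>(u A - a) * \<eta> (A - P)\<bar> \<le> \<omega> * \<eta> (A - P)" for A
    using assms(2)[OF supp, of A] pl(2)[of "A - P"]
    by (cases "\<eta> (A - P) = 0") (auto simp: abs_mult intro: mult_right_mono)
  have "(\<integral>A. u A * \<eta> (A - P) \<partial>lborel) - a * \<epsilon> = (\<integral>A. (u A - a) * \<eta> (A - P) \<partial>lborel)"
    unfolding left_diff_distrib I\<eta>[of a, symmetric]
    by (rule Bochner_Integration.integral_diff[OF i[OF cu] i[OF continuous_on_const], symmetric])
  also have "\<bar>\<dots>\<bar> \<le> (\<integral>A. \<bar>(u A - a) * \<eta> (A - P)\<bar> \<partial>lborel)" by (rule integral_abs_bound)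
  also have "\<dots> \<le> (\<integral>A. \<omega> * \<eta> (A - P) \<partial>lborel)"
    by (rule integral_mono[OF integrable_abs[OF i] i]) (use * cu in \<open>auto intro!: continuous_intros\<close>)
  also have "\<dots> = \<omega> * \<epsilon>" by (rule I\<eta>)
  finally show ?thesis .
qed

end

lemma coord_numbering_inj:
  assumes "coord_numbering n e" "i \<in> {1..2 * n - 1}" "j \<in> {1..2 * n - 1}"
  shows "e i = e j \<longleftrightarrow> i = j"
  using assms by (auto simp: coord_numbering_def bij_betw_def inj_on_def)

text \<open>The coordinate with index \<open>j\<close> does not occur in its own drift coefficient,
  so straight lines in the direction of a linear field are exact characteristics.\<close>

lemma drift_add_axis:
  assumes "coord_numbering n e" "j \<in> {1..2 * n - 1}" "j \<noteq> n"
  shows "drift n e j (z + s *\<^sub>R axis (e j) 1) = drift n e j z"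
proof -
  have "j < n \<Longrightarrow> e (j + n) \<noteq> e j"
    using coord_numbering_inj[OF assms(1) _ assms(2), of "j + n"] assms(2,3) by auto
  moreover have "\<not> j < n \<Longrightarrow> e (j - n) \<noteq> e j"
    using coord_numbering_inj[OF assms(1) _ assms(2), of "j - n"] assms(2,3)
    by (cases "n = 0") (auto, linarith)
  ultimately  show ?thesis by (auto simp: drift_def axis_def)
qed

lemma drift_diff: "drift n e j z - drift n e j z' = drift n e j (z - z')"
  by (simp add: drift_def algebra_simps)

lemma drift_le: "\<bar>drift n e j z\<bar> \<le> norm z / 2"
  using component_le_norm_cart[of z "e (j + n)"] component_le_norm_cart[of z "e (j - n)"]
  by (auto simp: drift_def abs_mult)

lemma drift_diff_le: "\<bar>drift n e j z - drift n e j z'\<bar> \<le> norm (z - z') / 2"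
  unfolding drift_diff by (rule drift_le)

text \<open>Passage from means to values. The pair \<open>a\<close>, \<open>a'\<close> bounds
  \<open>p - q\<close> from above and the pair \<open>b\<close>, \<open>b'\<close> from below; the
  pairs may belong to different plateaus, as they do for the nonlinear field.\<close>

lemma abs_diff_le_of_close:
  fixes \<epsilon> :: real
  assumes "\<epsilon> > 0" "a - a' \<le> S * \<epsilon>" "b' - b \<le> S * \<epsilon>"
    "\<bar>a - p * \<epsilon>\<bar> \<le> \<beta> / 2 * \<epsilon>" "\<bar>a' - q * \<epsilon>\<bar> \<le> \<beta> / 2 * \<epsilon>"
    "\<bar>b - p * \<epsilon>\<bar> \<le> \<beta> / 2 * \<epsilon>" "\<bar>b' - q * \<epsilon>\<bar> \<le> \<beta> / 2 * \<epsilon>"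
  shows "\<bar>p - q\<bar> \<le> S + \<beta>"
proof -
  have "\<bar>p * \<epsilon> - q * \<epsilon>\<bar> \<le> S * \<epsilon> + \<beta> * \<epsilon>" using assms(2-) by linarith
  moreover have "\<bar>p * \<epsilon> - q * \<epsilon>\<bar> = \<bar>p - q\<bar> * \<epsilon>"
    using assms(1) by (simp add: abs_mult flip: left_diff_distrib)
  ultimately have "\<bar>p - q\<bar> * \<epsilon> \<le> (S + \<beta>) * \<epsilon>" by (simp add: distrib_right)
  then show ?thesis using assms(1) by simp
qed

context weak_balance_law
begin

lemma B0: "B \<ge> 0"
  using bu[of 0] by linarith

lemma uniformly_continuous_cball:
  assumes "\<delta> > 0"
  obtains d where "d > 0" "\<And>X Y. X \<in> cball P R \<Longrightarrow> Y \<in> cball P R \<Longrightarrow> dist X Y \<le> d \<Longrightarrow> \<bar>u X - u Y\<bar> \<le> \<delta>"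
proof -
  have "uniformly_continuous_on (cball P R) u"
    by (intro compact_uniformly_continuous continuous_on_subset[OF cu]) auto
  from this[unfolded uniformly_continuous_on_def, rule_format, OF assms]
  obtain d where d: "d > 0" "\<And>X Y. X \<in> cball P R \<Longrightarrow> Y \<in> cball P R \<Longrightarrow> dist Y X < d \<Longrightarrow> dist (u Y) (u X) < \<delta>"
    by blast
  show thesis
  proof (rule that[of "d / 2"])
    fix X Y assume "X \<in> cball P R" "Y \<in> cball P R" "dist X Y \<le> d / 2"
    then show "\<bar>u X - u Y\<bar> \<le> \<delta>" using d(2)[of Y X] d(1) by (simp add: dist_real_def)
  qed (use d in simp)
qed

section \<open>Euler polygons of the nonlinear field\<close>

definition euler_step :: "real \<Rightarrow> (real ^ 'k) \<times> real \<Rightarrow> (real ^ 'k) \<times> real"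
  where "euler_step \<tau> X = X + \<tau> *\<^sub>R (axis (e n) 1, u X)"

lemma norm_axis_Pair_le: "norm (axis i (1::real), c) \<le> 1 + \<bar>c\<bar>"
  using norm_Pair_le[of "axis i (1::real)" c] by simp

lemma dist_euler: "dist ((euler_step \<tau> ^^ i) A) A \<le> real i * (\<bar>\<tau>\<bar> * (1 + B))"
proof (induction i)
  case (Suc i)
  let ?X = "(euler_step \<tau> ^^ i) A"
  have "norm (axis (e n) (1::real), u ?X) \<le> 1 + B"
    using norm_axis_Pair_le[of "e n" "u ?X"] bu[of ?X] by linarith
  then have "dist (euler_step \<tau> ?X) ?X \<le> \<bar>\<tau>\<bar> * (1 + B)"
    by (simp add: euler_step_def dist_norm mult_left_mono del: scaleR_Pair)
  then show ?case using Suc dist_triangle[of "euler_step \<tau> ?X" A ?X] by (simp add: algebra_simps)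
qed simp

lemma fst_euler: "fst ((euler_step \<tau> ^^ i) A) = fst A + (real i * \<tau>) *\<^sub>R axis (e n) 1"
  by (induction i) (auto simp: euler_step_def algebra_simps)

text \<open>
  The bound telescopes for the means of \<open>u\<close> over plateaus just above (or below) the vertices of the
  polygon. The defect of a polygon that is not an exact characteristic enters only quadratically,
  divided by the height \<open>\<epsilon>\<close> of the plateau, so \<open>\<epsilon>\<close> is fixed before the mesh is refined.
\<close>

lemma euler_Lipschitz:
  assumes R: "R > 0" "cball P R \<subseteq> G" and \<beta>: "\<beta> > 0"
  obtains \<tau>0 where "\<tau>0 > 0"
    "\<And>\<tau> A i. \<bar>\<tau>\<bar> \<le> \<tau>0 \<Longrightarrow> dist A P \<le> R / 4 \<Longrightarrow> real i * (\<bar>\<tau>\<bar> * (1 + B)) \<le> R / 4 \<Longrightarrow>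
      \<bar>u ((euler_step \<tau> ^^ i) A) - u A\<bar> \<le> (C + \<beta>) * (real i * \<bar>\<tau>\<bar>) + \<beta>"
proof -
  obtain d1 where d1: "d1 > 0" "\<And>X Y. X \<in> cball P R \<Longrightarrow> Y \<in> cball P R \<Longrightarrow> dist X Y \<le> d1 \<Longrightarrow>
      \<bar>u X - u Y\<bar> \<le> \<beta> / 2"
    using uniformly_continuous_cball[of "\<beta> / 2"] \<beta> by (metis half_gt_zero)
  \<comment> \<open>Over distances up to \<open>4 * \<epsilon>\<close> the oscillation of
    \<open>u\<close> is at most \<open>\<beta> / 2\<close>, and plateaus of this height attached to
    points within \<open>R / 2\<close> of \<open>P\<close> stay in the ball.\<close>
  define \<epsilon> where "\<epsilon> = min d1 R / 8"
  have \<epsilon>: "\<epsilon> > 0" "4 * \<epsilon> \<le> d1" "8 * \<epsilon> \<le> R" using d1 R by (auto simp: \<epsilon>_def)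
  \<comment> \<open>A slope error of at most \<open>\<delta>\<close> enters as
    \<open>\<delta>\<^sup>2 / 2 = \<beta> * \<epsilon>\<close>; after division by the mass
    \<open>\<epsilon>\<close> of the plateau it adds only \<open>\<beta>\<close> to the growth
    rate.\<close>
  define \<delta> where "\<delta> = sqrt (2 * \<epsilon> * \<beta>)"
  have \<delta>: "\<delta> > 0" "\<delta>\<^sup>2 / 2 = \<beta> * \<epsilon>" using \<epsilon> \<beta> by (simp_all add: \<delta>_def)
  obtain d2 where d2: "d2 > 0" "\<And>X Y. X \<in> cball P R \<Longrightarrow> Y \<in> cball P R \<Longrightarrow> dist X Y \<le> d2 \<Longrightarrow> \<bar>u X - u Y\<bar> \<le> \<delta>"
    using uniformly_continuous_cball[OF \<delta>(1)] by metis
  define \<kappa> where "\<kappa> = min \<epsilon> (d2 / 8)"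
  have \<kappa>: "\<kappa> > 0" "\<kappa> \<le> \<epsilon>" "8 * \<kappa> \<le> d2" using \<epsilon> d2 by (auto simp: \<kappa>_def)
  define \<tau>0 where "\<tau>0 = d2 / (2 * (1 + B))"
  have \<tau>0: "\<tau>0 > 0" "\<tau>0 * (1 + B) = d2 / 2" using d2 B0 by (auto simp: \<tau>0_def divide_simps)
  obtain \<eta> b :: "(real ^ 'k) \<times> real \<Rightarrow> real" where pl: "plateau \<kappa> \<epsilon> \<eta> b"
    using plateau_exists \<kappa>(1) \<epsilon>(1) by metis
  define m where "m Q = (\<integral>A. u A * \<eta> (A - Q) \<partial>lborel)" for Q
  define h :: "(real ^ 'k) \<times> real" where "h = (0, \<epsilon>)"
  have nh: "norm h = \<epsilon>" using \<epsilon> by (simp add: h_def norm_Pair)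
  have nj: "n \<in> {1..2 * n - 1}" using n1 by auto
  \<comment> \<open>Two families of means approximate the same value: \<open>m X\<close> has its
    plateau above \<open>X\<close>, and \<open>m (X - h)\<close> has it below.\<close>
  have close: "\<bar>m X - u X * \<epsilon>\<bar> \<le> \<beta> / 2 * \<epsilon>" "\<bar>m (X - h) - u X * \<epsilon>\<bar> \<le> \<beta> / 2 * \<epsilon>" if X: "dist X P \<le> R / 2"
      for X
  proof -
    have *: "\<bar>u Y - u X\<bar> \<le> \<beta> / 2" if "dist Y X \<le> 4 * \<epsilon>" for Y
      using d1(2)[of Y X] \<epsilon> that X dist_triangle[of Y P X] by (simp add: dist_commute)
    have "dist Y X \<le> 4 * \<epsilon>" if "dist Y X \<le> 2 * \<kappa> + \<epsilon>" for Y using that \<kappa> \<epsilon> by linarith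
    then show "\<bar>m X - u X * \<epsilon>\<bar> \<le> \<beta> / 2 * \<epsilon>"
      unfolding m_def by (intro plateau_mean_close[OF pl] *)
    have "dist Y X \<le> 4 * \<epsilon>" if "dist Y (X - h) \<le> 2 * \<kappa> + \<epsilon>" for Y
      using that \<kappa> \<epsilon> dist_triangle[of Y X "X - h"] nh by (simp add: dist_norm)
    then show "\<bar>m (X - h) - u X * \<epsilon>\<bar> \<le> \<beta> / 2 * \<epsilon>"
      unfolding m_def by (intro plateau_mean_close[OF pl] *)
  qed
  define K where "K = (C + \<beta>) * \<epsilon>"
  \<comment> \<open>In either family the plateau end on the polygon is the one where
    \<open>u\<close> is close to the slope and \<open>E\<close> is small. At the far end only
    \<open>E \<ge> 0\<close> is known, and there \<open>E\<close> has the harmless sign: the upper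
    mean cannot grow, and the lower mean cannot fall, faster than at rate \<open>K\<close>.\<close>
  have seg: "m (Y + \<sigma> *\<^sub>R v) - m Y \<le> K * \<sigma>" "m (Y - h) - m (Y + \<sigma> *\<^sub>R v - h) \<le> K * \<sigma>"
    if v: "v = (axis (e n) 1, u X)" and \<sigma>: "\<sigma> \<ge> 0" and near: "\<And>s. 0 \<le> s \<Longrightarrow> s \<le> \<sigma> \<Longrightarrow>
        dist (Y + s *\<^sub>R v) X \<le> d2 / 2"
       "\<And>s. 0 \<le> s \<Longrightarrow> s \<le> \<sigma> \<Longrightarrow> dist (Y + s *\<^sub>R v) P \<le> R / 2" and X: "dist X P \<le> R / 2"
    for X Y v \<sigma>
  proof -
    define E where "E A = flux n e u n A - u X * u A + (u X)\<^sup>2 / 2" for A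
    have E: "E A = (u A - u X)\<^sup>2 / 2" for A
      by (simp add: E_def flux_def power2_eq_square algebra_simps)
    have E0: "E A \<ge> - 0" for A by (simp add: E)
    have Ele: "E A \<le> \<beta> * \<epsilon>" if "0 \<le> s" "s \<le> \<sigma>" "dist A (Y + s *\<^sub>R v) \<le> 2 * \<kappa>" for s A
    proof -
      have "dist A X \<le> d2" "dist A P \<le> R"
        using near[OF that(1,2)] that(3) \<kappa> \<epsilon> dist_triangle[of A X "Y +
            s *\<^sub>R v"] dist_triangle[of A P "Y + s *\<^sub>R v"] R
        by linarith+
      then have "\<bar>u A - u X\<bar> \<le> \<delta>" using d2(2)[of A X] X R by (simp add: dist_commute)
      then have "(u A - u X)\<^sup>2 \<le> \<delta>\<^sup>2" using abs_le_square_iff[of "u A - u X" \<delta>] \<delta> by simp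
      then show ?thesis using \<delta> by (simp add: E)
    qed
    have sub: "cball (Y + s *\<^sub>R v) (2 * \<kappa> + \<epsilon>) \<subseteq> G" "cball (Y - h + s *\<^sub>R v) (2 * \<kappa> + \<epsilon>) \<subseteq> G"
      if "0 \<le> s" "s \<le> \<sigma>" for s
    proof -
      have P1: "dist P (Y + s *\<^sub>R v) \<le> R / 2" using near(2)[OF that] by (simp add: dist_commute)
      have "dist (Y + s *\<^sub>R v) (Y - h + s *\<^sub>R v) = \<epsilon>" using nh by (simp add: dist_norm)
      then have P2: "dist P (Y - h + s *\<^sub>R v) \<le> R / 2 + \<epsilon>"
        using P1 dist_triangle[of P "Y - h + s *\<^sub>R v" "Y + s *\<^sub>R v"] by linarith
      have "cball (Y + s *\<^sub>R v) (2 * \<kappa> + \<epsilon>) \<subseteq> cball P R"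
          "cball (Y - h + s *\<^sub>R v) (2 * \<kappa> + \<epsilon>) \<subseteq> cball P R"
        unfolding cball_subset_cball_iff using P1 P2 \<kappa> \<epsilon> by (auto simp: dist_commute)
      then show "cball (Y + s *\<^sub>R v) (2 * \<kappa> + \<epsilon>) \<subseteq> G" "cball (Y - h + s *\<^sub>R v) (2 * \<kappa> + \<epsilon>) \<subseteq> G"
        using R(2) by auto
    qed
    have "m (Y + \<sigma> *\<^sub>R v) - m Y \<le> (C * \<epsilon> + \<beta> * \<epsilon> + 0) * \<sigma>"
      by (rule plateau_transport_le[OF pl nj v \<sigma> sub(1) E_def m_def Ele E0])
    then show "m (Y + \<sigma> *\<^sub>R v) - m Y \<le> K * \<sigma>" by (simp add: K_def algebra_simps)
    have Ele': "E A \<le> \<beta> * \<epsilon>" if "0 \<le> s" "s \<le> \<sigma>" "dist A (Y - h + s *\<^sub>R v + (0, \<epsilon>)) \<le> 2 * \<kappa>" for s A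
      using Ele[OF that(1,2)] that(3) by (simp add: h_def algebra_simps)
    have "m (Y - h) - m (Y - h + \<sigma> *\<^sub>R v) \<le> (C * \<epsilon> + \<beta> * \<epsilon> + 0) * \<sigma>"
      by (rule plateau_transport_ge[OF pl nj v \<sigma> sub(2) E_def m_def E0 Ele'])
    then show "m (Y - h) - m (Y + \<sigma> *\<^sub>R v - h) \<le> K * \<sigma>" by (simp add: K_def algebra_simps)
  qed
  show thesis
  proof (rule that[OF \<tau>0(1)])
    fix \<tau> A i
    assume \<tau>: "\<bar>\<tau>\<bar> \<le> \<tau>0" and A: "dist A P \<le> R / 4" and i: "real i * (\<bar>\<tau>\<bar> * (1 + B)) \<le> R / 4"
    define X where "X k = (euler_step \<tau> ^^ k) A" for k
    define v where "v k = (axis (e n) (1::real), u (X k))" for k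
    have XS: "X (Suc k) = X k + \<tau> *\<^sub>R v k" for k by (simp add: X_def v_def euler_step_def)
    have dX: "dist (X k) P \<le> R / 4 + real k * (\<bar>\<tau>\<bar> * (1 + B))" for k
      using dist_euler[of k \<tau> A] A dist_triangle[of "X k" P A] by (simp add: X_def)
    have nv: "norm (v k) \<le> 1 + B" for k
      using norm_axis_Pair_le[of "e n" "u (X k)"] bu[of "X k"] by (simp add: v_def)
    have nsv: "norm (s *\<^sub>R v k) \<le> \<bar>\<tau>\<bar> * (1 + B)" if "\<bar>s\<bar> \<le> \<bar>\<tau>\<bar>" for s k
      using that nv[of k] by (simp add: mult_mono)
    have n1': "dist (X k + s *\<^sub>R v k) (X k) \<le> d2 / 2" "dist (X k + s *\<^sub>R v k) P \<le> R / 2" if "\<bar>s\<bar> \<le> \<bar>\<tau>\<bar>"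
        "k < i" for s k
    proof -
      have *: "dist (X k + s *\<^sub>R v k) (X k) \<le> \<bar>\<tau>\<bar> * (1 + B)" using nsv[OF that(1), of k]
          by (simp add: dist_norm)
      also have "\<dots> \<le> d2 / 2" using \<tau> B0 mult_right_mono[of "\<bar>\<tau>\<bar>" \<tau>0 "1 + B"] \<tau>0(2) by linarith
      finally show "dist (X k + s *\<^sub>R v k) (X k) \<le> d2 / 2" .
      have "real (Suc k) * (\<bar>\<tau>\<bar> * (1 + B)) \<le> real i * (\<bar>\<tau>\<bar> * (1 + B))"
        using that(2) B0 by (intro mult_right_mono) auto
      then have "real k * (\<bar>\<tau>\<bar> * (1 + B)) + \<bar>\<tau>\<bar> * (1 + B) \<le> R / 4" using i by (simp add: algebra_simps)
      then show "dist (X k + s *\<^sub>R v k) P \<le> R / 2"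
        using * dX[of k] dist_triangle[of "X k + s *\<^sub>R v k" P "X k"] by linarith
    qed
    have dX2: "dist (X k) P \<le> R / 2" if "k < i" for k using n1'(2)[of 0 k] that by simp
    have dXi: "dist (X i) P \<le> R / 2" "dist (X 0) P \<le> R / 2" using dX[of i] dX[of 0] i R by auto
    have "\<exists>m1 m2. (\<forall>X. dist X P \<le> R / 2 \<longrightarrow> \<bar>m1 X - u X * \<epsilon>\<bar> \<le> \<beta> / 2 * \<epsilon> \<and> \<bar>m2 X - u X * \<epsilon>\<bar> \<le> \<beta> / 2 * \<epsilon>) \<and>
        (\<forall>k<i. m1 (X (Suc k)) - m1 (X k) \<le> K * \<bar>\<tau>\<bar> \<and> m2 (X k) - m2 (X (Suc k)) \<le> K * \<bar>\<tau>\<bar>)"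
    proof (cases "\<tau> \<ge> 0")
      case True
      have "m (X (Suc k)) - m (X k) \<le> K * \<bar>\<tau>\<bar> \<and> m (X k - h) - m (X (Suc k) - h) \<le> K * \<bar>\<tau>\<bar>" if "k < i"
          for k
        unfolding XS using seg[OF v_def[of k] True _ _ dX2[OF that]] n1'[OF _ that] True
            by (auto simp: abs_le_iff)
      then show ?thesis using close by (intro exI[of _ m] exI[of _ "\<lambda>X. m (X - h)"]) auto
    next
      case False
      \<comment> \<open>For negative \<open>\<tau>\<close> each segment is run backwards, from
        \<open>X (Suc k)\<close> to \<open>X k\<close>, in positive time; this interchanges the two
        families.\<close>
      have "m (X (Suc k) - h) - m (X k - h) \<le> K * \<bar>\<tau>\<bar> \<and> m (X k) - m (X (Suc k)) \<le> K * \<bar>\<tau>\<bar>" if "k < i"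
          for k
      proof -
        have eq: "X (Suc k) + s *\<^sub>R v k = X k + (\<tau> + s) *\<^sub>R v k" for s by (simp add: XS algebra_simps)
        have "\<bar>\<tau> + s\<bar> \<le> \<bar>\<tau>\<bar>" if "0 \<le> s" "s \<le> - \<tau>" for s using that False by auto
        then show ?thesis using seg[OF v_def[of k], of "- \<tau>"
            "X (Suc k)"] dX2[OF that] n1'[OF _ that] False
          unfolding eq by simp
      qed
      then show ?thesis using close by (intro exI[of _ "\<lambda>X. m (X - h)"] exI[of _ m]) auto
    qed
    then obtain m1 m2 where cl: "\<And>X. dist X P \<le> R / 2 \<Longrightarrow> \<bar>m1 X - u X * \<epsilon>\<bar> \<le> \<beta> / 2 * \<epsilon>"
        "\<And>X. dist X P \<le> R / 2 \<Longrightarrow> \<bar>m2 X - u X * \<epsilon>\<bar> \<le> \<beta> / 2 * \<epsilon>"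
      and st: "\<And>k. k < i \<Longrightarrow> m1 (X (Suc k)) - m1 (X k) \<le> K * \<bar>\<tau>\<bar>" "\<And>k. k < i \<Longrightarrow>
          m2 (X k) - m2 (X (Suc k)) \<le> K * \<bar>\<tau>\<bar>"
      by blast
    have tel: "m1 (X k) - m1 (X 0) \<le> real k * (K * \<bar>\<tau>\<bar>) \<and> m2 (X 0) - m2 (X k) \<le> real k * (K * \<bar>\<tau>\<bar>)"
        if "k \<le> i" for k
      using that
    proof (induction k)
      case (Suc k)
      then show ?case using st[of k] by (auto simp: algebra_simps)
    qed simp
    have "m1 (X i) - m1 (X 0) \<le> (C + \<beta>) * (real i * \<bar>\<tau>\<bar>) * \<epsilon>"
        "m2 (X 0) - m2 (X i) \<le> (C + \<beta>) * (real i * \<bar>\<tau>\<bar>) * \<epsilon>"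
      using tel[of i] by (simp_all add: K_def mult_ac)
    from abs_diff_le_of_close[OF \<epsilon>(1) this cl(1)[OF dXi(1)] cl(1)[OF dXi(2)] cl(2)[OF dXi(1)] cl(2)[OF
        dXi(2)]]
    show "\<bar>u ((euler_step \<tau> ^^ i) A) - u A\<bar> \<le> (C + \<beta>) * (real i * \<bar>\<tau>\<bar>) + \<beta>"
      by (simp add: X_def)
  qed
qed

text \<open>On an exact characteristic of a linear field, \<open>E\<close> is \<open>u\<close> times
  the deviation of the drift, hence of order \<open>B * \<kappa>\<close> at both plateau ends. As
  \<open>\<kappa>\<close> may be taken small against \<open>\<epsilon>\<close>, neither a sign
  argument nor a polygon is needed, and the auxiliary error disappears in the limit.\<close>

lemma horizontal_Lipschitz:
  assumes R: "R > 0" "cball P R \<subseteq> G" and j: "j \<in> {1..2 * n - 1}" "j \<noteq> n"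
    and A: "dist A P \<le> R / 4" and h: "\<bar>h\<bar> * (1 + \<bar>drift n e j (fst A)\<bar>) \<le> R / 4"
  shows "\<bar>u (A + h *\<^sub>R (axis (e j) 1, drift n e j (fst A))) - u A\<bar> \<le> C * \<bar>h\<bar>"
proof (rule field_le_epsilon)
  fix \<beta>' :: real assume \<beta>': "\<beta>' > 0"
  define \<beta> where "\<beta> = \<beta>' / (1 + \<bar>h\<bar>)"
  have "\<beta> * (1 + \<bar>h\<bar>) = \<beta>'" using abs_ge_zero[of h] by (simp add: \<beta>_def)
  then have \<beta>: "\<beta> > 0" "\<beta> * \<bar>h\<bar> + \<beta> = \<beta>'"
    using \<beta>' by (simp add: \<beta>_def add_pos_nonneg, simp add: algebra_simps)
  obtain d1 where d1: "d1 > 0" "\<And>X Y. X \<in> cball P R \<Longrightarrow> Y \<in> cball P R \<Longrightarrow> dist X Y \<le> d1 \<Longrightarrow>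
      \<bar>u X - u Y\<bar> \<le> \<beta> / 2"
    using uniformly_continuous_cball[of "\<beta> / 2"] \<beta> by (metis half_gt_zero)
  define \<epsilon> where "\<epsilon> = min d1 R / 8"
  have \<epsilon>: "\<epsilon> > 0" "4 * \<epsilon> \<le> d1" "8 * \<epsilon> \<le> R" using d1 R by (auto simp: \<epsilon>_def)
  \<comment> \<open>The two end terms, each at most \<open>B * \<kappa>\<close>, together stay below
    \<open>\<beta> * \<epsilon>\<close>.\<close>
  define \<kappa> where "\<kappa> = min \<epsilon> (\<beta> * \<epsilon> / (2 * (1 + B)))"
  have \<kappa>: "\<kappa> > 0" "\<kappa> \<le> \<epsilon>" using \<epsilon> \<beta> B0 by (auto simp: \<kappa>_def)
  have "\<kappa> * (2 * (1 + B)) \<le> \<beta> * \<epsilon>" using B0 by (simp add: \<kappa>_def pos_le_divide_eq[symmetric])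
  then have \<kappa>': "2 * (B * \<kappa>) \<le> \<beta> * \<epsilon>" using \<kappa>(1) by (simp add: algebra_simps)
  obtain \<eta> b :: "(real ^ 'k) \<times> real \<Rightarrow> real" where pl: "plateau \<kappa> \<epsilon> \<eta> b"
    using plateau_exists \<kappa>(1) \<epsilon>(1) by metis
  define m where "m Q = (\<integral>A. u A * \<eta> (A - Q) \<partial>lborel)" for Q
  define c where "c = drift n e j (fst A)"
  define v where "v = (axis (e j) (1::real), c)"
  define E where "E X = flux n e u j X - c * u X + 0" for X
  have nv: "norm v \<le> 1 + \<bar>c\<bar>" unfolding v_def by (rule norm_axis_Pair_le)
  have dA: "dist (A + s *\<^sub>R v) P \<le> R / 2" if "\<bar>s\<bar> \<le> \<bar>h\<bar>" for s
  proof -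
    have "norm (s *\<^sub>R v) \<le> \<bar>h\<bar> * (1 + \<bar>c\<bar>)" using that nv by (simp add: mult_mono)
    then have "dist (A + s *\<^sub>R v) A \<le> R / 4" using h by (simp add: dist_norm c_def)
    then show ?thesis using A dist_triangle[of "A + s *\<^sub>R v" P A] by linarith
  qed
  have E: "\<bar>E X\<bar> \<le> B * \<kappa>" if "norm (fst X - fst (A + s *\<^sub>R v)) \<le> 2 * \<kappa>" for X s
  proof -
    have "drift n e j (fst (A + s *\<^sub>R v)) = c"
      using drift_add_axis[OF num j] by (simp add: v_def c_def)
    then have "\<bar>drift n e j (fst X) - c\<bar> \<le> \<kappa>"
      using drift_diff_le[of n e j "fst X" "fst (A + s *\<^sub>R v)"] that by simp
    then have "\<bar>u X\<bar> * \<bar>drift n e j (fst X) - c\<bar> \<le> B * \<kappa>" using bu B0 by (intro mult_mono) auto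
    moreover have "E X = u X * (drift n e j (fst X) - c)" using j
        by (simp add: E_def flux_def algebra_simps)
    ultimately show ?thesis by (simp add: abs_mult)
  qed
  have fstd: "norm (fst X - fst Y) \<le> dist X Y" for X Y :: "(real ^ 'k) \<times> real"
    using dist_fst_le[of X Y] by (simp add: dist_norm)
  have seg: "\<bar>m (Y + \<sigma> *\<^sub>R v) - m Y\<bar> \<le> (C * \<epsilon> + B * \<kappa> + B * \<kappa>) * \<sigma>"
    if Y: "Y = A + r *\<^sub>R v" and \<sigma>: "\<sigma> \<ge> 0" and near: "\<And>s. 0 \<le> s \<Longrightarrow> s \<le> \<sigma> \<Longrightarrow> dist (Y + s *\<^sub>R v) P \<le> R / 2"
        for Y \<sigma> r
  proof -
    have sub: "cball (Y + s *\<^sub>R v) (2 * \<kappa> + \<epsilon>) \<subseteq> G" if "0 \<le> s" "s \<le> \<sigma>" for s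
    proof -
      have "cball (Y + s *\<^sub>R v) (2 * \<kappa> + \<epsilon>) \<subseteq> cball P R"
        unfolding cball_subset_cball_iff using near[OF that] \<kappa> \<epsilon> by auto
      then show ?thesis using R(2) by auto
    qed
    have eq: "Y + s *\<^sub>R v = A + (r + s) *\<^sub>R v" for s by (simp add: Y algebra_simps)
    have lo: "\<bar>E X\<bar> \<le> B * \<kappa>" if "dist X (Y + s *\<^sub>R v) \<le> 2 * \<kappa>" for X s
      using E[of X "r + s"] fstd[of X "Y + s *\<^sub>R v"] that unfolding eq by linarith
    have up: "\<bar>E X\<bar> \<le> B * \<kappa>" if "dist X (Y + s *\<^sub>R v + (0, \<epsilon>)) \<le> 2 * \<kappa>" for X s
      using E[of X "r + s"] fstd[of X "Y + s *\<^sub>R v + (0, \<epsilon>)"] that unfolding eq by simp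
    have "m (Y + \<sigma> *\<^sub>R v) - m Y \<le> (C * \<epsilon> + B * \<kappa> + B * \<kappa>) * \<sigma>"
      by (rule plateau_transport_le[OF pl j(1) v_def \<sigma> sub E_def m_def]) (use lo up in \<open>auto simp:
          abs_le_iff minus_le_iff\<close>)
    moreover have "m Y - m (Y + \<sigma> *\<^sub>R v) \<le> (C * \<epsilon> + B * \<kappa> + B * \<kappa>) * \<sigma>"
      by (rule plateau_transport_ge[OF pl j(1) v_def \<sigma> sub E_def m_def]) (use lo up in \<open>auto simp:
          abs_le_iff minus_le_iff\<close>)
    ultimately show ?thesis by (simp add: abs_le_iff)
  qed
  have "\<bar>m (A + h *\<^sub>R v) - m A\<bar> \<le> (C * \<epsilon> + B * \<kappa> + B * \<kappa>) * \<bar>h\<bar>"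
  proof (cases "h \<ge> 0")
    case True
    then show ?thesis using seg[of A 0 h] dA by simp
  next
    case False
    have eq: "A + h *\<^sub>R v + s *\<^sub>R v = A + (h + s) *\<^sub>R v" for s by (simp add: algebra_simps)
    show ?thesis using seg[of "A + h *\<^sub>R v" h "- h"] dA False unfolding eq
        by (simp add: abs_minus_commute)
  qed
  also have "\<dots> \<le> (C * \<epsilon> + \<beta> * \<epsilon>) * \<bar>h\<bar>" using \<kappa>' by (intro mult_right_mono) auto
  finally have mm: "\<bar>m (A + h *\<^sub>R v) - m A\<bar> \<le> (C * \<epsilon> + \<beta> * \<epsilon>) * \<bar>h\<bar>" .
  have close: "\<bar>m X - u X * \<epsilon>\<bar> \<le> \<beta> / 2 * \<epsilon>" if X: "dist X P \<le> R / 2" for X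
  proof -
    have "\<bar>u Y - u X\<bar> \<le> \<beta> / 2" if "dist Y X \<le> 2 * \<kappa> + \<epsilon>" for Y
      using d1(2)[of Y X] \<epsilon> \<kappa> that X dist_triangle[of Y P X] by (simp add: dist_commute)
    then show ?thesis unfolding m_def by (rule plateau_mean_close[OF pl])
  qed
  have mm': "m (A + h *\<^sub>R v) - m A \<le> (C + \<beta>) * \<bar>h\<bar> * \<epsilon>" "m A - m (A + h *\<^sub>R v) \<le> (C + \<beta>) * \<bar>h\<bar> * \<epsilon>"
    using mm by (simp_all add: abs_le_iff algebra_simps)
  have d: "dist (A + h *\<^sub>R v) P \<le> R / 2" "dist A P \<le> R / 2" using dA[of h] dA[of 0] by simp_all
  have "\<bar>u (A + h *\<^sub>R v) - u A\<bar> \<le> (C + \<beta>) * \<bar>h\<bar> + \<beta>"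
    by (rule abs_diff_le_of_close[OF \<epsilon>(1) mm' close[OF d(1)] close[OF d(2)] close[OF d(1)] close[OF
        d(2)]])
  then show "\<bar>u (A + h *\<^sub>R (axis (e j) 1, drift n e j (fst A))) - u A\<bar> \<le> C * \<bar>h\<bar> + \<beta>'"
    using \<beta>(2) by (simp add: v_def c_def algebra_simps)
qed

end

section \<open>From local transport estimates to the intrinsic Lipschitz condition\<close>

text \<open>The terms \<open>drift n e j z * z $ e j\<close> cancel in pairs by antisymmetry. So the
  correction in the graph distance is the vertical displacement, up to sign, obtained by following
  the linear fields with coefficients frozen at the first point.\<close>

lemma sigma_form_eq_drift:
  "sigma_form n e z z' = - (\<Sum>j\<in>{1..2 * n - 1} - {n}. drift n e j z * (z' $ e j - z $ e j))"
proof (cases "n = 0")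
  case True
  then show ?thesis by (simp add: sigma_form_def)
next
  case False
  let ?g = "\<lambda>j. drift n e j z * (z' $ e j - z $ e j)"
  have "{1..2 * n - 1} - {n} = {1..n - 1} \<union> {1 + n..n - 1 + n}" using False by auto
  then have "sum ?g ({1..2 * n - 1} - {n}) = sum ?g {1..n - 1} + sum ?g {1 + n..n - 1 + n}"
    by (simp add: sum.union_disjoint)
  also have "sum ?g {1 + n..n - 1 + n} = (\<Sum>j = 1..n - 1. ?g (j + n))"
    by (rule sum.shift_bounds_cl_nat_ivl)
  finally show ?thesis
    by (auto simp: sigma_form_def sum.distrib[symmetric] sum_distrib_left sum_negf[symmetric] drift_def
      algebra_simps intro!: sum.cong)
qed

text \<open>The graph distance contains the values of \<open>u\<close> at both points, so bounds for
  a difference \<Delta> of values return a term \<open>c * \<Delta> * D\<close>. Young's inequality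
  splits it into \<open>(\<Delta> / 2)\<^sup>2\<close>, absorbed on the left, and
  \<open>(c * D)\<^sup>2\<close>.\<close>

lemma absorb_quadratic:
  fixes D :: real
  assumes "\<Delta> \<le> a * D + y" "y\<^sup>2 \<le> b * D\<^sup>2 + c * \<Delta> * D" "b \<ge> 0" "D \<ge> 0" "\<Delta> \<ge> 0"
  shows "\<Delta> \<le> 2 * (a + sqrt (b + c\<^sup>2)) * D"
proof -
  have "c * \<Delta> * D \<le> (\<Delta> / 2)\<^sup>2 + (c * D)\<^sup>2"
    using sum_squares_bound[of "\<Delta> / 2" "c * D"] by (simp add: mult_ac)
  then have "y\<^sup>2 \<le> (b + c\<^sup>2) * D\<^sup>2 + (\<Delta> / 2)\<^sup>2" using assms(2)
      by (simp add: power_mult_distrib algebra_simps)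
  also have "\<dots> = (sqrt (b + c\<^sup>2) * D)\<^sup>2 + (\<Delta> / 2)\<^sup>2" using assms(3) by (simp add: power_mult_distrib)
  also have "\<dots> \<le> (sqrt (b + c\<^sup>2) * D + \<Delta> / 2)\<^sup>2" using assms(3-5) by (simp add: power2_sum)
  finally have "y \<le> sqrt (b + c\<^sup>2) * D + \<Delta> / 2" by (rule power2_le_imp_le) (use assms(3-5) in simp)
  then show ?thesis using assms(1) by (simp add: algebra_simps)
qed

lemma exists_fine_mesh:
  fixes x :: real
  assumes "x > 0"
  obtains N :: nat where "N > 0" "y / real N \<le> x"
proof -
  obtain N :: nat where N: "y / x < real N" using reals_Archimedean2 by blast
  have "y / real (Suc N) \<le> x" using N assms by (simp add: field_simps)
  then show thesis using that[of "Suc N"] by simp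
qed

context weak_balance_law
begin

lemma snd_euler_close:
  assumes "\<And>k. k < i \<Longrightarrow> \<bar>u ((euler_step \<tau> ^^ k) A) - u A\<bar> \<le> S"
  shows "\<bar>snd ((euler_step \<tau> ^^ i) A) - snd A - real i * \<tau> * u A\<bar> \<le> real i * \<bar>\<tau>\<bar> * S"
  using assms
proof (induction i)
  case (Suc i)
  let ?X = "(euler_step \<tau> ^^ i) A"
  have "\<bar>\<tau> * (u ?X - u A)\<bar> \<le> \<bar>\<tau>\<bar> * S" unfolding abs_mult using Suc.prems[of i]
      by (intro mult_left_mono) auto
  moreover have "snd (euler_step \<tau> ?X) = snd ?X + \<tau> * u ?X" by (simp add: euler_step_def)
  moreover have "\<bar>snd ?X - snd A - real i * \<tau> * u A\<bar> \<le> real i * \<bar>\<tau>\<bar> * S" using Suc by simp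
  ultimately show ?case by (simp add: algebra_simps)
qed simp

text \<open>
  If \<open>u\<close> varied too much between two points of a vertical line, the Euler polygons through them would
  have to cross soon, while \<open>u\<close> still differs on the two polygons.
\<close>

lemma vertical_Hoelder:
  assumes R: "R > 0" "cball P R \<subseteq> G" and K: "K = C + 1 + 2 * B * (1 + B) / R"
    and A: "dist (z, t) P \<le> R / 4" and A': "dist (z, t') P \<le> R / 4" and tt: "t < t'"
  shows "(u (z, t) - u (z, t'))\<^sup>2 \<le> 8 * K * (t' - t)"
proof (rule ccontr)
  define \<Delta> where "\<Delta> = \<bar>u (z, t) - u (z, t')\<bar>"
  define d where "d = t' - t"
  assume "\<not> ?thesis"
  then have \<Delta>2: "\<Delta>\<^sup>2 > 8 * K * d" by (simp add: \<Delta>_def d_def)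
  have K0: "K > 0" "C + 1 \<le> K" using C0 B0 R by (auto simp: K add_pos_nonneg)
  have d: "d > 0" using tt by (simp add: d_def)
  have "8 * K * d > 0" using d K0 by simp
  then have "\<Delta> > 0" using \<Delta>2 by (auto simp: \<Delta>_def)
  have \<Delta>B: "\<Delta> \<le> 2 * B" using bu[of "(z, t)"] bu[of "(z, t')"] by (simp add: \<Delta>_def)
  \<comment> \<open>Direction of travel along the polygons: forward if \<open>u\<close> is larger at
    the lower point, backward otherwise, so that in either case the polygons approach each
    other.\<close>
  define sg :: real where "sg = sgn (u (z, t) - u (z, t'))"
  have sg: "\<bar>sg\<bar> = 1" "sg * (u (z, t') - u (z, t)) = - \<Delta>"
    using \<open>\<Delta> > 0\<close> by (auto simp: sg_def \<Delta>_def sgn_if)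
  \<comment> \<open>In this time \<open>u\<close> changes by about
    \<open>K * s = \<Delta> / 4\<close> on each polygon, so the slopes still differ by about half of
    \<open>\<Delta>\<close>. Up to errors in \<beta> the gap shrinks by at least
    \<open>2 * K * s\<^sup>2\<close>, which is \<open>\<Delta>\<^sup>2 / (8 * K)\<close> and exceeds
    \<open>d\<close> by the negated claim. This is where the factor 8 comes from.\<close>
  define s where "s = \<Delta> / (4 * K)"
  have s: "s > 0" "4 * K * s = \<Delta>" using \<open>\<Delta> > 0\<close> K0 by (auto simp: s_def)
  \<comment> \<open>The summand \<open>2 * B * (1 + B) / R\<close> of \<open>K\<close> is made for
    this bound: as \<open>\<Delta> \<le> 2 * B\<close>, the polygons stay within
    \<open>R / 4\<close> of their starting points.\<close>
  have sB: "s * (1 + B) \<le> R / 4"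
  proof -
    have "\<Delta> * (1 + B) \<le> 2 * B * (1 + B)" using \<Delta>B B0 by (intro mult_right_mono) auto
    also have "\<dots> \<le> R * (C + 1) + 2 * B * (1 + B)" using R C0 by simp
    also have "\<dots> = R * K" using R unfolding K distrib_left[of R] by simp
    finally have "4 * K * (s * (1 + B)) \<le> 4 * K * (R / 4)"
      unfolding s(2)[symmetric] by (simp add: mult_ac)
    then show ?thesis using K0 by simp
  qed
  \<comment> \<open>The last term spends the strict slack in
    \<open>\<Delta>\<^sup>2 > 8 * K * d\<close>; the bound \<open>\<Delta> / 16\<close> is for the
    final contradiction, which loses \<open>3 * \<beta>\<close> against
    \<open>\<Delta> / 2\<close>.\<close>
  define \<beta> where "\<beta> = min 1 (min (\<Delta> / 16) ((\<Delta>\<^sup>2 - 8 * K * d) / (8 * \<Delta>)))"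
  have \<beta>: "\<beta> > 0" "\<beta> \<le> 1" "16 * \<beta> \<le> \<Delta>" using \<Delta>2 \<open>\<Delta> > 0\<close> by (auto simp: \<beta>_def)
  have "\<beta> \<le> (\<Delta>\<^sup>2 - 8 * K * d) / (8 * \<Delta>)" by (simp add: \<beta>_def)
  then have "\<beta> * (8 * \<Delta>) \<le> \<Delta>\<^sup>2 - 8 * K * d" using \<open>\<Delta> > 0\<close> by (simp add: pos_le_divide_eq)
  then have "8 * K * (4 * \<beta> * s + d) \<le> 8 * K * (2 * K * s\<^sup>2)"
    using s(2)[symmetric] by (simp add: power2_eq_square algebra_simps)
  then have \<beta>s: "4 * \<beta> * s + d \<le> 2 * K * s\<^sup>2" using K0 by simp
  obtain \<tau>0 where \<tau>0: "\<tau>0 > 0"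
    "\<And>\<tau> A i. \<bar>\<tau>\<bar> \<le> \<tau>0 \<Longrightarrow> dist A P \<le> R / 4 \<Longrightarrow> real i * (\<bar>\<tau>\<bar> * (1 + B)) \<le> R / 4 \<Longrightarrow>
      \<bar>u ((euler_step \<tau> ^^ i) A) - u A\<bar> \<le> (C + \<beta>) * (real i * \<bar>\<tau>\<bar>) + \<beta>"
    using euler_Lipschitz[OF R \<beta>(1)] by blast
  obtain d2 where d2: "d2 > 0" "\<And>X Y. X \<in> cball P R \<Longrightarrow> Y \<in> cball P R \<Longrightarrow> dist X Y \<le> d2 \<Longrightarrow> \<bar>u X - u Y\<bar> \<le> \<beta>"
    using uniformly_continuous_cball[OF \<beta>(1)] by blast
  obtain N :: nat where N: "N > 0" "s / real N \<le> min \<tau>0 (d2 / (2 * B + 1))"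
    using exists_fine_mesh[of "min \<tau>0 (d2 / (2 * B + 1))" s] \<tau>0(1) d2(1) B0 by auto
  define \<tau> where "\<tau> = sg * (s / real N)"
  have \<tau>: "\<bar>\<tau>\<bar> = s / real N" "real N * \<bar>\<tau>\<bar> = s" "real N * \<tau> = sg * s" using sg s N(1)
      by (auto simp: \<tau>_def abs_mult)
  \<comment> \<open>One step changes the gap by at most \<open>d2\<close>. So just before the gap
    first becomes negative it is at most \<open>d2\<close>, and there the values on the two polygons
    differ by at most \<open>\<beta>\<close>.\<close>
  have \<tau>B: "\<bar>\<tau>\<bar> * (2 * B) \<le> d2"
  proof -
    have "\<bar>\<tau>\<bar> * (2 * B + 1) \<le> d2" using N(2) B0 by (simp add: \<tau>(1) pos_le_divide_eq)
    then show ?thesis by (simp add: algebra_simps)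
  qed
  define X where "X k = (euler_step \<tau> ^^ k) (z, t)" for k
  define Y where "Y k = (euler_step \<tau> ^^ k) (z, t')" for k
  have small: "real k * \<bar>\<tau>\<bar> \<le> s" "real k * (\<bar>\<tau>\<bar> * (1 + B)) \<le> R / 4" if "k \<le> N" for k
  proof -
    show *: "real k * \<bar>\<tau>\<bar> \<le> s" using that mult_right_mono[of "real k" "real N" "\<bar>\<tau>\<bar>"] \<tau>(2) by simp
    have "real k * \<bar>\<tau>\<bar> * (1 + B) \<le> s * (1 + B)" using * B0 by (intro mult_right_mono) auto
    then show "real k * (\<bar>\<tau>\<bar> * (1 + B)) \<le> R / 4" using sB unfolding mult.assoc by (rule order_trans)
  qed
  have close: "\<bar>u (X k) - u (z, t)\<bar> \<le> K * s + \<beta>" "\<bar>u (Y k) - u (z, t')\<bar> \<le> K * s + \<beta>" if "k \<le> N" for k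
  proof -
    have "\<bar>\<tau>\<bar> \<le> \<tau>0" using N(2) \<tau>(1) by simp
    moreover have "(C + \<beta>) * (real k * \<bar>\<tau>\<bar>) \<le> K * s"
      using small[OF that] K0 \<beta> C0 by (intro mult_mono) auto
    ultimately show "\<bar>u (X k) - u (z, t)\<bar> \<le> K * s + \<beta>" "\<bar>u (Y k) - u (z, t')\<bar> \<le> K * s + \<beta>"
      unfolding X_def Y_def using \<tau>0(2)[of \<tau> "(z, t)" k] \<tau>0(2)[of \<tau> "(z, t')" k] A A' small(2)[OF that]
          by auto
  qed
  define gap where "gap k = snd (Y k) - snd (X k)" for k
  have "gap N < 0"
  proof -
    have "\<bar>snd (X N) - t - sg * s * u (z, t)\<bar> \<le> s * (K * s + \<beta>)"
      using snd_euler_close[of N \<tau> "(z, t)" "K * s + \<beta>"] close(1) \<tau> by (simp add: X_def)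
    moreover have "\<bar>snd (Y N) - t' - sg * s * u (z, t')\<bar> \<le> s * (K * s + \<beta>)"
      using snd_euler_close[of N \<tau> "(z, t')" "K * s + \<beta>"] close(2) \<tau> by (simp add: Y_def)
    moreover have "sg * s * u (z, t') - sg * s * u (z, t) = - (4 * K * s * s)"
    proof -
      have "sg * s * u (z, t') - sg * s * u (z, t) = s * (sg * (u (z, t') - u (z, t)))"
          by (simp add: algebra_simps)
      then show ?thesis unfolding sg(2) s(2)[symmetric] by simp
    qed
    ultimately have "gap N \<le> d - 4 * K * s * s + 2 * (s * (K * s + \<beta>))"
      unfolding gap_def d_def by linarith
    also have "\<dots> = d - 2 * K * s\<^sup>2 + 2 * \<beta> * s" by (simp add: power2_eq_square algebra_simps)
    also have "\<dots> < 0" using \<beta>s mult_pos_pos[OF \<beta>(1) s(1)] by linarith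
    finally show ?thesis .
  qed
  moreover have g0: "gap 0 > 0" using tt by (simp add: gap_def X_def Y_def)
  ultimately obtain k where k: "k \<le> N" "\<forall>i<k. \<not> gap i < 0" "gap k < 0"
    using ex_least_nat_le[of "\<lambda>i. gap i < 0" N] by auto
  then obtain i where i: "k = Suc i" using g0 by (cases k) auto
  then have i': "i \<le> N" "gap i \<ge> 0" using k by auto
  have "gap (Suc i) = gap i + \<tau> * (u (Y i) - u (X i))"
    by (simp add: gap_def X_def Y_def euler_step_def algebra_simps)
  moreover have "\<bar>\<tau> * (u (Y i) - u (X i))\<bar> \<le> \<bar>\<tau>\<bar> * (2 * B)"
    unfolding abs_mult using bu[of "X i"] bu[of "Y i"] by (intro mult_left_mono) auto
  ultimately have gi: "gap i \<le> d2" using k(3)[unfolded i] \<tau>B by linarith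
  have "fst (X i) = fst (Y i)" by (simp add: X_def Y_def fst_euler)
  then have "dist (X i) (Y i) = \<bar>gap i\<bar>"
    by (simp add: dist_prod_def gap_def dist_real_def abs_minus_commute)
  then have "dist (X i) (Y i) \<le> d2" using gi i'(2) by simp
  moreover have "X i \<in> cball P R" "Y i \<in> cball P R"
    using dist_euler[of i \<tau> "(z, t)"] dist_euler[of i \<tau> "(z, t')"] small(2)[OF i'(1)] A A' R
      dist_triangle[of "X i" P "(z, t)"] dist_triangle[of "Y i" P "(z, t')"]
    by (auto simp: X_def Y_def dist_commute)
  ultimately have "\<bar>u (X i) - u (Y i)\<bar> \<le> \<beta>" by (intro d2(2))
  moreover have "\<Delta> \<le> \<bar>u (X i) - u (z, t)\<bar> + \<bar>u (X i) - u (Y i)\<bar> + \<bar>u (Y i) - u (z, t')\<bar>"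
    unfolding \<Delta>_def by linarith
  ultimately have "\<Delta> \<le> (K * s + \<beta>) + \<beta> + (K * s + \<beta>)"
    using close[OF i'(1)] by (meson add_mono order_trans)
  also have "\<dots> < 4 * K * s" using \<beta> s by (simp add: s(2)[symmetric] algebra_simps)
  finally show False using s(2) by simp
qed

section \<open>Moving along all fields in turn\<close>

definition speed :: "nat \<Rightarrow> (real ^ 'k) \<times> real \<Rightarrow> real"
  where "speed j A = (if j = n then u A else drift n e j (fst A))"

text \<open>Exact characteristics of the linear fields and Euler polygons are put on the same
  footing: first-order motion in \<open>t\<close> with an error quadratic in \<open>h\<close>. On a
  polygon the additive error is chosen to be at most \<open>\<bar>h\<bar>\<close>, which together
  with the bound \<open>\<beta> \<le> 1\<close> gives the constant \<open>C + 2\<close>.\<close>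

lemma step_exists:
  assumes R: "R > 0" "cball P R \<subseteq> G" and j: "j \<in> {1..2 * n - 1}" and A: "dist A P \<le> R / 4"
    and V: "B \<le> V" "norm (fst A) \<le> V" "\<bar>h\<bar> * (1 + V) \<le> R / 4"
  shows "\<exists>t. \<bar>t - snd A - h * speed j A\<bar> \<le> (C + 2) * h\<^sup>2 \<and>
    \<bar>u (fst A + h *\<^sub>R axis (e j) 1, t) - u A\<bar> \<le> (C + 2) * \<bar>h\<bar>"
proof (cases "h = 0")
  case True
  then show ?thesis by (intro exI[of _ "snd A"]) simp
next
  case h: False
  show ?thesis
  proof (cases "j = n")
    case False
    have "\<bar>drift n e j (fst A)\<bar> \<le> V" using drift_le[of n e j "fst A"] V(2)
        by (smt (verit) norm_ge_zero field_sum_of_halves)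
    then have "\<bar>h\<bar> * (1 + \<bar>drift n e j (fst A)\<bar>) \<le> \<bar>h\<bar> * (1 + V)" by (intro mult_left_mono) auto
    then have "\<bar>u (A + h *\<^sub>R (axis (e j) 1, drift n e j (fst A))) - u A\<bar> \<le> C * \<bar>h\<bar>"
      using V(3) by (intro horizontal_Lipschitz[OF R j False A]) simp
    moreover have "A + h *\<^sub>R (axis (e j) 1, drift n e j (fst A)) =
        (fst A + h *\<^sub>R axis (e j) 1, snd A + h * drift n e j (fst A))"
      by (simp add: prod_eq_iff)
    moreover have "C * \<bar>h\<bar> \<le> (C + 2) * \<bar>h\<bar>" by (intro mult_right_mono) auto
    ultimately show ?thesis using False C0
      by (intro exI[of _ "snd A + h * drift n e j (fst A)"]) (auto simp: speed_def)
  next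
    case True
    define \<beta> where "\<beta> = min 1 \<bar>h\<bar>"
    have \<beta>: "\<beta> > 0" "\<beta> \<le> 1" "\<beta> \<le> \<bar>h\<bar>" using h by (auto simp: \<beta>_def)
    obtain \<tau>0 where \<tau>0: "\<tau>0 > 0"
      "\<And>\<tau> A i. \<bar>\<tau>\<bar> \<le> \<tau>0 \<Longrightarrow> dist A P \<le> R / 4 \<Longrightarrow> real i * (\<bar>\<tau>\<bar> * (1 + B)) \<le> R / 4 \<Longrightarrow>
        \<bar>u ((euler_step \<tau> ^^ i) A) - u A\<bar> \<le> (C + \<beta>) * (real i * \<bar>\<tau>\<bar>) + \<beta>"
      using euler_Lipschitz[OF R \<beta>(1)] by blast
    obtain N :: nat where N: "N > 0" "\<bar>h\<bar> / real N \<le> \<tau>0" using exists_fine_mesh[OF \<tau>0(1)] by blast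
    define \<tau> where "\<tau> = h / real N"
    have \<tau>: "real N * \<tau> = h" "\<bar>\<tau>\<bar> \<le> \<tau>0" "real N * \<bar>\<tau>\<bar> = \<bar>h\<bar>" using N by (auto simp: \<tau>_def)
    have close: "\<bar>u ((euler_step \<tau> ^^ k) A) - u A\<bar> \<le> (C + 2) * \<bar>h\<bar>" if "k \<le> N" for k
    proof -
      have k: "real k * \<bar>\<tau>\<bar> \<le> \<bar>h\<bar>" using that mult_right_mono[of "real k" "real N" "\<bar>\<tau>\<bar>"] \<tau>(3) by simp
      have "real k * \<bar>\<tau>\<bar> * (1 + B) \<le> \<bar>h\<bar> * (1 + V)" using k V(1) B0 by (intro mult_mono) auto
      then have "\<bar>u ((euler_step \<tau> ^^ k) A) - u A\<bar> \<le> (C + \<beta>) * (real k * \<bar>\<tau>\<bar>) + \<beta>"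
        using order_trans[OF _ V(3)] by (intro \<tau>0(2) \<tau> A) (simp only: mult.assoc)
      also have "\<dots> \<le> (C + 1) * \<bar>h\<bar> + \<bar>h\<bar>" using k \<beta> C0 by (intro add_mono mult_mono) auto
      finally show ?thesis by (simp add: algebra_simps)
    qed
    let ?X = "(euler_step \<tau> ^^ N) A"
    have "\<bar>snd ?X - snd A - real N * \<tau> * u A\<bar> \<le> real N * \<bar>\<tau>\<bar> * ((C + 2) * \<bar>h\<bar>)"
      by (rule snd_euler_close) (use close in auto)
    then have "\<bar>snd ?X - snd A - h * u A\<bar> \<le> (C + 2) * h\<^sup>2"
      unfolding \<tau> by (simp add: power2_eq_square mult_ac abs_mult[symmetric])
    moreover have "(fst A + h *\<^sub>R axis (e j) 1, snd ?X) = ?X"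
      by (simp add: prod_eq_iff fst_euler \<tau> True)
    ultimately show ?thesis using close[of N] True
      by (intro exI[of _ "snd ?X"]) (simp add: speed_def)
  qed
qed

text \<open>The displacement with all speeds frozen at the first point is the correction term of the
  graph distance, except that \<open>u\<close> at the first point stands in place of the average of
  both values.\<close>

lemma sum_speed:
  assumes "coord_numbering n e"
  shows "(\<Sum>j = 1..2 * n - 1. (z' $ e j - z $ e j) * speed j (z, t)) =
    u (z, t) * (z' $ e n - z $ e n) - sigma_form n e z z'"
proof -
  have nj: "n \<in> {1..2 * n - 1}" using n1 by auto
  have "(\<Sum>j = 1..2 * n - 1. (z' $ e j - z $ e j) * speed j (z, t)) =
      (z' $ e n - z $ e n) * speed n (z, t) + (\<Sum>j\<in>{1..2 * n - 1} - {n}. (z' $ e j -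
          z $ e j) * speed j (z, t))"
    using nj by (intro sum.remove) auto
  also have "(\<Sum>j\<in>{1..2 * n - 1} - {n}. (z' $ e j - z $ e j) * speed j (z, t)) =
      (\<Sum>j\<in>{1..2 * n - 1} - {n}. drift n e j z * (z' $ e j - z $ e j))"
    by (intro sum.cong) (auto simp: speed_def)
  finally show ?thesis by (simp add: sigma_form_eq_drift speed_def mult_ac)
qed

lemma sum_axis:
  assumes "coord_numbering n e"
  shows "(\<Sum>j = 1..2 * n - 1. x $ e j *\<^sub>R axis (e j) (1::real)) = x"
proof -
  have "(\<Sum>j = 1..2 * n - 1. x $ e j *\<^sub>R axis (e j) (1::real)) = (\<Sum>i\<in>UNIV. x $ i *\<^sub>R axis i 1)"
    using assms unfolding coord_numbering_def by (rule sum.reindex_bij_betw)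
  also have "\<dots> = x" by (simp add: vec_eq_iff axis_def if_distrib cong: if_cong)
  finally show ?thesis .
qed

text \<open>The coordinates are replaced one at a time. A step uses the speed at the current point;
  exchanging it for the speed at \<open>A\<close> costs at most \<open>(K + 1) * real N * H\<close>
  per unit of step. With the quadratic error \<open>K\<close> of the step itself this gives
  \<open>K2\<close>.\<close>

lemma coordinate_path:
  fixes K V K2 :: real and z z' :: "real ^ 'k"
  defines "K \<equiv> C + 2" and "N \<equiv> 2 * n - 1" and "\<zeta> \<equiv> \<lambda>m. z + (\<Sum>j = 1..m. (z' - z) $ e j *\<^sub>R axis (e j) 1)"
  assumes R: "R > 0" "cball P R \<subseteq> G" and A: "A = (z, t)" and H: "H = norm (z' - z)" "H \<le> 1"
    and V: "V = B + norm P + R" and H1: "H * (1 + V) \<le> R / 4" and K2: "K2 = K + (K + 1) * real N"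
    and AP: "dist A P + real N * (1 + V + K2) * H \<le> R / 4"
    and m: "m \<le> N"
  shows "\<exists>\<tau>. \<bar>u (\<zeta> m, \<tau>) - u A\<bar> \<le> real m * (K * H) \<and>
    \<bar>\<tau> - t - (\<Sum>j = 1..m. (z' $ e j - z $ e j) * speed j A)\<bar> \<le> real m * (K2 * H\<^sup>2) \<and>
    dist (\<zeta> m, \<tau>) P \<le> R / 4"
proof -
  have K0: "K \<ge> 0" "K2 \<ge> 0" using C0 by (simp_all add: K_def K2)
  have H0: "H \<ge> 0" using H by simp
  have V0: "V \<ge> 0" using B0 R by (simp add: V)
  have comp: "\<bar>z' $ e j - z $ e j\<bar> \<le> H" for j
    using component_le_norm_cart[of "z' - z" "e j"] by (simp add: H)
  have AP': "dist A P \<le> R / 4"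
    using AP H0 V0 K0 by (smt (verit) mult_nonneg_nonneg of_nat_0_le_iff)
  have normz: "norm z \<le> V"
    using AP' norm_fst_le[of z t] norm_triangle_sub[of A P] B0 R by (simp add: A V dist_norm)
  have speedA: "\<bar>speed j A\<bar> \<le> V" for j
  proof -
    have "B \<le> V" using R by (simp add: V)
    then have "\<bar>u (z, t)\<bar> \<le> V" using bu[of "(z, t)"] by linarith
    moreover have "\<bar>drift n e j z\<bar> \<le> V" using drift_le[of n e j z] normz norm_ge_zero[of z] by linarith
    ultimately show ?thesis by (simp add: speed_def A)
  qed
  have \<zeta>z: "norm (\<zeta> m - z) \<le> real m * H" for m
  proof -
    have "norm (\<Sum>j = 1..m. (z' - z) $ e j *\<^sub>R axis (e j) (1::real)) \<le> real (card {1..m}) * H"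
      by (rule sum_norm_bound) (use comp in simp)
    then show ?thesis by (simp add: \<zeta>_def)
  qed
  \<comment> \<open>Needed before each further step as well as at the end. Since
    \<open>H \<le> 1\<close>, the accumulated quadratic error is at most linear in \<open>H\<close>,
    and the smallness assumption keeps the point in the ball where a step is possible.\<close>
  have near: "dist (\<zeta> m, \<tau>) P \<le> R / 4"
    if "m \<le> N" and \<tau>: "\<bar>\<tau> - t - (\<Sum>j = 1..m. (z' $ e j - z $ e j) * speed j A)\<bar> \<le> real m * (K2 * H\<^sup>2)"
        for m \<tau>
  proof -
    have "\<bar>\<Sum>j = 1..m. (z' $ e j - z $ e j) * speed j A\<bar> \<le> (\<Sum>j = 1..m. H * V)"
      by (rule order_trans[OF sum_abs], rule sum_mono) (use comp speedA H0 in \<open>auto simp: abs_mult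
          intro!: mult_mono\<close>)
    then have dt: "\<bar>\<tau> - t\<bar> \<le> real m * (H * V) + real m * (K2 * H\<^sup>2)" using \<tau> by simp
    have "dist (\<zeta> m, \<tau>) A \<le> norm (\<zeta> m - z) + \<bar>\<tau> - t\<bar>"
      using norm_Pair_le[of "\<zeta> m - z" "\<tau> - t"] by (simp add: A dist_norm)
    also have "\<dots> \<le> real m * (H * (1 + V)) + real m * (K2 * (H * H))"
      using \<zeta>z[of m] dt by (simp add: algebra_simps power2_eq_square)
    also have "\<dots> \<le> real m * (H * (1 + V)) + real m * (K2 * (H * 1))"
      using H H0 K0 by (intro add_left_mono mult_left_mono) auto
    also have "\<dots> = real m * (H * (1 + V + K2))" by (simp add: algebra_simps)
    also have "\<dots> \<le> real N * (H * (1 + V + K2))" using that(1) H0 V0 K0 by (intro mult_right_mono) auto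
    also have "\<dots> = real N * (1 + V + K2) * H" by (simp add: mult_ac)
    finally show ?thesis using AP dist_triangle[of "(\<zeta> m, \<tau>)" P A] by linarith
  qed
  have "\<exists>\<tau>. \<bar>u (\<zeta> m, \<tau>) - u A\<bar> \<le> real m * (K * H) \<and>
    \<bar>\<tau> - t - (\<Sum>j = 1..m. (z' $ e j - z $ e j) * speed j A)\<bar> \<le> real m * (K2 * H\<^sup>2)"
    using m
  proof (induction m)
    case 0
    show ?case by (intro exI[of _ t]) (simp add: A \<zeta>_def)
  next
    case (Suc m)
    obtain \<tau> where \<tau>: "\<bar>u (\<zeta> m, \<tau>) - u A\<bar> \<le> real m * (K * H)"
        "\<bar>\<tau> - t - (\<Sum>j = 1..m. (z' $ e j - z $ e j) * speed j A)\<bar> \<le> real m * (K2 * H\<^sup>2)"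
      using Suc by auto
    have mN: "m < N" using Suc.prems by simp
    have XP: "dist (\<zeta> m, \<tau>) P \<le> R / 4" using near[OF _ \<tau>(2)] mN by simp
    define h where "h = z' $ e (Suc m) - z $ e (Suc m)"
    have h: "\<bar>h\<bar> \<le> H" using comp by (simp add: h_def)
    have h2: "h\<^sup>2 \<le> H\<^sup>2" using h H0 by (simp add: abs_le_square_iff[symmetric])
    have j: "Suc m \<in> {1..2 * n - 1}" using mN by (simp add: N_def)
    have "norm (\<zeta> m) \<le> V"
      using XP norm_fst_le[of "\<zeta> m" \<tau>] norm_triangle_sub[of "(\<zeta> m, \<tau>)" P] B0 R
          by (simp add: V dist_norm)
    moreover have "\<bar>h\<bar> * (1 + V) \<le> R / 4" 
      by (rule order_trans[OF mult_right_mono[OF h] H1]) (use V0 in simp)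
    ultimately obtain \<tau>' where \<tau>': "\<bar>\<tau>' - \<tau> - h * speed (Suc m) (\<zeta> m, \<tau>)\<bar> \<le> K * h\<^sup>2"
        "\<bar>u (\<zeta> m + h *\<^sub>R axis (e (Suc m)) 1, \<tau>') - u (\<zeta> m, \<tau>)\<bar> \<le> K * \<bar>h\<bar>"
      using step_exists[OF R j XP, of V h] R by (auto simp: V K_def)
    have speed: "\<bar>speed (Suc m) (\<zeta> m, \<tau>) - speed (Suc m) A\<bar> \<le> (K + 1) * real N * H"
    proof -
      have "\<bar>drift n e (Suc m) (\<zeta> m) - drift n e (Suc m) z\<bar> \<le> real m * H"
        using drift_diff_le[of n e "Suc m" "\<zeta> m" z] \<zeta>z[of m] norm_ge_zero[of "\<zeta> m - z"] by linarith
      moreover have "0 \<le> real m * H" "0 \<le> real m * (K * H)" using H0 K0 by simp_all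
      ultimately have "\<bar>speed (Suc m) (\<zeta> m, \<tau>) - speed (Suc m) A\<bar> \<le> real m * (K * H) + real m * H"
        using \<tau>(1) by (auto simp: speed_def A)
      also have "\<dots> = real m * ((K + 1) * H)" by (simp add: algebra_simps)
      also have "\<dots> \<le> real N * ((K + 1) * H)" using mN H0 K0 by (intro mult_right_mono) auto
      finally show ?thesis by (simp add: mult_ac)
    qed
    have \<zeta>S: "\<zeta> (Suc m) = \<zeta> m + h *\<^sub>R axis (e (Suc m)) 1" by (simp add: \<zeta>_def h_def)
    have "\<bar>u (\<zeta> (Suc m), \<tau>') - u A\<bar> \<le> real m * (K * H) + K * H"
      using \<tau>(1) \<tau>'(2) mult_left_mono[OF h K0(1)] unfolding \<zeta>S by linarith
    moreover have "\<bar>\<tau>' - t - (\<Sum>j = 1..Suc m. (z' $ e j - z $ e j) * speed j A)\<bar> \<le>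
        real (Suc m) * (K2 * H\<^sup>2)"
    proof -
      have "\<bar>h * (speed (Suc m) (\<zeta> m, \<tau>) - speed (Suc m) A)\<bar> \<le> H * ((K + 1) * real N * H)"
        unfolding abs_mult by (rule mult_mono[OF h speed H0]) simp
      then have "\<bar>h * speed (Suc m) (\<zeta> m, \<tau>) - h * speed (Suc m) A\<bar> \<le> (K + 1) * real N * H\<^sup>2"
        by (simp add: power2_eq_square algebra_simps)
      moreover have "K * h\<^sup>2 \<le> K * H\<^sup>2" by (rule mult_left_mono[OF h2 K0(1)])
      ultimately have "\<bar>\<tau>' - t - ((\<Sum>j = 1..m. (z' $ e j - z $ e j) * speed j A) + h * speed (Suc m) A)\<bar>
          \<le> real m * (K2 * H\<^sup>2) + (K * H\<^sup>2 + (K + 1) * real N * H\<^sup>2)"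
        using \<tau>(2) \<tau>'(1) by linarith
      then show ?thesis by (simp add: h_def K2 algebra_simps)
    qed
    ultimately show ?case by (intro exI[of _ \<tau>']) (simp add: distrib_right)
  qed
  then show ?thesis using near[OF m] by blast
qed

text \<open>The coordinate path ends at \<open>(z', \<tau>)\<close> on the vertical line of
  \<open>A'\<close>. The remaining gap \<open>t' - \<tau>\<close> is the quantity under the root in
  the graph distance, up to an error quadratic in \<open>H\<close> and half of
  \<open>(u A' - u A) * (z' $ e n - z $ e n)\<close>. The vertical estimate turns this into a
  quadratic inequality for the difference of values, in which that difference is absorbed.\<close>

theorem intrinsic_Lipschitz_near:
  assumes R: "R > 0" "cball P R \<subseteq> G"
  obtains r L where "r > 0" "L > 0"
    "\<And>A A'. dist A P \<le> r \<Longrightarrow> dist A' P \<le> r \<Longrightarrow> \<bar>u A - u A'\<bar> \<le> L * graph_dist n e u A A'"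
proof -
  define K where "K = C + 2"
  define N where "N = 2 * n - 1"
  define V where "V = B + norm P + R"
  define K2 where "K2 = K + (K + 1) * real N"
  define K' where "K' = C + 1 + 2 * B * (1 + B) / R"
  define W where "W = 1 + V + real N * (1 + V + K2)"
  have K0: "K \<ge> 0" "K2 \<ge> 0" using C0 by (simp_all add: K_def K2_def)
  have K'0: "K' > 0" using C0 B0 R by (simp add: K'_def add_pos_nonneg)
  have V0: "V \<ge> 0" using B0 R by (simp add: V_def)
  have W: "W > 0" "1 + V \<le> W" "real N * (1 + V + K2) \<le> W" using V0 K0
      by (auto simp: W_def add_pos_nonneg)
  \<comment> \<open>\<open>H\<close> is at most \<open>2 * r\<close>, which must not exceed 1; the
    second bound keeps the whole coordinate path within \<open>R / 4\<close> of
    \<open>P\<close>.\<close>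
  define r where "r = min (1 / 2) (R / (8 * (1 + W)))"
  have r: "r > 0" "r \<le> 1 / 2" using R W unfolding r_def by (simp_all only: min.cobounded1, simp)
  have rW: "2 * r * (1 + W) \<le> R / 4"
  proof -
    have "r \<le> R / (8 * (1 + W))" by (simp add: r_def)
    then show ?thesis using W by (simp add: pos_le_divide_eq algebra_simps)
  qed
  define L where "L = 2 * (K * real N + sqrt (8 * K' * (1 + real N * K2) + (4 * K')\<^sup>2)) + 1"
  show thesis
  proof (rule that[OF r(1)])
    have "K * real N + sqrt (8 * K' * (1 + real N * K2) + (4 * K')\<^sup>2) \<ge> 0" using K0 K'0 by simp
    then show "L > 0" by (simp add: L_def)
    fix A A' assume AP: "dist A P \<le> r" and A'P: "dist A' P \<le> r"
    obtain z t where A: "A = (z, t)" by (cases A)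
    obtain z' t' where A': "A' = (z', t')" by (cases A')
    define H where "H = norm (z' - z)"
    have "dist A A' \<le> 2 * r" using AP A'P dist_triangle[of A A' P] by (simp add: dist_commute)
    then have H: "0 \<le> H" "H \<le> 2 * r"
      using dist_fst_le[of A A'] by (simp_all add: H_def A A' dist_norm norm_minus_commute)
    have HW: "H * W \<le> 2 * r * W" using H W by (intro mult_right_mono) auto
    have rW': "r + 2 * r * W \<le> R / 4" "2 * r * W \<le> R / 4" "r \<le> R / 4" using rW r W
      by (auto simp: algebra_simps intro: order_trans[rotated])
    have 1: "H * (1 + V) \<le> R / 4"
      using mult_left_mono[OF W(2) H(1)] HW rW' by linarith
    have 2: "dist A P + real N * (1 + V + K2) * H \<le> R / 4"
      using mult_right_mono[OF W(3) H(1)] HW rW' AP by (simp add: mult.commute)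
    have "H \<le> 1" using H r by simp
    then obtain \<tau> where \<tau>: "\<bar>u (z + (\<Sum>j = 1..N. (z' - z) $ e j *\<^sub>R axis (e j) 1), \<tau>) - u A\<bar> \<le>
        real N * (K * H)"
        "\<bar>\<tau> - t - (\<Sum>j = 1..N. (z' $ e j - z $ e j) * speed j A)\<bar> \<le> real N * (K2 * H\<^sup>2)"
        "dist (z + (\<Sum>j = 1..N. (z' - z) $ e j *\<^sub>R axis (e j) 1), \<tau>) P \<le> R / 4"
      using coordinate_path[OF R A H_def _ V_def 1 K2_def[unfolded K_def N_def] 2[unfolded N_def]
          order_refl]
      unfolding N_def K_def by blast
    have uX: "\<bar>u (z', \<tau>) - u A\<bar> \<le> real N * (K * H)" and XP: "dist (z', \<tau>) P \<le> R / 4"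
      using \<tau>(1,3) unfolding N_def sum_axis[OF num] by simp_all
    define q where "q = t' - t - 1 / 2 * (u A + u A') * (z' $ e n - z $ e n) + sigma_form n e z z'"
    define D where "D = H + sqrt \<bar>q\<bar>"
    have D: "graph_dist n e u A A' = D" by (simp add: graph_dist_def A A' D_def H_def q_def)
    have D0: "D \<ge> 0" "H \<le> D" "\<bar>q\<bar> \<le> D\<^sup>2"
    proof -
      show "D \<ge> 0" "H \<le> D" using H by (simp_all add: D_def)
      have "sqrt \<bar>q\<bar> \<le> D" using H by (simp add: D_def)
      then show "\<bar>q\<bar> \<le> D\<^sup>2" by (rule sqrt_le_D)
    qed
    define \<Delta> where "\<Delta> = \<bar>u A - u A'\<bar>"
    have vert: "\<bar>t' - \<tau>\<bar> \<le> (1 + real N * K2) * D\<^sup>2 + 1 / 2 * \<Delta> * D"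
    proof -
      have "\<bar>z' $ e n - z $ e n\<bar> \<le> H" using component_le_norm_cart[of "z' - z" "e n"]
          by (simp add: H_def)
      then have "\<bar>(u A' - u A) * (z' $ e n - z $ e n)\<bar> \<le> \<Delta> * D"
        unfolding abs_mult using D0 by (intro mult_mono) (auto simp: \<Delta>_def)
      moreover have "H\<^sup>2 \<le> D\<^sup>2" using D0 H by (intro power_mono) auto
      then have "real N * (K2 * H\<^sup>2) \<le> real N * K2 * D\<^sup>2" using K0
          by (simp add: mult.assoc mult_left_mono)
      moreover have "t' - \<tau> = q + 1 / 2 * ((u A' - u A) * (z' $ e n - z $ e n)) -
          (\<tau> - t - (\<Sum>j = 1..N. (z' $ e j - z $ e j) * speed j A))"
        unfolding A sum_speed[OF num] N_def q_def by (simp add: A algebra_simps)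
      ultimately show ?thesis using D0(3) \<tau>(2) unfolding distrib_right by linarith
    qed
    have hoelder: "(u (z', \<tau>) - u A')\<^sup>2 \<le> 8 * K' * \<bar>t' - \<tau>\<bar>"
    proof -
      have A'P': "dist (z', t') P \<le> R / 4" using A'P rW' by (simp add: A')
      consider "\<tau> < t'" | "\<tau> = t'" | "t' < \<tau>" by linarith
      then show ?thesis
      proof cases
        case 1
        then show ?thesis using vertical_Hoelder[OF R K'_def XP A'P' 1] by (simp add: A')
      next
        case 3
        then show ?thesis using vertical_Hoelder[OF R K'_def A'P' XP 3] by (simp add: A' power2_commute)
      qed (simp add: A')
    qed
    show "\<bar>u A - u A'\<bar> \<le> L * graph_dist n e u A A'"
    proof -
      have "\<Delta> \<le> K * real N * D + \<bar>u (z', \<tau>) - u A'\<bar>"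
        using uX mult_left_mono[OF D0(2), of "real N * K"] K0 unfolding \<Delta>_def by (simp add: mult_ac)
      moreover have "\<bar>u (z', \<tau>) - u A'\<bar>\<^sup>2 \<le> 8 * K' * (1 + real N * K2) * D\<^sup>2 + 4 * K' * \<Delta> * D"
        using hoelder mult_left_mono[OF vert, of "8 * K'"] K'0 by (simp add: algebra_simps)
      ultimately have "\<Delta> \<le> 2 * (K * real N + sqrt (8 * K' * (1 + real N * K2) + (4 * K')\<^sup>2)) * D"
        by (rule absorb_quadratic) (use K'0 K0 D0 in \<open>auto simp: \<Delta>_def\<close>)
      also have "\<dots> \<le> L * D" using D0 by (simp add: L_def algebra_simps)
      finally show ?thesis by (simp add: \<Delta>_def D)
    qed
  qed
qed

end

section \<open>Distributional solutions are locally intrinsic Lipschitz\<close>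

lemma frechet_derivative_outside_support:
  fixes \<psi> :: "'a::euclidean_space \<Rightarrow> real"
  assumes "x \<notin> closure {x. \<psi> x \<noteq> 0}"
  shows "frechet_derivative \<psi> (at x) = (\<lambda>_. 0)"
proof -
  have "(\<psi> has_derivative (\<lambda>_. 0)) (at x)"
  proof (rule has_derivative_transform_within_open[where f = "\<lambda>_. 0" and s = "- closure {x. \<psi> x \<noteq> 0}"])
    fix y assume "y \<in> - closure {x. \<psi> x \<noteq> 0}"
    then show "0 = \<psi> y" using closure_subset[of "{x. \<psi> x \<noteq> 0}"] by auto
  qed (use assms in auto)
  then show ?thesis using frechet_derivative_at by metis
qed

lemma integral_lebesgue_on_eq_lborel:
  fixes f g :: "'a::euclidean_space \<Rightarrow> real"
  assumes "open S" "g \<in> borel_measurable borel" "\<And>x. x \<in> S \<Longrightarrow> f x = g x" "\<And>x. x \<notin> S \<Longrightarrow> g x = 0"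
  shows "(LINT x|lebesgue_on S. f x) = (LINT x|lborel. g x)"
proof -
  have "(LINT x|lebesgue_on S. f x) = (LINT x|lebesgue. indicator S x *\<^sub>R f x)"
    by (rule integral_restrict_space) (use assms(1) in simp)
  also have "(\<lambda>x. indicator S x *\<^sub>R f x) = g" using assms(3,4) by (auto simp: indicator_def)
  also have "(LINT x|lebesgue. g x) = (LINT x|lborel. g x)"
    by (rule integral_completion) (use assms(2) in simp)
  finally show ?thesis .
qed

lemma test_function_facts:
  assumes "test_function S \<psi>"
  shows "Ck k \<psi>" "compact (closure {x. \<psi> x \<noteq> 0})" "closure {x. \<psi> x \<noteq> 0} \<subseteq> S" "bounded {x. \<psi> x \<noteq> 0}"
    "x \<notin> closure {x. \<psi> x \<noteq> 0} \<Longrightarrow> \<psi> x = 0"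
proof -
  show "compact (closure {x. \<psi> x \<noteq> 0})" "Ck k \<psi>" "closure {x. \<psi> x \<noteq> 0} \<subseteq> S"
    using assms by (auto simp: test_function_def compactly_contained_def)
  then show "bounded {x. \<psi> x \<noteq> 0}"
    using closure_subset by (metis bounded_subset compact_imp_bounded)
  show "x \<notin> closure {x. \<psi> x \<noteq> 0} \<Longrightarrow> \<psi> x = 0" using closure_subset[of "{x. \<psi> x \<noteq> 0}"] by auto
qed

lemma partial_continuous_on:
  assumes "\<And>k. Ck k \<psi>"
  shows "continuous_on UNIV (partial_z e j \<psi>)" "continuous_on UNIV (partial_t \<psi>)"
  unfolding partial_z_def[abs_def] partial_t_def[abs_def] using assms
      by (auto intro: smooth_derivative(2))

text \<open>The derivatives of a test function vanish off its support, so any continuous function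
  that agrees there with \<open>\<phi>\<close> gives the same weak expression.\<close>

lemma integral_flux_extension:
  assumes "open \<omega>" and \<psi>: "test_function \<omega> \<psi>" and cu: "continuous_on UNIV u"
    and u: "\<And>x. x \<in> closure {x. \<psi> x \<noteq> 0} \<Longrightarrow> u x = \<phi> x"
  shows "(LINT A|lebesgue_on \<omega>. \<phi> A * partial_z e j \<psi> A + flux n e \<phi> j A * partial_t \<psi> A) =
    (LINT A|lborel. u A * partial_z e j \<psi> A + flux n e u j A * partial_t \<psi> A)"
proof (rule integral_lebesgue_on_eq_lborel[OF assms(1)])
  note t = test_function_facts[OF \<psi>]
  have 0: "partial_z e j \<psi> x = 0" "partial_t \<psi> x = 0" if "x \<notin> closure {x. \<psi> x \<noteq> 0}" for x
    using frechet_derivative_outside_support[OF that] by (simp_all add: partial_z_def partial_t_def)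
  show "\<phi> x * partial_z e j \<psi> x + flux n e \<phi> j x * partial_t \<psi> x =
      u x * partial_z e j \<psi> x + flux n e u j x * partial_t \<psi> x" for x
    using 0[of x] u[of x] by (cases "x \<in> closure {x. \<psi> x \<noteq> 0}") (auto simp: flux_def)
  show "u x * partial_z e j \<psi> x + flux n e u j x * partial_t \<psi> x = 0" if "x \<notin> \<omega>" for x
  proof -
    have "x \<notin> closure {x. \<psi> x \<noteq> 0}" using t(3) that by blast
    then show ?thesis using 0 by simp
  qed
  show "(\<lambda>A. u A * partial_z e j \<psi> A + flux n e u j A * partial_t \<psi> A) \<in> borel_measurable borel"
    by (intro borel_measurable_continuous_onI continuous_intros continuous_on_flux cu
        partial_continuous_on t(1))
qed

text \<open>For \<open>j \<noteq> n\<close> the drift coefficient is moved from the test function to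
  \<open>\<phi>\<close>; for \<open>j = n\<close> the definition already has the conservative form.
  All components can then be treated uniformly.\<close>

lemma distributional_solution_iff_flux:
  assumes "n \<ge> 1"
  shows "distributional_solution n e \<omega> \<phi> w \<longleftrightarrow>
    (\<forall>\<psi>. test_function \<omega> \<psi> \<longrightarrow> (\<forall>j\<in>{1..2 * n - 1}.
      (LINT A|lebesgue_on \<omega>. \<phi> A * partial_z e j \<psi> A + flux n e \<phi> j A * partial_t \<psi> A) =
        - (LINT A|lebesgue_on \<omega>. w A $ e j * \<psi> A)))"
proof -
  have n: "\<phi> A * partial_z e n \<psi> A + 1 / 2 * (\<phi> A)\<^sup>2 * partial_t \<psi> A =
      \<phi> A * partial_z e n \<psi> A + flux n e \<phi> n A * partial_t \<psi> A" for \<psi> A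
    by (simp add: flux_def)
  have j: "\<phi> A * nabla n e \<phi> j \<psi> A = \<phi> A * partial_z e j \<psi> A + flux n e \<phi> j A * partial_t \<psi> A"
    if "j \<noteq> n" for j \<psi> A
    using that by (simp add: nabla_def flux_def drift_def algebra_simps)
  have "{1..2 * n - 1} = insert n ({1..2 * n - 1} - {n})" using assms by auto
  then have all: "(\<forall>j\<in>{1..2 * n - 1}. Q j) \<longleftrightarrow> (\<forall>j\<in>{1..2 * n - 1} - {n}. Q j) \<and> Q n" for Q
    by (metis insert_iff)
  show ?thesis
    unfolding distributional_solution_def n all by (simp add: j)
qed

lemma continuous_extension_bounded:
  fixes \<phi> :: "'a::euclidean_space \<Rightarrow> real"
  assumes "compact K" "continuous_on K \<phi>"
  obtains u B where "continuous_on UNIV u" "\<And>x. x \<in> K \<Longrightarrow> u x = \<phi> x" "\<And>x. \<bar>u x\<bar> \<le> B" "B \<ge> 0"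
proof -
  have "bounded (\<phi> ` K)" using assms by (intro compact_imp_bounded compact_continuous_image)
  then obtain B where B: "\<And>x. x \<in> K \<Longrightarrow> norm (\<phi> x) \<le> B" "B \<ge> 0"
    unfolding bounded_iff by (metis abs_ge_zero image_eqI order_trans real_norm_def abs_ge_self)
  have "closedin (top_of_set UNIV) K" using assms(1) by (simp add: compact_imp_closed)
  from Tietze[OF assms(2) this B(2,1)] obtain u where "continuous_on UNIV u" "\<And>x. x \<in> K \<Longrightarrow> u x = \<phi> x"
    "\<And>x. x \<in> UNIV \<Longrightarrow> norm (u x) \<le> B" by metis
  then show thesis using that[of u B] B(2) by simp
qed

text \<open>On a closed ball in \<open>\<omega>\<close> the function \<open>\<phi>\<close> is
  bounded and extends to a bounded continuous \<open>u\<close> by Tietze, while \<open>w\<close> is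
  essentially bounded on the open ball. Test functions supported there do not see the difference
  between \<open>u\<close> and \<open>\<phi>\<close>, so \<open>u\<close> obeys the weak inequality
  with that bound.\<close>

lemma solution_intrinsic_Lipschitz_near:
  assumes "n \<ge> 1" "coord_numbering n e" "open \<omega>" "continuous_on \<omega> \<phi>"
    and w: "Linfty_loc \<omega> w" and sol: "distributional_solution n e \<omega> \<phi> w" and P: "P \<in> \<omega>"
  obtains r L where "r > 0" "L > 0"
    "\<And>A A'. dist A P \<le> r \<Longrightarrow> dist A' P \<le> r \<Longrightarrow> \<bar>\<phi> A - \<phi> A'\<bar> \<le> L * graph_dist n e \<phi> A A'"
proof -
  obtain R where R: "R > 0" "cball P R \<subseteq> \<omega>" using assms(3) P by (auto simp: open_contains_cball)
  obtain u B where u: "continuous_on UNIV u" "\<And>x. x \<in> cball P R \<Longrightarrow> u x = \<phi> x" "\<And>x. \<bar>u x\<bar> \<le> B"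
    using continuous_extension_bounded[of "cball P R" \<phi>] R(2) assms(4)
        by (metis compact_cball continuous_on_subset)
  define G where "G = ball P R"
  have "closure G \<subseteq> cball P R" unfolding G_def by (rule closure_minimal) auto
  then have "compactly_contained G \<omega>"
    using R by (auto simp: compactly_contained_def G_def compact_closure)
  then obtain C0 where C0: "AE x in lebesgue_on G. norm (w x) \<le> C0"
    using w open_ball[of P R] unfolding Linfty_loc_def G_def by blast
  define C where "C = max C0 0"
  have wC: "AE x in lebesgue_on \<omega>. x \<in> G \<longrightarrow> norm (w x) \<le> C"
  proof -
    have "AE x in lebesgue. x \<in> G \<longrightarrow> norm (w x) \<le> C0"
      using C0 by (subst (asm) AE_restrict_space_iff) (simp_all add: G_def)
    then have "AE x in lebesgue. x \<in> G \<longrightarrow> norm (w x) \<le> C"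
        by eventually_elim (auto simp: C_def intro: max.coboundedI1)
    then show ?thesis using assms(3) by (subst AE_restrict_space_iff) auto
  qed
  interpret weak_balance_law n e u G B C
  proof
    fix \<psi> j assume \<psi>: "test_function G \<psi>" "\<And>A. 0 \<le> \<psi> A" and j: "j \<in> {1..2 * n - 1}"
    note t = test_function_facts[OF \<psi>(1)]
    have G\<omega>: "G \<subseteq> cball P R" "G \<subseteq> \<omega>" using R by (auto simp: G_def)
    then have \<psi>': "test_function \<omega> \<psi>" using \<psi>(1) by (auto simp: test_function_def
        compactly_contained_def)
    have "(LINT A|lborel. u A * partial_z e j \<psi> A + flux n e u j A * partial_t \<psi> A) =
        (LINT A|lebesgue_on \<omega>. \<phi> A * partial_z e j \<psi> A + flux n e \<phi> j A * partial_t \<psi> A)"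
      by (rule integral_flux_extension[symmetric, OF assms(3) \<psi>' u(1)]) (use u(2) t(3) G\<omega> in auto)
    also have "\<dots> = - (LINT A|lebesgue_on \<omega>. w A $ e j * \<psi> A)"
      using sol \<psi>' j by (simp add: distributional_solution_iff_flux[OF assms(1)])
    also have "\<bar>\<dots>\<bar> \<le> (LINT A|lebesgue_on \<omega>. \<bar>w A $ e j * \<psi> A\<bar>)" by simp
    also have "\<dots> \<le> (LINT A|lebesgue_on \<omega>. C * \<psi> A)"
    proof (rule integral_mono_AE')
      have c\<psi>: "continuous_on UNIV (\<lambda>A. C * \<psi> A)" by (intro continuous_intros Ck_continuous[OF t(1)])
      have "integrable lborel (\<lambda>A. C * \<psi> A)"
        by (intro integrable_mult_right integrable_continuous_bounded_support Ck_continuous[OF t(1)]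
            t(4))
      then have "integrable lebesgue (\<lambda>A. C * \<psi> A)"
        by (subst integrable_completion) (use borel_measurable_continuous_onI[OF c\<psi>] in simp_all)
      then have "integrable lebesgue (\<lambda>A. indicator \<omega> A *\<^sub>R (C * \<psi> A))"
        using assms(3) by (intro integrable_mult_indicator) auto
      then show "integrable (lebesgue_on \<omega>) (\<lambda>A. C * \<psi> A)"
        using assms(3) by (subst integrable_restrict_space) auto
      show "AE A in lebesgue_on \<omega>. \<bar>w A $ e j * \<psi> A\<bar> \<le> C * \<psi> A"
        using wC
      proof eventually_elim
        case (elim A)
        show ?case
        proof (cases "A \<in> G")
          case True
          then have "\<bar>w A $ e j\<bar> \<le> C" using elim component_le_norm_cart[of "w A" "e j"] by simp
          then show ?thesis using \<psi>(2)[of A] by (simp add: abs_mult mult_right_mono)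
        next
          case False
          then have "\<psi> A = 0" using t(3,5) by blast
          then show ?thesis by simp
        qed
      qed
      show "AE A in lebesgue_on \<omega>. 0 \<le> C * \<psi> A" using \<psi>(2) by (auto simp: C_def)
    qed
    also have "\<dots> = (LINT A|lborel. C * \<psi> A)"
    proof (rule integral_lebesgue_on_eq_lborel[OF assms(3)])
      show "(\<lambda>A. C * \<psi> A) \<in> borel_measurable borel"
        by (intro borel_measurable_continuous_onI continuous_intros Ck_continuous[OF t(1)])
      show "C * \<psi> A = 0" if "A \<notin> \<omega>" for A
      proof -
        have "A \<notin> closure {x. \<psi> x \<noteq> 0}" using t(3) G\<omega>(2) that by blast
        from t(5)[OF this] show ?thesis by simp
      qed
    qed simp
    finally show "\<bar>LINT A|lborel. u A * partial_z e j \<psi> A + flux n e u j A * partial_t \<psi> A\<bar> \<le>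
        C * (LINT A|lborel. \<psi> A)"
      by simp
  qed (use assms u in \<open>auto simp: C_def\<close>)
  have "cball P (R / 2) \<subseteq> G" using R by (auto simp: G_def)
  then obtain r L where rL: "r > 0" "L > 0"
    "\<And>A A'. dist A P \<le> r \<Longrightarrow> dist A' P \<le> r \<Longrightarrow> \<bar>u A - u A'\<bar> \<le> L * graph_dist n e u A A'"
    using intrinsic_Lipschitz_near[of "R / 2" P] R by (metis half_gt_zero)
  show thesis
  proof (rule that[of "min r R" L])
    fix A A' assume A: "dist A P \<le> min r R" "dist A' P \<le> min r R"
    then have "u A = \<phi> A" "u A' = \<phi> A'" using u(2) by (auto simp: dist_commute)
    moreover from this have "graph_dist n e u A A' = graph_dist n e \<phi> A A'"
      by (cases A; cases A') (simp add: graph_dist_def)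
    ultimately show "\<bar>\<phi> A - \<phi> A'\<bar> \<le> L * graph_dist n e \<phi> A A'" using rL(3)[of A A'] A by simp
  qed (use rL R in auto)
qed

section \<open>From neighbourhoods of points to compactly contained sets\<close>

lemma graph_dist_nonneg: "graph_dist n e \<phi> A A' \<ge> 0"
  by (auto simp: graph_dist_def split: prod.splits)

lemma graph_dist_eq:
  "graph_dist n e \<phi> A A' = norm (fst A' - fst A) +
    sqrt \<bar>snd A' - snd A - 1 / 2 * (\<phi> A + \<phi> A') * (fst A' $ e n - fst A $ e n) +
        sigma_form n e (fst A) (fst A')\<bar>"
  by (simp add: graph_dist_def case_prod_beta)

lemma graph_dist_eq_0_imp: "graph_dist n e \<phi> A A' = 0 \<Longrightarrow> A = A'"
proof -
  assume 0: "graph_dist n e \<phi> A A' = 0"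
  let ?q = "\<bar>snd A' - snd A - 1 / 2 * (\<phi> A + \<phi> A') * (fst A' $ e n - fst A $ e n) +
      sigma_form n e (fst A) (fst A')\<bar>"
  have "norm (fst A' - fst A) \<ge> 0" "sqrt ?q \<ge> 0" by simp_all
  then have "norm (fst A' - fst A) = 0" "sqrt ?q = 0" using 0 unfolding graph_dist_eq by linarith+
  then have z: "fst A' = fst A" and q: "?q = 0" by simp_all
  from q have "snd A' = snd A" unfolding z by (simp add: sigma_form_def)
  with z show ?thesis by (simp add: prod_eq_iff)
qed

lemma tendsto_graph_dist:
  assumes "(a \<longlongrightarrow> A) F" "(b \<longlongrightarrow> A') F" "((\<lambda>k. \<phi> (a k)) \<longlongrightarrow> \<phi> A) F" "((\<lambda>k. \<phi> (b k)) \<longlongrightarrow> \<phi> A') F"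
  shows "((\<lambda>k. graph_dist n e \<phi> (a k) (b k)) \<longlongrightarrow> graph_dist n e \<phi> A A') F"
  unfolding graph_dist_eq sigma_form_def by (intro tendsto_intros assms)

text \<open>No triangle inequality for \<open>graph_dist\<close> is used. Pairs violating the bound
  with constants tending to infinity accumulate at a pair \<open>A\<close>, \<open>A'\<close>; as
  the differences of \<open>\<phi>\<close> stay bounded, the graph distance of the limit pair is
  zero, which forces \<open>A' = A\<close>. Late pairs then lie in the neighbourhood of
  \<open>A\<close> where the local bound holds.\<close>

lemma locally_intrinsic_LipschitzI:
  assumes c: "continuous_on \<omega> \<phi>"
    and near: "\<And>P. P \<in> \<omega> \<Longrightarrow> \<exists>r L. r > 0 \<and> L > 0 \<and>
      (\<forall>A A'. dist A P \<le> r \<longrightarrow> dist A' P \<le> r \<longrightarrow> \<bar>\<phi> A - \<phi> A'\<bar> \<le> L * graph_dist n e \<phi> A A')"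
  shows "locally_intrinsic_Lipschitz_on n e \<omega> \<phi>"
  unfolding locally_intrinsic_Lipschitz_on_def
proof (intro allI impI, rule ccontr)
  fix \<omega>' assume "open \<omega>' \<and> compactly_contained \<omega>' \<omega>"
  then have K: "compact (closure \<omega>')" "closure \<omega>' \<subseteq> \<omega>" by (auto simp: compactly_contained_def)
  assume "\<not> intrinsic_Lipschitz_on n e \<omega>' \<phi>"
  then have ex: "\<exists>A\<in>\<omega>'. \<exists>A'\<in>\<omega>'. \<bar>\<phi> A - \<phi> A'\<bar> > real (Suc k) * graph_dist n e \<phi> A A'" for k
    unfolding intrinsic_Lipschitz_on_def by (metis not_less of_nat_0_less_iff zero_less_Suc)
  then obtain a b where ab: "\<And>k. a k \<in> \<omega>'" "\<And>k. b k \<in> \<omega>'"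
      "\<And>k. \<bar>\<phi> (a k) - \<phi> (b k)\<bar> > real (Suc k) * graph_dist n e \<phi> (a k) (b k)"
  proof -
    have "\<forall>k. \<exists>p. fst p \<in> \<omega>' \<and> snd p \<in> \<omega>' \<and>
        \<bar>\<phi> (fst p) - \<phi> (snd p)\<bar> > real (Suc k) * graph_dist n e \<phi> (fst p) (snd p)"
      using ex by fastforce
    from choice[OF this] obtain p where "\<forall>k. fst (p k) \<in> \<omega>' \<and> snd (p k) \<in> \<omega>' \<and>
        \<bar>\<phi> (fst (p k)) - \<phi> (snd (p k))\<bar> > real (Suc k) * graph_dist n e \<phi> (fst (p k)) (snd (p k))" ..
    then show thesis using that[of "\<lambda>k. fst (p k)" "\<lambda>k. snd (p k)"] by blast
  qed
  have abK: "\<forall>k. (a k, b k) \<in> closure \<omega>' \<times> closure \<omega>'" using ab(1,2) closure_subset by blast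
  have "seq_compact (closure \<omega>' \<times> closure \<omega>')" using K(1)
      by (intro compact_imp_seq_compact compact_Times)
  then obtain l r where l: "l \<in> closure \<omega>' \<times> closure \<omega>'" "strict_mono r" "((\<lambda>k. (a k, b k)) \<circ> r) \<longlonglongrightarrow> l"
    by (rule seq_compactE[OF _ abK])
  obtain A A' where AA: "l = (A, A')" by (cases l)
  have lim: "(\<lambda>k. a (r k)) \<longlonglongrightarrow> A" "(\<lambda>k. b (r k)) \<longlonglongrightarrow> A'"
    using tendsto_fst[OF l(3)] tendsto_snd[OF l(3)] by (simp_all add: AA o_def)
  have A: "A \<in> closure \<omega>'" "A' \<in> closure \<omega>'" using l(1) by (auto simp: AA)
  have \<phi>lim: "(\<lambda>k. \<phi> (c (r k))) \<longlonglongrightarrow> \<phi> X" if "(\<lambda>k. c (r k)) \<longlonglongrightarrow> X" "X \<in> closure \<omega>'" "\<And>k. c k \<in> \<omega>'" for c X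
  proof (rule continuous_on_tendsto_compose[OF c that(1)])
    show "X \<in> \<omega>" using that(2) K by blast
    show "\<forall>\<^sub>F k in sequentially. c (r k) \<in> \<omega>" using that(3) K(2) closure_subset
        by (intro always_eventually) blast
  qed
  note \<phi>A = \<phi>lim[OF lim(1) A(1) ab(1)] and \<phi>A' = \<phi>lim[OF lim(2) A(2) ab(2)]
  have glim: "(\<lambda>k. graph_dist n e \<phi> (a (r k)) (b (r k))) \<longlonglongrightarrow> graph_dist n e \<phi> A A'"
    by (rule tendsto_graph_dist[OF lim \<phi>A \<phi>A'])
  have "graph_dist n e \<phi> A A' = 0"
  proof (rule ccontr)
    assume "graph_dist n e \<phi> A A' \<noteq> 0"
    then have pos: "graph_dist n e \<phi> A A' > 0" using graph_dist_nonneg by (simp add: less_le)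
    have "filterlim (\<lambda>k. real (Suc (r k))) at_top sequentially"
      using filterlim_compose[OF filterlim_real_sequentially filterlim_compose[OF filterlim_Suc
          filterlim_subseq[OF l(2)]]] .
    then have "filterlim (\<lambda>k. graph_dist n e \<phi> (a (r k)) (b (r k)) * real (Suc (r k))) at_top
        sequentially"
      by (rule filterlim_tendsto_pos_mult_at_top[OF glim pos])
    then have "filterlim (\<lambda>k. \<bar>\<phi> (a (r k)) - \<phi> (b (r k))\<bar>) at_top sequentially"
      by (rule filterlim_at_top_mono) (use less_imp_le[OF ab(3)] in \<open>auto simp: mult.commute\<close>)
    moreover have "(\<lambda>k. \<bar>\<phi> (a (r k)) - \<phi> (b (r k))\<bar>) \<longlonglongrightarrow> \<bar>\<phi> A - \<phi> A'\<bar>" by (intro tendsto_intros \<phi>A \<phi>A')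
    ultimately show False using not_tendsto_and_filterlim_at_infinity[OF sequentially_bot _
        filterlim_at_top_imp_at_infinity] by blast
  qed
  then have [simp]: "A' = A" by (rule graph_dist_eq_0_imp[symmetric])
  obtain s L where sL: "s > 0" "L > 0"
    "\<And>X Y. dist X A \<le> s \<Longrightarrow> dist Y A \<le> s \<Longrightarrow> \<bar>\<phi> X - \<phi> Y\<bar> \<le> L * graph_dist n e \<phi> X Y"
    using near[of A] A K by blast
  have "\<forall>\<^sub>F k in sequentially. dist (a (r k)) A < s" "\<forall>\<^sub>F k in sequentially. dist (b (r k)) A < s"
    using tendstoD[OF lim(1) sL(1)] tendstoD[OF lim(2) sL(1)] by simp_all
  moreover have "\<forall>\<^sub>F k in sequentially. L \<le> real k"
    using filterlim_real_sequentially by (simp add: filterlim_at_top)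
  ultimately have "\<forall>\<^sub>F k in sequentially. False"
  proof eventually_elim
    case (elim k)
    have "real (Suc (r k)) * graph_dist n e \<phi> (a (r k)) (b (r k)) < L * graph_dist n e \<phi> (a (r k)) (b (r
        k))"
      using ab(3)[of "r k"] sL(3)[of "a (r k)" "b (r k)"] elim by linarith
    then have "real (Suc (r k)) < L" using graph_dist_nonneg[of n e \<phi> "a (r k)" "b (r k)"]
        by (simp add: mult_less_cancel_right)
    then show False using elim(3) seq_suble[OF l(2), of k] by linarith
  qed
  then show False by simp
qed

lemma solution_imp_locally_intrinsic_Lipschitz:
  assumes "n \<ge> 1" "coord_numbering n e" "open \<omega>" "continuous_on \<omega> \<phi>"
    and "Linfty_loc \<omega> w" "distributional_solution n e \<omega> \<phi> w"
  shows "locally_intrinsic_Lipschitz_on n e \<omega> \<phi>"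
  by (rule locally_intrinsic_LipschitzI[OF assms(4)]) (metis solution_intrinsic_Lipschitz_near[OF
      assms])

section \<open>Sequential weak* compactness\<close>

lemma diagonal_convergent:
  fixes a :: "nat \<Rightarrow> nat \<Rightarrow> real"
  assumes b: "\<And>n k. \<bar>a n k\<bar> \<le> c n"
  obtains r :: "nat \<Rightarrow> nat" where "strict_mono r" "\<And>n. convergent (\<lambda>k. a n (r k))"
proof -
  interpret subseqs "\<lambda>n s. convergent (\<lambda>k. a n (s k))"
  proof
    fix n and s :: "nat \<Rightarrow> nat" assume "strict_mono s"
    have "\<forall>k. a n (s k) \<in> {- c n..c n}" using b[of n] by (auto simp: abs_le_iff minus_le_iff)
    then obtain l r where "strict_mono r" "((\<lambda>k. a n (s k)) \<circ> r) \<longlonglongrightarrow> l"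
      using compact_Icc[of "- c n" "c n", unfolded compact_def] by metis
    then show "\<exists>r'. strict_mono r' \<and> convergent (\<lambda>k. a n ((s \<circ> r') k))"
      by (auto simp: convergent_def o_def)
  qed
  have "convergent (\<lambda>k. a n (diagseq k))" for n
  proof -
    \<comment> \<open>The property with index \<open>n\<close> holds for the diagonal only from
      position \<open>Suc n\<close> on, where it is a subsequence of the sequence selected for
      \<open>n\<close>; the initial segment is dropped afterwards.\<close>
    have "convergent (\<lambda>k. a n ((diagseq \<circ> (+) (Suc n)) k))"
    proof (rule diagseq_holds)
      fix r s :: "nat \<Rightarrow> nat" and m
      assume "strict_mono r" "convergent (\<lambda>k. a m (s k))"
      then show "convergent (\<lambda>k. a m ((s \<circ> r) k))"
        using convergent_subseq_convergent[of "\<lambda>k. a m (s k)" r] by (simp add: o_def)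
    qed
    then show ?thesis
      using convergent_ignore_initial_segment[of "\<lambda>k. a n (diagseq k)" "Suc n"]
          by (simp add: add.commute)
  qed
  then show thesis using that subseq_diagseq by blast
qed

text \<open>Sequences that are uniform limits of convergent ones are Cauchy. This handles countable
  disjoint unions, which finite unions approximate uniformly in the index of the sequence.\<close>

lemma convergent_approximation:
  fixes a :: "nat \<Rightarrow> real"
  assumes "\<And>\<epsilon>. \<epsilon> > 0 \<Longrightarrow> \<exists>b. convergent b \<and> (\<forall>k. \<bar>a k - b k\<bar> \<le> \<epsilon>)"
  shows "convergent a"
proof (rule Cauchy_convergent, rule CauchyI)
  fix e :: real assume "e > 0"
  then obtain b where b: "convergent b" "\<And>k. \<bar>a k - b k\<bar> \<le> e / 4" using assms[of "e / 4"] by auto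
  then obtain N where N: "\<And>m k. m \<ge> N \<Longrightarrow> k \<ge> N \<Longrightarrow> norm (b m - b k) < e / 4"
    using CauchyD[OF convergent_Cauchy[OF b(1)], of "e / 4"] \<open>e > 0\<close> by auto
  have "norm (a m - a k) < e" if "m \<ge> N" "k \<ge> N" for m k
  proof -
    have "\<bar>a m - a k\<bar> \<le> \<bar>a m - b m\<bar> + \<bar>b m - b k\<bar> + \<bar>a k - b k\<bar>" by linarith
    then show ?thesis using N[OF that] b(2)[of m] b(2)[of k] \<open>e > 0\<close> unfolding real_norm_def by linarith
  qed
  then show "\<exists>M. \<forall>m\<ge>M. \<forall>n\<ge>M. norm (a m - a n) < e" by blast
qed

text \<open>Finite intersections of a countable basis. Countability serves the diagonal argument and
  closure under intersection the induction over sigma-algebras; \<open>UNIV\<close>, the empty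
  intersection, is what complements are compared with.\<close>

lemma countable_Int_stable_generator:
  obtains G :: "'a::second_countable_topology set set"
  where "countable G" "Int_stable G" "UNIV \<in> G" "sets borel = sigma_sets UNIV G"
proof -
  obtain B :: "'a set set" where B: "countable B" "topological_basis B" using ex_countable_basis
      by blast
  define G where "G = Inter ` {F. finite F \<and> F \<subseteq> B}"
  have BG: "B \<subseteq> G"
  proof
    fix b assume "b \<in> B"
    then show "b \<in> G" unfolding G_def by (intro image_eqI[of _ _ "{b}"]) auto
  qed
  have "countable G" unfolding G_def using B(1) by (intro countable_image
      countable_Collect_finite_subset)
  moreover have "Int_stable G"
  proof (rule Int_stableI)
    fix a b assume "a \<in> G" "b \<in> G"
    then obtain E F where "finite E" "E \<subseteq> B" "finite F" "F \<subseteq> B" "a = \<Inter>E" "b = \<Inter>F" by (auto simp: G_def)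
    then show "a \<inter> b \<in> G" unfolding G_def by (intro image_eqI[of _ _ "E \<union> F"]) auto
  qed
  moreover have "UNIV \<in> G" unfolding G_def by (rule image_eqI[of _ _ "{}"]) auto
  moreover have "sets borel = sigma_sets UNIV G"
  proof
    have "sets borel = sigma_sets UNIV B"
      using arg_cong[OF borel_eq_countable_basis[OF B], of sets] by (simp add: sets_measure_of)
    then show "sets borel \<subseteq> sigma_sets UNIV G" using sigma_sets_mono''[of UNIV UNIV B G] BG
      by (metis sigma_sets_mono')
    have "G \<subseteq> sets borel"
    proof
      fix g assume "g \<in> G"
      then obtain F where F: "finite F" "F \<subseteq> B" "g = \<Inter>F" by (auto simp: G_def)
      then have "open g" using topological_basis_open[OF B(2)] by (auto intro!: open_Inter)
      then show "g \<in> sets borel" by simp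
    qed
    then show "sigma_sets UNIV G \<subseteq> sets borel" using sets.sigma_sets_subset[of G borel] by simp
  qed
  ultimately show thesis by (rule that)
qed

text \<open>
  The limit of the set functions \<open>E \<mapsto> \<integral>\<^sub>E v\<^sub>k\<close> along a diagonal sequence is absolutely continuous,
      and its
  density is the weak* limit.
\<close>

lemma weak_star_compactness_finite:
  fixes v :: "nat \<Rightarrow> 'a::second_countable_topology \<Rightarrow> real"
  assumes "finite_measure M" and sM: "sets M = sets borel"
    and v: "\<And>k. v k \<in> borel_measurable borel" "\<And>k x. \<bar>v k x\<bar> \<le> 1"
  obtains r :: "nat \<Rightarrow> nat" and g where "strict_mono r" "g \<in> borel_measurable borel" "\<And>x. \<bar>g x\<bar> \<le> 1"
    "\<And>E. E \<in> sets borel \<Longrightarrow> (\<lambda>k. \<integral>x. v (r k) x * indicator E x \<partial>M) \<longlonglongrightarrow> (\<integral>x. g x * indicator E x \<partial>M)"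
proof -
  interpret finite_measure M by fact
  note [measurable_cong] = sM
  note [measurable] = v(1)
  have space: "space M = UNIV" using sets_eq_imp_space_eq[OF sM] by simp
  obtain G :: "'a set set" where G: "countable G" "Int_stable G" "UNIV \<in> G"
      "sets borel = sigma_sets UNIV G"
    using countable_Int_stable_generator by blast
  define J where "J k E = (\<integral>x. v k x * indicator E x \<partial>M)" for k E
  have int: "integrable M (\<lambda>x. v k x * indicator E x)" if [measurable]: "E \<in> sets borel" for k E
    by (rule integrable_const_bound[where B = 1]) (use v(2) in \<open>auto split: split_indicator\<close>)
  have int1: "integrable M (indicator E :: 'a \<Rightarrow> real)" if "E \<in> sets borel" for E
    using that sM by (intro integrable_real_indicator) (auto simp: less_top[symmetric])
  have J_le: "\<bar>J k E\<bar> \<le> measure M E" if [measurable]: "E \<in> sets borel" for k E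
  proof -
    have "\<bar>J k E\<bar> \<le> (\<integral>x. \<bar>v k x * indicator E x\<bar> \<partial>M)" unfolding J_def by simp
    also have "\<dots> \<le> (\<integral>x. indicator E x \<partial>M)"
      by (rule integral_mono) (use v(2) int[OF that] int1[OF that] in \<open>auto split: split_indicator\<close>)
    also have "\<dots> = measure M E" by (simp add: space)
    finally show ?thesis .
  qed
  have J_diff: "J k (E \<union> F) = J k E + J k F" if "E \<in> sets borel" "F \<in> sets borel" "E \<inter> F = {}" for k E F
  proof -
    have "J k (E \<union> F) = (\<integral>x. v k x * indicator E x + v k x * indicator F x \<partial>M)"
      unfolding J_def using that(3) by (intro Bochner_Integration.integral_cong) (auto simp:
          indicator_def)
    then show ?thesis unfolding J_def using int[OF that(1)] int[OF that(2)] by simp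
  qed
  obtain r where r: "strict_mono r" "\<And>n. convergent (\<lambda>k. J (r k) (from_nat_into G n))"
  proof (rule diagonal_convergent[of "\<lambda>n k. J k (from_nat_into G n)"
      "\<lambda>n. measure M (from_nat_into G n)"])
    have "from_nat_into G n \<in> sets borel" for n
      unfolding G(4) using from_nat_into[of G n] G(3) by (intro sigma_sets.Basic) auto
    then show "\<bar>J k (from_nat_into G n)\<bar> \<le> measure M (from_nat_into G n)" for n k by (rule J_le)
  qed auto
  have G_Pow: "G \<subseteq> Pow UNIV" by simp
  have conv: "convergent (\<lambda>k. J (r k) E)" if "E \<in> sigma_sets UNIV G" for E
    using G(2) G_Pow that
  proof (induction rule: sigma_sets_induct_disjoint)
    case (basic E)
    then obtain n where "E = from_nat_into G n" using from_nat_into_surj[OF G(1)] by metis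
    then show ?case using r(2) by simp
  next
    case empty
    show ?case by (simp add: J_def convergent_const)
  next
    case (compl E)
    obtain n where n: "UNIV = from_nat_into G n" using from_nat_into_surj[OF G(1,3)] by metis
    have "J (r k) (UNIV - E) = J (r k) UNIV - J (r k) E" for k
      using J_diff[of "UNIV - E" E "r k"] compl(1) sigma_sets.Compl[OF compl(1)] G(4)
          by (simp add: Diff_Int_distrib2)
    then show ?case using convergent_diff[OF r(2)[of n] compl(2)] n by simp
  next
    case (union A)
    have A: "range A \<subseteq> sets borel" using union(2) G(4) by simp
    show ?case
    proof (rule convergent_approximation)
      fix \<epsilon> :: real assume \<epsilon>: "\<epsilon> > 0"
      \<comment> \<open>The tails of the union. Their measure tends to zero and dominates every
        \<open>J k\<close>, so cutting off the tail makes an error that is small uniformly in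
        \<open>k\<close>.\<close>
      define T where "T n = (\<Union>i. A (i + n))" for n
      have Tm: "T n \<in> sets borel" for n using A by (auto simp: T_def)
      have "decseq T" unfolding decseq_def T_def
      proof (intro allI impI subsetI)
        fix m n x assume "m \<le> n" "x \<in> (\<Union>i. A (i + n))"
        then obtain i where "x \<in> A (i + n)" by blast
        then have "x \<in> A ((i + (n - m)) + m)" using \<open>m \<le> n\<close> by simp
        then show "x \<in> (\<Union>i. A (i + m))" by blast
      qed
      moreover have "(\<Inter>n. T n) = {}"
      proof -
        have False if xT: "\<And>n. x \<in> T n" for x
        proof -
          obtain i where i: "x \<in> A i" using xT[of 0] by (auto simp: T_def)
          obtain j where "x \<in> A (j + Suc i)" using xT[of "Suc i"] by (auto simp: T_def)
          moreover have "A i \<inter> A (j + Suc i) = {}" using union(1) by (auto simp: disjoint_family_on_def)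
          ultimately show False using i by blast
        qed
        then show ?thesis by blast
      qed
      ultimately have "(\<lambda>n. measure M (T n)) \<longlonglongrightarrow> 0"
        using finite_Lim_measure_decseq[of T] Tm sM by auto
      then have "\<forall>\<^sub>F n in sequentially. measure M (T n) < \<epsilon>" using \<epsilon> by (rule order_tendstoD(2))
      then obtain n where n: "measure M (T n) < \<epsilon>" unfolding eventually_sequentially by blast
      have fin: "J k (\<Union>i<n. A i) = (\<Sum>i<n. J k (A i))" for k n
      proof (induction n)
        case (Suc n)
        have "A i \<inter> A n = {}" if "i < n" for i using union(1) that
            by (auto simp: disjoint_family_on_def)
        then have "(\<Union>i<n. A i) \<inter> A n = {}" by blast
        moreover have "(\<Union>i<Suc n. A i) = (\<Union>i<n. A i) \<union> A n" by (auto simp: lessThan_Suc)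
        moreover have "(\<Union>i<n. A i) \<in> sets borel" "A n \<in> sets borel" using A by auto
        ultimately show ?case using Suc J_diff[of "\<Union>i<n. A i" "A n" k] by simp
      qed (simp add: J_def)
      have "\<bar>J (r k) (\<Union>i. A i) - (\<Sum>i<n. J (r k) (A i))\<bar> \<le> \<epsilon>" for k
      proof -
        have "(\<Union>i. A i) = (\<Union>i<n. A i) \<union> T n"
        proof (intro equalityI subsetI)
          fix x assume "x \<in> (\<Union>i. A i)"
          then obtain i where i: "x \<in> A i" by blast
          show "x \<in> (\<Union>i<n. A i) \<union> T n"
          proof (cases "i < n")
            case False
            then have "x \<in> A ((i - n) + n)" using i by simp
            then show ?thesis unfolding T_def by blast
          qed (use i in auto)
        qed (auto simp: T_def)
        moreover have "(\<Union>i<n. A i) \<inter> T n = {}"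
        proof -
          have "A i \<inter> A (j + n) = {}" if "i < n" for i j using union(1) that
              by (auto simp: disjoint_family_on_def)
          then show ?thesis unfolding T_def by blast
        qed
        moreover have "(\<Union>i<n. A i) \<in> sets borel" using A by auto
        ultimately have "J (r k) (\<Union>i. A i) = J (r k) (\<Union>i<n. A i) + J (r k) (T n)" using J_diff Tm
            by metis
        then show ?thesis using fin[of "r k" n] J_le[OF Tm[of n], of "r k"] n by simp
      qed
      moreover have "convergent (\<lambda>k. \<Sum>i<n. J (r k) (A i))" by (rule convergent_sum) (rule union(3))
      ultimately show "\<exists>b. convergent b \<and> (\<forall>k. \<bar>J (r k) (\<Union>i. A i) - b k\<bar> \<le> \<epsilon>)" by blast
    qed
  qed
  define l where "l E = lim (\<lambda>k. J (r k) E)" for E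
  have l: "(\<lambda>k. J (r k) E) \<longlonglongrightarrow> l E" if "E \<in> sets borel" for E
    unfolding l_def using conv[of E] that G(4) by (simp add: convergent_LIMSEQ_iff)
  have l_le: "\<bar>l E\<bar> \<le> measure M E" if "E \<in> sets borel" for E
    using tendsto_rabs[OF l[OF that]] by (rule LIMSEQ_le_const2) (use J_le[OF that] in auto)
  have l_add: "l (E \<union> F) = l E + l F" if "E \<in> sets borel" "F \<in> sets borel" "E \<inter> F = {}" for E F
  proof -
    have "(\<lambda>k. J (r k) (E \<union> F)) \<longlonglongrightarrow> l E + l F"
      unfolding J_diff[OF that] by (intro tendsto_add l that)
    then show ?thesis using LIMSEQ_unique l that by blast
  qed
  \<comment> \<open>The limit \<open>l\<close> is signed but bounded by the measure; adding the
    measure gives a set function between zero and twice the measure. Its density lies between 0 and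
    2 almost everywhere, and subtracting 1 recovers the density of \<open>l\<close>.\<close>
  define \<mu> where "\<mu> E = ennreal (l E + measure M E)" for E
  define N where "N = measure_of UNIV (sets borel :: 'a set set) \<mu>"
  have nn: "l E + measure M E \<ge> 0" if "E \<in> sets borel" for E using l_le[OF that] by linarith
  have l0: "l {} = 0" using l_le[of "{}"] by simp
  have emN: "emeasure N E = \<mu> E" if "E \<in> sets borel" for E
  proof (rule emeasure_measure_of[OF N_def])
    show "positive (sets N) \<mu>" by (simp add: positive_def \<mu>_def l0)
    have sN: "sets N = sets borel" unfolding N_def by (simp add: sets.sigma_sets_eq[of borel,
        simplified])
    interpret ring_of_sets UNIV "sets N" unfolding sN using sets.ring_of_sets_axioms[of borel] by simp
    \<comment> \<open>Finite additivity passes to the limit. Countable additivity then follows from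
      continuity at the empty set, where twice the measure is a majorant.\<close>
    show "countably_additive (sets N) \<mu>"
    proof (rule empty_continuous_imp_countably_additive)
      show "positive (sets N) \<mu>" by (simp add: positive_def \<mu>_def l0)
      show "additive (sets N) \<mu>"
      proof (unfold additive_def, intro ballI impI)
        fix E F assume "E \<in> sets N" "F \<in> sets N" and d: "E \<inter> F = {}"
        then have EF: "E \<in> sets borel" "F \<in> sets borel" by (simp_all add: sN)
        have "measure M (E \<union> F) = measure M E + measure M F"
          using EF d sM by (intro finite_measure_Union) auto
        then show "\<mu> (E \<union> F) = \<mu> E + \<mu> F"
          unfolding \<mu>_def l_add[OF EF d] using nn[OF EF(1)] nn[OF EF(2)]
          by (simp add: algebra_simps flip: ennreal_plus)
      qed
      show "\<forall>A\<in>sets N. \<mu> A \<noteq> \<infinity>" by (simp add: \<mu>_def)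
      fix A :: "nat \<Rightarrow> 'a set" assume A: "range A \<subseteq> sets N" "decseq A" "(\<Inter>i. A i) = {}"
      have "(\<lambda>i. 2 * measure M (A i)) \<longlonglongrightarrow> 0"
        using tendsto_mult_right[OF finite_Lim_measure_decseq[of A], of 2] A sM sN by simp
      moreover have "norm (l (A i) + measure M (A i)) \<le> 2 * measure M (A i)" for i
        using l_le[of "A i"] A(1) sN by (auto simp: abs_le_iff)
      then have "\<forall>\<^sub>F i in sequentially. norm (l (A i) + measure M (A i)) \<le> 2 * measure M (A i)" by simp
      ultimately have "(\<lambda>i. l (A i) + measure M (A i)) \<longlonglongrightarrow> 0" by (rule Lim_null_comparison[rotated])
      then show "(\<lambda>i. \<mu> (A i)) \<longlonglongrightarrow> 0" unfolding \<mu>_def using tendsto_ennrealI[of _ 0] by fastforce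
    qed
    show "E \<in> sets N" using that sN by simp
    show "sets borel \<subseteq> Pow UNIV" by simp
  qed
  have sN: "sets N = sets M" unfolding N_def sM by (simp add: sets.sigma_sets_eq[of borel, simplified])
  have "finite_measure N"
  proof
    show "emeasure N (space N) \<noteq> \<infinity>" using emN[of UNIV] sets_eq_imp_space_eq[OF sN]
        by (simp add: space \<mu>_def)
  qed
  moreover have "absolutely_continuous M N"
    unfolding absolutely_continuous_def
  proof
    fix E assume E: "E \<in> null_sets M"
    then have "E \<in> sets borel" "measure M E = 0" using sM by (auto simp: measure_def)
    then show "E \<in> null_sets N" using emN[of E] l_le[of E] sN sM by (auto simp: null_sets_def \<mu>_def)
  qed
  ultimately obtain f where f: "f \<in> borel_measurable M" "density M f = N"
    using Radon_Nikodym_finite_measure[OF _ sN] by blast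
  have fm [measurable]: "f \<in> borel_measurable borel" using f(1) sM by (simp cong: measurable_cong_sets)
  have Nf: "(\<integral>\<^sup>+ x. f x * indicator E x \<partial>M) = \<mu> E" if [measurable]: "E \<in> sets borel" for E
    using emeasure_density[of f M E] f emN[OF that] that sM by simp
  have f2: "AE x in M. f x \<le> 2"
  proof -
    define E where "E = {x. f x > 2}"
    have E [measurable]: "E \<in> sets borel" unfolding E_def by measurable
    have "(\<integral>\<^sup>+ x. f x * indicator E x - 2 * indicator E x \<partial>M) =
        (\<integral>\<^sup>+ x. f x * indicator E x \<partial>M) - (\<integral>\<^sup>+ x. 2 * indicator E x \<partial>M)"
    proof (rule nn_integral_diff)
      have "(\<integral>\<^sup>+ x. 2 * indicator E x \<partial>M) = 2 * emeasure M E"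
        using E sM by (intro nn_integral_cmult_indicator) simp
      then show "(\<integral>\<^sup>+ x. 2 * indicator E x \<partial>M) \<noteq> \<infinity>" by (simp add: ennreal_mult_eq_top_iff)
      show "AE x in M. 2 * indicator E x \<le> f x * indicator E x" by (auto simp: E_def indicator_def)
    qed auto
    also have "\<dots> = 0"
    proof -
      have "\<mu> E \<le> 2 * emeasure M E"
        using l_le[OF E] by (auto simp: \<mu>_def emeasure_eq_measure ennreal_mult'[symmetric] intro!:
            ennreal_leI simp flip: ennreal_numeral)
      moreover have "(\<integral>\<^sup>+ x. 2 * indicator E x \<partial>M) = 2 * emeasure M E"
        using E sM by (intro nn_integral_cmult_indicator) simp
      moreover have "\<mu> E < top" by (simp add: \<mu>_def)
      ultimately show ?thesis by (simp add: Nf[OF E] diff_eq_0_ennreal)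
    qed
    finally have "AE x in M. f x * indicator E x - 2 * indicator E x = 0"
      by (subst (asm) nn_integral_0_iff_AE) auto
    then show ?thesis
    proof eventually_elim
      case (elim x)
      show ?case
      proof (rule ccontr)
        assume "\<not> f x \<le> 2"
        then have "f x - 2 = 0" "f x > 2" using elim by (auto simp: E_def)
        then show False by (simp add: diff_eq_0_iff_ennreal not_le[symmetric])
      qed
    qed
  qed
  \<comment> \<open>Cutting \<open>f\<close> at 2 alters it only on a null set and makes the bound
    for \<open>g\<close> hold at every point.\<close>
  define g where "g x = enn2real (min (f x) 2) - 1" for x
  have g [measurable]: "g \<in> borel_measurable borel" unfolding g_def by measurable
  have g1: "\<bar>g x\<bar> \<le> 1" for x
  proof -
    have "enn2real (min (f x) 2) \<le> 2" by (rule enn2real_leI) auto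
    then show ?thesis unfolding g_def using enn2real_nonneg[of "min (f x) 2"] by (simp add: abs_le_iff)
  qed
  show thesis
  proof (rule that[OF r(1) g g1])
    fix E :: "'a set" assume E [measurable]: "E \<in> sets borel"
    have "norm ((g x + 1) * indicator E x) \<le> 2" "norm (g x * indicator E x) \<le> 2" for x
      using g1[of x] by (auto simp: abs_le_iff split: split_indicator)
    then have ig: "integrable M (\<lambda>x. (g x + 1) * indicator E x)"
        "integrable M (\<lambda>x. g x * indicator E x)"
      by (auto intro!: integrable_const_bound[where B = 2])
    have "ennreal (\<integral>x. (g x + 1) * indicator E x \<partial>M) = (\<integral>\<^sup>+ x. ennreal ((g x + 1) * indicator E x) \<partial>M)"
      using ig(1) by (intro nn_integral_eq_integral[symmetric]) (auto simp: g_def)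
    also have "\<dots> = (\<integral>\<^sup>+ x. f x * indicator E x \<partial>M)"
    proof (rule nn_integral_cong_AE)
      show "AE x in M. ennreal ((g x + 1) * indicator E x) = f x * indicator E x"
        using f2
      proof eventually_elim
        case (elim x)
        then have "min (f x) 2 = f x" "f x < top" by (auto simp: min_def intro: le_less_trans)
        then show ?case by (auto simp: g_def indicator_def)
      qed
    qed
    also have "\<dots> = \<mu> E" by (rule Nf[OF E])
    finally have "ennreal (\<integral>x. (g x + 1) * indicator E x \<partial>M) = ennreal (l E + measure M E)"
        by (simp add: \<mu>_def)
    moreover have "(\<integral>x. (g x + 1) * indicator E x \<partial>M) \<ge> 0"
        by (rule integral_nonneg_AE) (auto simp: g_def)
    ultimately have "(\<integral>x. (g x + 1) * indicator E x \<partial>M) = l E + measure M E"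
      using nn[OF E] by (simp add: ennreal_inj)
    moreover have "(\<integral>x. (g x + 1) * indicator E x \<partial>M) = (\<integral>x. g x * indicator E x \<partial>M) + measure M E"
    proof -
      have "(\<integral>x. (g x + 1) * indicator E x \<partial>M) = (\<integral>x. g x * indicator E x + indicator E x \<partial>M)"
        by (simp add: distrib_right)
      also have "\<dots> = (\<integral>x. g x * indicator E x \<partial>M) + (\<integral>x. indicator E x \<partial>M)"
        using ig(2) E sM by (intro Bochner_Integration.integral_add) (auto simp: less_top[symmetric])
      finally show ?thesis by (simp add: space)
    qed
    ultimately have "(\<integral>x. g x * indicator E x \<partial>M) = l E" by simp
    then show "(\<lambda>k. \<integral>x. v (r k) x * indicator E x \<partial>M) \<longlonglongrightarrow> (\<integral>x. g x * indicator E x \<partial>M)"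
      using l[OF E] by (simp add: J_def)
  qed
qed

text \<open>Lebesgue measure is replaced by the finite measure with a positive integrable density
  \<open>p\<close>, and an integrable \<open>f\<close> by \<open>f / p\<close>. Convergence on
  indicators extends to all integrable functions by approximation in the mean, since the sequence is
  bounded by 1.\<close>

lemma weak_star_compactness:
  fixes v :: "nat \<Rightarrow> 'a::euclidean_space \<Rightarrow> real"
  assumes v: "\<And>k. v k \<in> borel_measurable borel" "\<And>k x. \<bar>v k x\<bar> \<le> 1"
  obtains r :: "nat \<Rightarrow> nat" and g where "strict_mono r" "g \<in> borel_measurable borel" "\<And>x. \<bar>g x\<bar> \<le> 1"
    "\<And>f. integrable lborel f \<Longrightarrow> (\<lambda>k. \<integral>x. v (r k) x * f x \<partial>lborel) \<longlonglongrightarrow> (\<integral>x. g x * f x \<partial>lborel)"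
proof -
  obtain h :: "'a \<Rightarrow> ennreal" where h: "h \<in> borel_measurable borel" "integral\<^sup>N lborel h \<noteq> \<infinity>"
      "\<And>x. 0 < h x \<and> h x < \<infinity>"
    using sigma_finite_measure.Ex_finite_integrable_function[OF sigma_finite_lborel] by auto
  define p where "p x = enn2real (h x)" for x
  have p [measurable]: "p \<in> borel_measurable borel" unfolding p_def using h(1) by measurable
  have p0: "p x > 0" and hp: "ennreal (p x) = h x" for x
    using h(3)[of x] by (auto simp: p_def enn2real_positive_iff)
  define M where "M = density lborel (\<lambda>x. ennreal (p x))"
  have sM: "sets M = sets borel" by (simp add: M_def)
  have fin: "finite_measure M"
  proof
    have "emeasure M (space M) = integral\<^sup>N lborel h" unfolding M_def
        by (simp add: emeasure_density hp h(1))
    then show "emeasure M (space M) \<noteq> \<infinity>" using h(2) by simp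
  qed
  interpret finite_measure M by fact
  note [measurable_cong] = sM
  note [measurable] = v(1)
  have "\<exists>r g. strict_mono (r :: nat \<Rightarrow> nat) \<and> g \<in> borel_measurable borel \<and> (\<forall>x. \<bar>g x\<bar> \<le> 1) \<and>
    (\<forall>E\<in>sets borel. (\<lambda>k. \<integral>x. v (r k) x * indicator E x \<partial>M) \<longlonglongrightarrow> (\<integral>x. g x * indicator E x \<partial>M))"
  proof (rule weak_star_compactness_finite[OF fin sM, of v, OF v])
    fix r :: "nat \<Rightarrow> nat" and g
    assume "strict_mono r" "g \<in> borel_measurable borel" "\<And>x. \<bar>g x\<bar> \<le> 1"
      "\<And>E. E \<in> sets borel \<Longrightarrow> (\<lambda>k. \<integral>x. v (r k) x * indicator E x \<partial>M) \<longlonglongrightarrow> (\<integral>x. g x * indicator E x \<partial>M)"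
    then show ?thesis by (intro exI[of _ r] exI[of _ g]) simp
  qed
  then obtain r :: "nat \<Rightarrow> nat" and g where rg': "strict_mono r \<and> g \<in> borel_measurable borel \<and>
      (\<forall>x. \<bar>g x\<bar> \<le> 1) \<and>
    (\<forall>E\<in>sets borel. (\<lambda>k. \<integral>x. v (r k) x * indicator E x \<partial>M) \<longlonglongrightarrow> (\<integral>x. g x * indicator E x \<partial>M))"
    by (elim exE)
  then have rg: "strict_mono r" "g \<in> borel_measurable borel" "\<And>x. \<bar>g x\<bar> \<le> 1"
    "\<And>E. E \<in> sets borel \<Longrightarrow> (\<lambda>k. \<integral>x. v (r k) x * indicator E x \<partial>M) \<longlonglongrightarrow> (\<integral>x. g x * indicator E x \<partial>M)"
    by simp_all
  note [measurable] = rg(2)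
  have i: "integrable M (\<lambda>x. w x * f x)"
    if "integrable M f" "w \<in> borel_measurable borel" "\<And>x. \<bar>w x\<bar> \<le> 1" for w f :: "'a \<Rightarrow> real"
  proof (rule Bochner_Integration.integrable_bound[OF that(1)])
    show "(\<lambda>x. w x * f x) \<in> borel_measurable M"
      using that borel_measurable_integrable[OF that(1)] by measurable
    show "AE x in M. norm (w x * f x) \<le> norm (f x)"
      using that(3) by (auto simp: abs_mult intro!: mult_left_le_one_le)
  qed
  have lim: "(\<lambda>k. \<integral>x. v (r k) x * f x \<partial>M) \<longlonglongrightarrow> (\<integral>x. g x * f x \<partial>M)" if "integrable M f" for f
    using that
  proof (induction f rule: integrable_induct)
    case (base E c)
    have "(\<lambda>k. (\<integral>x. v (r k) x * indicator E x \<partial>M) * c) \<longlonglongrightarrow> (\<integral>x. g x * indicator E x \<partial>M) * c"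
      using base sM by (intro tendsto_mult_right rg(4)) simp
    then show ?case by (simp add: mult.assoc[symmetric])
  next
    case (add f f')
    then show ?case
      using i[OF add.hyps(1) v] i[OF add.hyps(2) v] i[OF add.hyps(1) rg(2,3)] i[OF add.hyps(2) rg(2,3)]
          tendsto_add[OF add.IH]
      by (simp add: distrib_left)
  next
    case (lim f s)
    have "(\<lambda>i. \<integral>x. \<bar>s i x - f x\<bar> \<partial>M) \<longlonglongrightarrow> (\<integral>x. 0 \<partial>M)"
    proof (rule integral_dominated_convergence[where w = "\<lambda>x. 3 * \<bar>f x\<bar>"])
      show "AE x in M. (\<lambda>i. \<bar>s i x - f x\<bar>) \<longlonglongrightarrow> 0"
        using lim.hyps(2) by (auto intro!: tendsto_rabs_zero simp: LIM_zero_iff)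
      show "AE x in M. norm \<bar>s i x - f x\<bar> \<le> 3 * \<bar>f x\<bar>" for i
      proof (rule AE_I2)
        fix x assume "x \<in> space M"
        from lim.hyps(3)[OF this, of i] show "norm \<bar>s i x - f x\<bar> \<le> 3 * \<bar>f x\<bar>" by simp
      qed
    qed (use lim.hyps borel_measurable_integrable in \<open>auto intro!: borel_measurable_abs
        borel_measurable_diff\<close>)
    then have z: "(\<lambda>i. \<integral>x. \<bar>s i x - f x\<bar> \<partial>M) \<longlonglongrightarrow> 0" by simp
    have close: "\<bar>(\<integral>x. w x * f x \<partial>M) - (\<integral>x. w x * s i x \<partial>M)\<bar> \<le> (\<integral>x. \<bar>s i x - f x\<bar> \<partial>M)"
      if "w \<in> borel_measurable borel" "\<And>x. \<bar>w x\<bar> \<le> 1" for w i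
    proof -
      have "(\<integral>x. w x * f x \<partial>M) - (\<integral>x. w x * s i x \<partial>M) = (\<integral>x. w x * (f x - s i x) \<partial>M)"
        using i[OF lim.hyps(4) that] i[OF lim.hyps(1) that] by (simp add: right_diff_distrib)
      also have "\<bar>\<dots>\<bar> \<le> (\<integral>x. \<bar>w x * (f x - s i x)\<bar> \<partial>M)" by simp
      also have "\<dots> \<le> (\<integral>x. \<bar>s i x - f x\<bar> \<partial>M)"
      proof (rule integral_mono)
        show "integrable M (\<lambda>x. \<bar>w x * (f x - s i x)\<bar>)"
          by (intro integrable_abs i that Bochner_Integration.integrable_diff lim.hyps)
        show "integrable M (\<lambda>x. \<bar>s i x - f x\<bar>)"
          by (intro integrable_abs Bochner_Integration.integrable_diff lim.hyps)
        show "\<bar>w x * (f x - s i x)\<bar> \<le> \<bar>s i x - f x\<bar>" for x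
          using that(2)[of x] by (auto simp: abs_mult abs_minus_commute intro!: mult_left_le_one_le)
      qed
      finally show ?thesis .
    qed
    show ?case
    proof (rule LIMSEQ_I)
      fix e :: real assume "e > 0"
      then have "\<forall>\<^sub>F m in sequentially. (\<integral>x. \<bar>s m x - f x\<bar> \<partial>M) < e / 3"
        by (intro order_tendstoD(2)[OF z]) simp
      then obtain m where m: "(\<integral>x. \<bar>s m x - f x\<bar> \<partial>M) < e / 3" unfolding eventually_sequentially by blast
      obtain k0 where k0: "\<And>k. k \<ge> k0 \<Longrightarrow> norm ((\<integral>x. v (r k) x * s m x \<partial>M) -
          (\<integral>x. g x * s m x \<partial>M)) < e / 3"
        using LIMSEQ_D[OF lim.IH[of m], of "e / 3"] \<open>e > 0\<close> by auto
      have "norm ((\<integral>x. v (r k) x * f x \<partial>M) - (\<integral>x. g x * f x \<partial>M)) < e" if "k \<ge> k0" for k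
        using k0[OF that] close[OF v, of "r k" m] close[OF rg(2,3), of m] m unfolding real_norm_def
            by linarith
      then show "\<exists>no. \<forall>n\<ge>no. norm ((\<integral>x. v (r n) x * f x \<partial>M) - (\<integral>x. g x * f x \<partial>M)) < e" by blast
    qed
  qed
  show thesis
  proof (rule that[OF rg(1-3)])
    fix f :: "'a \<Rightarrow> real" assume f: "integrable lborel f"
    have [measurable]: "f \<in> borel_measurable borel" using borel_measurable_integrable[OF f] by simp
    have "integrable M (\<lambda>x. f x / p x)" unfolding M_def
      by (subst integrable_density) (use f p0 in \<open>auto simp: less_imp_le less_imp_neq[OF p0,
          symmetric]\<close>)
    moreover have "(\<integral>x. w x * (f x / p x) \<partial>M) = (\<integral>x. w x * f x \<partial>lborel)"
        if [measurable]: "w \<in> borel_measurable borel" for w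
    proof -
      have "(\<integral>x. w x * (f x / p x) \<partial>M) = (\<integral>x. p x *\<^sub>R (w x * (f x / p x)) \<partial>lborel)"
        unfolding M_def by (rule integral_density) (use p0 in \<open>auto simp: less_imp_le\<close>)
      also have "(\<lambda>x. p x *\<^sub>R (w x * (f x / p x))) = (\<lambda>x. w x * f x)"
        by (auto simp: less_imp_neq[OF p0, symmetric])
      finally show ?thesis .
    qed
    ultimately show "(\<lambda>k. \<integral>x. v (r k) x * f x \<partial>lborel) \<longlonglongrightarrow> (\<integral>x. g x * f x \<partial>lborel)"
      using lim[of "\<lambda>x. f x / p x"] v(1) rg(2) by simp
  qed
qed

section \<open>Difference quotients of intrinsic Lipschitz functions\<close>

text \<open>The length \<open>h\<^sup>2\<close> matches a horizontal step \<open>h\<close> in the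
  scaling of the graph distance. An indicator inside a Lebesgue integral keeps the mean measurable
  also for functions that are merely Borel, such as an extension by zero.\<close>

definition vmean :: "real \<Rightarrow> ('a \<times> real \<Rightarrow> real) \<Rightarrow> 'a \<times> real \<Rightarrow> real"
  where "vmean h f A = (\<integral>r. indicator {0..h\<^sup>2} r * f (fst A, snd A + r) \<partial>lborel) / h\<^sup>2"

lemma vmean_eq_integral:
  assumes "continuous_on UNIV u"
  shows "vmean h u A = integral {0..h\<^sup>2} (\<lambda>r. u (fst A, snd A + r)) / h\<^sup>2"
proof -
  have c: "continuous_on {0..h\<^sup>2} (\<lambda>r. u (fst A, snd A + r))"
    by (intro continuous_on_compose2[OF assms] continuous_intros) auto
  have "set_integrable lborel {0..h\<^sup>2} (\<lambda>r. u (fst A, snd A + r))"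
    unfolding set_integrable_def by (rule borel_integrable_compact[OF compact_Icc c])
  from set_borel_integral_eq_integral(2)[OF this] show ?thesis
    by (simp add: vmean_def set_lebesgue_integral_def)
qed

text \<open>One antiderivative per vertical line represents the means for all \<open>h\<close> and
  \<open>t\<close>, so their \<open>t\<close>-derivative and their bounds become one-variable
  calculus.\<close>

lemma vmean_antiderivative:
  assumes "continuous_on UNIV u"
  obtains \<Phi> where "\<And>t. (\<Phi> has_real_derivative u (z, t)) (at t)"
    "\<And>h t. h \<noteq> 0 \<Longrightarrow> vmean h u (z, t) = (\<Phi> (t + h\<^sup>2) - \<Phi> t) / h\<^sup>2"
proof -
  have "continuous_on UNIV (\<lambda>t. u (z, t))"
    by (intro continuous_on_compose2[OF assms] continuous_intros) auto
  then have "\<exists>F. \<forall>t. - \<infinity> < ereal t \<longrightarrow> ereal t < \<infinity> \<longrightarrow> (F has_vector_derivative u (z, t)) (at t)"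
    by (intro einterval_antiderivative) (auto simp: continuous_on_eq_continuous_at)
  then obtain \<Phi> where \<Phi>: "\<And>t. (\<Phi> has_real_derivative u (z, t)) (at t)"
    by (auto simp: has_real_derivative_iff_has_vector_derivative)
  show thesis
  proof (rule that[OF \<Phi>])
    fix h t :: real assume "h \<noteq> 0"
    have "((\<lambda>r. u (z, t + r)) has_integral \<Phi> (t + h\<^sup>2) - \<Phi> (t + 0)) {0..h\<^sup>2}"
    proof (rule fundamental_theorem_of_calculus)
      fix r assume "r \<in> {0..h\<^sup>2}"
      have "((\<lambda>r. \<Phi> (t + r)) has_real_derivative u (z, t + r) * 1) (at r)"
        by (rule DERIV_chain2[OF \<Phi>]) (auto intro!: derivative_eq_intros)
      then show "((\<lambda>r. \<Phi> (t + r)) has_vector_derivative u (z, t + r)) (at r within {0..h\<^sup>2})"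
        by (auto simp: has_real_derivative_iff_has_vector_derivative[symmetric] intro: DERIV_subset)
    qed simp
    then show "vmean h u (z, t) = (\<Phi> (t + h\<^sup>2) - \<Phi> t) / h\<^sup>2"
      by (simp add: vmean_eq_integral[OF assms] integral_unique)
  qed
qed

lemma vmean_has_derivative:
  assumes "continuous_on UNIV u" "h \<noteq> 0"
  shows "((\<lambda>t. vmean h u (z, t)) has_real_derivative (u (z, t + h\<^sup>2) - u (z, t)) / h\<^sup>2) (at t)"
proof -
  obtain \<Phi> where \<Phi>: "\<And>t. (\<Phi> has_real_derivative u (z, t)) (at t)"
    "\<And>h t. h \<noteq> 0 \<Longrightarrow> vmean h u (z, t) = (\<Phi> (t + h\<^sup>2) - \<Phi> t) / h\<^sup>2"
    using vmean_antiderivative[OF assms(1)] by blast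
  have "((\<lambda>t. \<Phi> (t + h\<^sup>2)) has_real_derivative u (z, t + h\<^sup>2) * 1) (at t)"
    by (rule DERIV_chain2[OF \<Phi>(1)]) (auto intro!: derivative_eq_intros)
  then have "((\<lambda>t. \<Phi> (t + h\<^sup>2) - \<Phi> t) has_real_derivative u (z, t + h\<^sup>2) * 1 - u (z, t)) (at t)"
    by (rule DERIV_diff[OF _ \<Phi>(1)])
  from DERIV_cdivide[OF this, of "h\<^sup>2"]
  have "((\<lambda>t. (\<Phi> (t + h\<^sup>2) - \<Phi> t) / h\<^sup>2) has_real_derivative (u (z, t + h\<^sup>2) - u (z, t)) / h\<^sup>2) (at t)"
      by simp
  then show ?thesis using \<Phi>(2)[OF assms(2)] by simp
qed

lemma continuous_on_vmean:
  assumes "continuous_on UNIV u"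
  shows "continuous_on UNIV (vmean h u)"
proof -
  have "continuous_on UNIV (\<lambda>A. integral (cbox 0 (h\<^sup>2)) (\<lambda>r. u (fst A, snd A + r)))"
    by (rule integral_continuous_on_param)
       (auto simp: case_prod_beta intro!: continuous_on_compose2[OF assms] continuous_intros)
  then show ?thesis unfolding vmean_eq_integral[OF assms, abs_def] divide_inverse
    by (auto intro!: continuous_on_mult_right)
qed

lemma vmean_close:
  assumes c: "continuous_on UNIV u" and h: "h \<noteq> 0"
    and "\<And>r. 0 \<le> r \<Longrightarrow> r \<le> h\<^sup>2 \<Longrightarrow> \<bar>u (fst A, snd A + r) - a\<bar> \<le> \<delta>"
  shows "\<bar>vmean h u A - a\<bar> \<le> \<delta>"
proof -
  obtain \<Phi> where \<Phi>: "\<And>t. (\<Phi> has_real_derivative u (fst A, t)) (at t)"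
    "\<And>h t. h \<noteq> 0 \<Longrightarrow> vmean h u (fst A, t) = (\<Phi> (t + h\<^sup>2) - \<Phi> t) / h\<^sup>2"
    using vmean_antiderivative[OF c] by blast
  have "h\<^sup>2 > 0" using h by simp
  then obtain r where r: "snd A < r" "r < snd A + h\<^sup>2" "\<Phi> (snd A + h\<^sup>2) - \<Phi> (snd A) =
      (snd A + h\<^sup>2 - snd A) * u (fst A, r)"
    using MVT2[of "snd A" "snd A + h\<^sup>2" \<Phi> "\<lambda>t. u (fst A, t)"] \<Phi>(1) by auto
  then have "vmean h u A = u (fst A, snd A + (r - snd A))"
    using \<Phi>(2)[OF h, of "snd A"] \<open>h\<^sup>2 > 0\<close> by simp
  then show ?thesis using assms(3)[of "r - snd A"] r by simp
qed

lemma vmean_bounded: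
  assumes "continuous_on UNIV u" "h \<noteq> 0" "\<And>A. \<bar>u A\<bar> \<le> B"
  shows "\<bar>vmean h u A\<bar> \<le> B"
  using vmean_close[OF assms(1,2), of A 0 B] assms(3) by simp

lemma tendsto_vmean:
  fixes X :: "nat \<Rightarrow> 'a::euclidean_space \<times> real"
  assumes c: "continuous_on UNIV u" and h: "\<And>k. h k > 0" "h \<longlonglongrightarrow> 0" and X: "X \<longlonglongrightarrow> A"
  shows "(\<lambda>k. vmean (h k) u (X k)) \<longlonglongrightarrow> u A"
proof (rule LIMSEQ_I)
  fix \<delta> :: real assume \<delta>: "\<delta> > 0"
  have "isCont u A" using c continuous_on_eq_continuous_at[OF open_UNIV] by blast
  then obtain d where d: "d > 0" "\<And>Y. dist Y A < d \<Longrightarrow> dist (u Y) (u A) < \<delta> / 2"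
    using \<delta> unfolding continuous_at_eps_delta by (metis half_gt_zero)
  have "(\<lambda>k. (h k)\<^sup>2) \<longlonglongrightarrow> 0\<^sup>2" by (intro tendsto_intros h)
  then have "\<forall>\<^sub>F k in sequentially. (h k)\<^sup>2 < d / 2" using d(1)
      by (intro order_tendstoD(2)[where y = 0]) auto
  moreover have "\<forall>\<^sub>F k in sequentially. dist (X k) A < d / 2" using X d(1) by (intro tendstoD) auto
  ultimately have "\<forall>\<^sub>F k in sequentially. norm (vmean (h k) u (X k) - u A) < \<delta>"
  proof eventually_elim
    case (elim k)
    have "\<bar>u (fst (X k), snd (X k) + r) - u A\<bar> \<le> \<delta> / 2" if "0 \<le> r" "r \<le> (h k)\<^sup>2" for r
    proof -
      have "dist (fst (X k), snd (X k) + r) (X k) = r"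
        using that(1) by (simp add: dist_prod_def dist_real_def)
      then have "dist (fst (X k), snd (X k) + r) A < d"
        using elim that dist_triangle[of "(fst (X k), snd (X k) + r)" A "X k"] by linarith
      then show ?thesis using d(2) by (fastforce simp: dist_real_def)
    qed
    then have "\<bar>vmean (h k) u (X k) - u A\<bar> \<le> \<delta> / 2" using h(1)[of k] by (intro vmean_close[OF c]) auto
    then show ?case using \<delta> by simp
  qed
  then show "\<exists>no. \<forall>k\<ge>no. norm (vmean (h k) u (X k) - u A) < \<delta>" by (simp add: eventually_sequentially)
qed

section \<open>The weak limit of the difference quotients\<close>

lemma smooth_mean_value:
  assumes "\<And>k. Ck k \<psi>"
  obtains \<theta> where "0 \<le> \<theta>" "\<theta> \<le> 1" "\<psi> (x + c *\<^sub>R d) - \<psi> x =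
      c * frechet_derivative \<psi> (at (x + (\<theta> * c) *\<^sub>R d)) d"
proof -
  have der: "((\<lambda>s. \<psi> (x + s *\<^sub>R c *\<^sub>R d)) has_real_derivative
      frechet_derivative \<psi> (at (x + s *\<^sub>R c *\<^sub>R d)) (c *\<^sub>R d)) (at s)" for s
    by (rule has_derivative_along_line) (rule smooth_derivative(1)[OF assms])
  obtain \<theta> where \<theta>: "0 < \<theta>" "\<theta> < 1" "\<psi> (x + 1 *\<^sub>R c *\<^sub>R d) - \<psi> (x + 0 *\<^sub>R c *\<^sub>R d) =
      (1 - 0) * frechet_derivative \<psi> (at (x + \<theta> *\<^sub>R c *\<^sub>R d)) (c *\<^sub>R d)"
    using MVT2[OF zero_less_one der] by auto
  have "frechet_derivative \<psi> (at y) (c *\<^sub>R d) = c * frechet_derivative \<psi> (at y) d" for y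
    using linear_scale[OF has_derivative_linear[OF smooth_derivative(1)[OF assms]]] by simp
  then show thesis using that[of \<theta>] \<theta> by simp
qed

text \<open>The factor \<open>c k\<close> varies with \<open>k\<close> because the quotients are
  taken along the regularised speeds, which only converge to the speed of the field.\<close>

lemma smooth_diffquot_tendsto:
  fixes \<psi> :: "'a::euclidean_space \<Rightarrow> real"
  assumes \<psi>: "\<And>k. Ck k \<psi>" and h: "\<And>k. h k > 0" "h \<longlonglongrightarrow> 0" and c: "c \<longlonglongrightarrow> l"
  shows "(\<lambda>k. (\<psi> (x + (h k * c k) *\<^sub>R d) - \<psi> x) / h k) \<longlonglongrightarrow> l * frechet_derivative \<psi> (at x) d"
proof -
  have "\<exists>\<theta>. 0 \<le> \<theta> \<and> \<theta> \<le> 1 \<and> \<psi> (x + (h k * c k) *\<^sub>R d) - \<psi> x =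
      h k * c k * frechet_derivative \<psi> (at (x + (\<theta> * (h k * c k)) *\<^sub>R d)) d" for k
    using smooth_mean_value[OF \<psi>] by metis
  then obtain \<theta> where \<theta>: "\<And>k. 0 \<le> \<theta> k" "\<And>k. \<theta> k \<le> 1" "\<And>k. \<psi> (x + (h k * c k) *\<^sub>R d) - \<psi> x =
      h k * c k * frechet_derivative \<psi> (at (x + (\<theta> k * (h k * c k)) *\<^sub>R d)) d"
    by metis
  have "(\<lambda>k. h k * c k) \<longlonglongrightarrow> 0 * l" by (intro tendsto_intros h c)
  then have "(\<lambda>k. \<bar>h k * c k\<bar>) \<longlonglongrightarrow> 0" using tendsto_rabs_zero by fastforce
  moreover have "\<forall>\<^sub>F k in sequentially. norm (\<theta> k * (h k * c k)) \<le> \<bar>h k * c k\<bar>"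
    using \<theta>(1,2) by (auto simp: abs_mult intro!: always_eventually mult_left_le_one_le)
  ultimately have "(\<lambda>k. \<theta> k * (h k * c k)) \<longlonglongrightarrow> 0" by (rule Lim_null_comparison[rotated])
  then have "(\<lambda>k. x + (\<theta> k * (h k * c k)) *\<^sub>R d) \<longlonglongrightarrow> x + 0 *\<^sub>R d" by (intro tendsto_intros)
  then have "(\<lambda>k. frechet_derivative \<psi> (at (x + (\<theta> k * (h k * c k)) *\<^sub>R d)) d) \<longlonglongrightarrow>
      frechet_derivative \<psi> (at (x + 0 *\<^sub>R d)) d"
    by (rule continuous_on_tendsto_compose[OF smooth_derivative(2)[OF \<psi>]]) auto
  then have "(\<lambda>k. c k * frechet_derivative \<psi> (at (x + (\<theta> k * (h k * c k)) *\<^sub>R d)) d) \<longlonglongrightarrow>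
      l * frechet_derivative \<psi> (at x) d"
    by (intro tendsto_mult c) simp
  moreover have "(\<psi> (x + (h k * c k) *\<^sub>R d) - \<psi> x) / h k =
      c k * frechet_derivative \<psi> (at (x + (\<theta> k * (h k * c k)) *\<^sub>R d)) d" for k
    unfolding \<theta>(3) using h(1)[of k] by simp
  ultimately show ?thesis by simp
qed

lemma bounded_smooth_derivative:
  fixes \<psi> :: "'a::euclidean_space \<Rightarrow> real"
  assumes "\<And>k. Ck k \<psi>" "bounded {x. \<psi> x \<noteq> 0}"
  shows "bounded {x. frechet_derivative \<psi> (at x) d \<noteq> 0}"
proof (rule bounded_subset[OF bounded_closure[OF assms(2)]], rule subsetI, rule ccontr)
  fix x assume "x \<in> {x. frechet_derivative \<psi> (at x) d \<noteq> 0}" "x \<notin> closure {x. \<psi> x \<noteq> 0}"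
  then show False using frechet_derivative_outside_support by fastforce
qed

lemma continuous_bounded_support_bounded:
  fixes f :: "'a::euclidean_space \<Rightarrow> real"
  assumes "continuous_on UNIV f" "bounded {x. f x \<noteq> 0}"
  obtains C where "C \<ge> 0" "\<And>x. \<bar>f x\<bar> \<le> C"
proof -
  have "compact (f ` closure {x. f x \<noteq> 0})"
    using assms by (intro compact_continuous_image continuous_on_subset[OF assms(1)]) (auto simp:
        compact_closure)
  then have "bounded (f ` closure {x. f x \<noteq> 0})" by (rule compact_imp_bounded)
  then obtain C where "\<forall>y\<in>f ` closure {x. f x \<noteq> 0}. norm y \<le> C" unfolding bounded_iff by blast
  then have C: "\<bar>f x\<bar> \<le> C" if "x \<in> closure {x. f x \<noteq> 0}" for x using that by auto
  have "\<bar>f x\<bar> \<le> max C 0" for x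
  proof (cases "f x = 0")
    case False
    then have "x \<in> closure {x. f x \<noteq> 0}" using closure_subset[of "{x. f x \<noteq> 0}"] by blast
    from C[OF this] show ?thesis by simp
  qed simp
  then show thesis by (intro that[of "max C 0"]) simp_all
qed

definition tspeed :: "nat \<Rightarrow> (nat \<Rightarrow> 'k::finite) \<Rightarrow> ((real ^ 'k) \<times> real \<Rightarrow> real) \<Rightarrow> real \<Rightarrow> nat \<Rightarrow> (real ^ 'k)
    \<times> real \<Rightarrow> real"
  where "tspeed n e f h j A = (if j = n then vmean h f A else drift n e j (fst A))"

definition tjacobian :: "nat \<Rightarrow> ((real ^ 'k::finite) \<times> real \<Rightarrow> real) \<Rightarrow> real \<Rightarrow> nat \<Rightarrow> (real ^ 'k) \<times> real \<Rightarrow>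
    real"
  where "tjacobian n f h j A = (if j = n then 1 + (f (fst A, snd A + h\<^sup>2) - f A) / h else 1)"

text \<open>
  The factor \<open>tjacobian\<close>, the Jacobian of \<open>t \<mapsto> t + h * tspeed\<close>, makes the change of variables in the
  weak formulation exact.
\<close>

definition dquot :: "nat \<Rightarrow> (nat \<Rightarrow> 'k::finite) \<Rightarrow> ((real ^ 'k) \<times> real \<Rightarrow> real) \<Rightarrow> real \<Rightarrow> nat \<Rightarrow> (real ^ 'k) \<times>
    real \<Rightarrow> real"
  where "dquot n e f h j A =
    (vmean h f (fst A + h *\<^sub>R axis (e j) 1, snd A + h * tspeed n e f h j A) -
        vmean h f A) * tjacobian n f h j A / h"

text \<open>Substitution moves the quotient onto \<open>\<psi>\<close> and leaves three terms: the
  difference quotient \<open>p\<close> in the space direction, a term with the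
  \<open>t\<close>-derivative \<open>E\<close> of the regularised speed, and a transport term
  \<open>q\<close> weighted by the Jacobian. Dominated convergence alone settles only the first:
  \<open>E\<close> may be of size \<open>1 / h\<close>, and the Jacobian need not converge
  pointwise. Its bound is assumed just where \<open>\<psi>\<close> or its transported copy
  lives.\<close>

lemma dquot_weak_limit:
  fixes u :: "(real ^ 'k::finite) \<times> real \<Rightarrow> real"
  assumes num: "coord_numbering n e" and j: "j \<in> {1..2 * n - 1}"
    and cu: "continuous_on UNIV u" and bu: "\<And>A. \<bar>u A\<bar> \<le> B"
    and \<psi>: "\<And>k. Ck k \<psi>" and b\<psi>: "bounded {A. \<psi> A \<noteq> 0}"
    and h: "\<And>k. h k > 0" "\<And>k. h k \<le> 1" "h \<longlonglongrightarrow> 0"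
    and J: "\<And>k A. A \<in> closure {A. \<psi> A \<noteq> 0} \<or> \<psi> (fst A, snd A + h k * tspeed n e u (h k) j A) \<noteq> 0 \<Longrightarrow>
      \<bar>tjacobian n u (h k) j A\<bar> \<le> L"
    and L: "L \<ge> 0"
  shows "(\<lambda>k. \<integral>A. dquot n e u (h k) j A * \<psi> A \<partial>lborel) \<longlonglongrightarrow>
    - (\<integral>A. u A * partial_z e j \<psi> A + flux n e u j A * partial_t \<psi> A \<partial>lborel)"
proof -
  define um where "um k = vmean (h k) u" for k
  define v where "v k = tspeed n e u (h k) j" for k
  define s where "s k A = snd A + h k * v k A" for k A
  define Jk where "Jk k = tjacobian n u (h k) j" for k
  define E where "E k A = (Jk k A - 1) / h k" for k A
  define c where "c k = h k *\<^sub>R (axis (e j) (1::real), 0::real)" for k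
  define G where "G k A = um k (A + c k)" for k A
  define w where "w A = (if j = n then u A else drift n e j (fst A))" for A
  define q where "q k A = (\<psi> (fst A, s k A) - \<psi> A) / h k * G k (fst A, s k A)" for k A
  define p where "p k A = (\<psi> (A - c k) - \<psi> A) / h k" for k A
  note z\<psi> = partial_z_def[abs_def] and t\<psi> = partial_t_def[abs_def]
  have Ckt: "Ck k (partial_t \<psi>)" for k unfolding t\<psi> by (rule smooth_derivative(3)[OF \<psi>])
  note c\<psi> = Ck_continuous[OF \<psi>[of 0]] and c\<psi>z = partial_continuous_on(1)[OF \<psi>]
    and c\<psi>t = partial_continuous_on(2)[OF \<psi>] and c\<psi>tt = partial_continuous_on(2)[OF Ckt]
  have b\<psi>z: "bounded {A. partial_z e j \<psi> A \<noteq> 0}" and b\<psi>t: "bounded {A. partial_t \<psi> A \<noteq> 0}"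
    unfolding partial_z_def partial_t_def by (rule bounded_smooth_derivative[OF \<psi> b\<psi>])+
  have b\<psi>tt: "bounded {A. partial_t (partial_t \<psi>) A \<noteq> 0}"
    unfolding partial_t_def[of "partial_t \<psi>"] by (rule bounded_smooth_derivative[OF Ckt b\<psi>t])
  obtain Cz where Cz: "Cz \<ge> 0" "\<And>A. \<bar>partial_z e j \<psi> A\<bar> \<le> Cz"
    using continuous_bounded_support_bounded[OF c\<psi>z b\<psi>z] by blast
  obtain Ct where Ct: "Ct \<ge> 0" "\<And>A. \<bar>partial_t \<psi> A\<bar> \<le> Ct"
    using continuous_bounded_support_bounded[OF c\<psi>t b\<psi>t] by blast
  obtain Ctt where Ctt: "Ctt \<ge> 0" "\<And>A. \<bar>partial_t (partial_t \<psi>) A\<bar> \<le> Ctt"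
    using continuous_bounded_support_bounded[OF c\<psi>tt b\<psi>tt] by blast
  define K where "K = closure {A. \<psi> A \<noteq> 0}"
  have K\<psi>: "A \<in> K" if "\<psi> A \<noteq> 0" for A using that closure_subset[of "{A. \<psi> A \<noteq> 0}"] unfolding K_def
      by blast
  have K\<psi>t: "A \<in> K" if "partial_t \<psi> A \<noteq> 0" for A
    by (rule ccontr) (use frechet_derivative_outside_support[of A \<psi>] that in \<open>simp add: K_def
        partial_t_def\<close>)
  have K\<psi>tt: "A \<in> K" if "partial_t (partial_t \<psi>) A \<noteq> 0" for A
  proof -
    have "closure {A. partial_t \<psi> A \<noteq> 0} \<subseteq> K"
      by (rule closure_minimal) (use K\<psi>t in \<open>auto simp: K_def\<close>)
    moreover have "A \<in> closure {A. partial_t \<psi> A \<noteq> 0}"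
      by (rule ccontr) (use frechet_derivative_outside_support[of A "partial_t \<psi>"] that in
        \<open>simp add: partial_t_def[of "partial_t \<psi>"]\<close>)
    ultimately show ?thesis by blast
  qed
  have "bounded K" unfolding K_def by (rule bounded_closure[OF b\<psi>])
  then obtain R where R: "R > 0" "\<And>A. A \<in> K \<Longrightarrow> norm A \<le> R" unfolding bounded_pos by blast
  have B0: "B \<ge> 0" using bu[of 0] by linarith
  have hn: "h k \<noteq> 0" for k using h(1)[of k] by simp
  have um: "\<bar>um k A\<bar> \<le> B" for k A unfolding um_def by (rule vmean_bounded[OF cu hn bu])
  have cum: "continuous_on UNIV (um k)" for k unfolding um_def by (rule continuous_on_vmean[OF cu])
  have cv: "continuous_on UNIV (v k)" for k
    unfolding v_def tspeed_def[abs_def] using cum[of k] by (cases "j =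
        n") (auto intro!: continuous_intros simp: um_def)
  have cs: "continuous_on UNIV (s k)" for k unfolding s_def[abs_def] by (intro continuous_intros cv)
  have cJ: "continuous_on UNIV (Jk k)" for k
    unfolding Jk_def tjacobian_def[abs_def] using h(1)[of k]
    by (cases "j = n") (auto intro!: continuous_intros continuous_on_compose2[OF cu])
  have cE: "continuous_on UNIV (E k)" for k unfolding E_def[abs_def] using hn
      by (intro continuous_intros cJ) auto
  have cG: "continuous_on UNIV (G k)" for k
    unfolding G_def[abs_def] by (intro continuous_on_compose2[OF cum] continuous_intros) auto
  have cw: "continuous_on UNIV w"
    unfolding w_def[abs_def] by (cases "j = n") (auto intro!: continuous_intros cu)
  have c\<psi>s: "continuous_on UNIV (\<lambda>A. \<psi> (fst A, s k A))" "continuous_on UNIV (\<lambda>A. G k (fst A, s k A))"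
      for k
    by (intro continuous_on_compose2[OF c\<psi>] continuous_on_compose2[OF cG] continuous_intros cs; simp)+
  have cq: "continuous_on UNIV (q k)" for k
    unfolding q_def[abs_def] using hn by (intro continuous_intros c\<psi> c\<psi>s) auto
  have cp: "continuous_on UNIV (p k)" for k
    unfolding p_def[abs_def] using hn by (intro continuous_intros c\<psi> continuous_on_compose2[OF c\<psi>]) auto
  have vB: "\<bar>v k A\<bar> \<le> B + norm (fst A)" for k A
    using um[of k A] drift_le[of n e j "fst A"] norm_ge_zero[of "fst A"] B0
    by (auto simp: v_def tspeed_def um_def)
  have hv: "\<bar>s k A - snd A\<bar> \<le> B + norm (fst A)" for k A
  proof -
    have "\<bar>h k * v k A\<bar> \<le> 1 * (B + norm (fst A))"
      unfolding abs_mult using h(1,2)[of k] vB by (intro mult_mono) auto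
    then show ?thesis by (simp add: s_def)
  qed
  have nc: "norm (c k) \<le> 1" for k
    using h(1,2)[of k] norm_Pair_le[of "axis (e j) (1::real)" "0::real"]
    by (auto simp: c_def norm_Pair simp del: scaleR_Pair intro!: mult_le_one)
  \<comment> \<open>One bounded set for all \<open>k\<close>: it contains the supports of
    \<open>\<psi>\<close>, of its copies under the vertical transport, displaced by at most
    \<open>B + R\<close>, and of its translates by the vectors \<open>c k\<close> of norm at most
    1.\<close>
  define S where "S = cball (0 :: (real ^ 'k) \<times> real) (3 * R + B + 1)"
  have bS: "bounded S" by (simp add: S_def)
  have KS: "A \<in> S" if "A \<in> K" for A using R(2)[OF that] R(1) B0 by (simp add: S_def)
  have sS: "A \<in> S" and sn: "norm (fst A) \<le> R" if "\<psi> (fst A, s k A) \<noteq> 0" for A k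
  proof -
    have "norm (fst A, s k A) \<le> R" using R(2) K\<psi> that by blast
    then have *: "norm (fst A) \<le> R" "\<bar>s k A\<bar> \<le> R"
      using norm_fst_le[of "fst A" "s k A"] norm_snd_le[of "s k A" "fst A"] by auto
    then show "norm (fst A) \<le> R" by simp
    show "A \<in> S" using * hv[of k A] norm_Pair_le[of "fst A" "snd A"] by (simp add: S_def)
  qed
  have Kn: "norm (fst A) \<le> R" if "A \<in> K" for A using R(2)[OF that] norm_fst_le[of "fst A" "snd A"]
      by simp
  have cS: "A \<in> S" if "\<psi> (A - c k) \<noteq> 0" for A k
    using R(2)[OF K\<psi>[OF that]] norm_triangle_sub[of A "c k"] nc[of k] R(1) B0 by (simp add: S_def)
  have int: "integrable lborel f" if "continuous_on UNIV f" "\<And>A. A \<notin> S \<Longrightarrow> f A = 0"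
      for f :: "(real ^ 'k) \<times> real \<Rightarrow> real"
    by (rule integrable_continuous_bounded_support[OF that(1) bounded_subset[OF bS]]) (use that(2) in
        blast)
  have \<psi>S: "\<psi> A = 0" "\<psi> (A - c k) = 0" "\<psi> (fst A, s k A) = 0" "partial_t \<psi> A = 0"
      "partial_t (partial_t \<psi>) A = 0"
    if "A \<notin> S" for A k
    using that K\<psi> K\<psi>t K\<psi>tt KS cS sS by blast+
  have E_eq: "E k A = (if j = n then (u (fst A, snd A + (h k)\<^sup>2) - u A) / (h k)\<^sup>2 else 0)" for k A
    by (simp add: E_def Jk_def tjacobian_def power2_eq_square)
  have v_der: "((\<lambda>t. v k (z, t)) has_real_derivative E k (z, t)) (at t)" for k z t
    using vmean_has_derivative[OF cu hn[of k], of z t] unfolding E_eq v_def tspeed_def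
        by (cases "j = n") simp_all
  have s_der: "((\<lambda>t. s k (z, t)) has_real_derivative Jk k (z, t)) (at t)" for k z t
  proof -
    have "((\<lambda>t. s k (z, t)) has_real_derivative 1 + h k * E k (z, t)) (at t)"
      unfolding s_def by (auto intro!: derivative_eq_intros v_der)
    then show ?thesis using hn[of k] by (simp add: E_def)
  qed
  have subst: "(\<integral>A. \<psi> (fst A, s k A) * G k (fst A, s k A) * Jk k A \<partial>lborel) =
      (\<integral>A. \<psi> (A - c k) * um k A \<partial>lborel)" for k
  proof -
    have "(\<integral>A. \<psi> (fst A, s k A) * G k (fst A, s k A) * Jk k A \<partial>lborel) = (\<integral>A. \<psi> A * G k A \<partial>lborel)"
    proof (rule lborel_substitution_snd[where \<Psi> = "\<lambda>A. \<psi> A * G k A", OF _ _ s_der cs cJ hv])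
      show "bounded {A. \<psi> A * G k A \<noteq> 0}" by (rule bounded_subset[OF b\<psi>]) auto
    qed (intro continuous_intros c\<psi> cG)
    also have "\<dots> = (\<integral>A. \<psi> ((A + c k) - c k) * um k (A + c k) \<partial>lborel)" by (simp add: G_def)
    also have "\<dots> = (\<integral>A. \<psi> (A - c k) * um k A \<partial>lborel)"
      by (rule lborel_integral_translate, rule borel_measurable_continuous_onI)
         (intro continuous_intros cum continuous_on_compose2[OF c\<psi>], auto)
    finally show ?thesis .
  qed
  have dq: "dquot n e u (h k) j A = (G k (fst A, s k A) - um k A) * Jk k A / h k" for k A
    by (simp add: dquot_def G_def um_def s_def v_def Jk_def c_def)
  \<comment> \<open>A discrete product rule: at the transported point \<open>\<psi> A\<close> is
    written as \<open>\<psi> (fst A, s k A)\<close> minus an increment, and after the substitution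
    the main terms recombine to \<open>p\<close>. The remainders are the increment, in
    \<open>q\<close>, and the excess \<open>Jk - 1 = h * E\<close> of the Jacobian.\<close>
  have decomp: "(\<integral>A. dquot n e u (h k) j A * \<psi> A \<partial>lborel) =
      (\<integral>A. p k A * um k A \<partial>lborel) - (\<integral>A. \<psi> A * um k A * E k A \<partial>lborel) - (\<integral>A. q k A * Jk k A \<partial>lborel)"
          for k
  proof -
    have i: "integrable lborel (\<lambda>A. p k A * um k A)" "integrable lborel (\<lambda>A. \<psi> A * um k A * E k A)"
        "integrable lborel (\<lambda>A. q k A * Jk k A)" "integrable lborel (\<lambda>A. \<psi> (A - c k) * um k A)"
        "integrable lborel (\<lambda>A. \<psi> (fst A, s k A) * G k (fst A, s k A) * Jk k A)"
      by (intro int continuous_intros cp cum c\<psi> cE cq cJ c\<psi>s continuous_on_compose2[OF c\<psi>];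
          simp add: p_def q_def \<psi>S)+
    have "dquot n e u (h k) j A * \<psi> A = p k A * um k A - \<psi> A * um k A * E k A - q k A * Jk k A +
        (\<psi> (fst A, s k A) * G k (fst A, s k A) * Jk k A - \<psi> (A - c k) * um k A) / h k" for A
      unfolding dq p_def q_def E_def using hn[of k] by (simp add: field_simps)
    then show ?thesis
      using i subst[of k] by simp
  qed
  have slice_der: "((\<lambda>t. f (fst A, snd A + t)) has_real_derivative
      frechet_derivative f (at A) (0, 1)) (at 0)"
    if "\<And>k. Ck k f" for f :: "(real ^ 'k) \<times> real \<Rightarrow> real" and A
  proof -
    have "((\<lambda>s. f (A + s *\<^sub>R (0, 1))) has_real_derivative frechet_derivative f (at A) (0, 1)) (at 0)"
      by (rule has_derivative_along_line) (use smooth_derivative(1)[OF that, of A] in \<open>simp flip: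
          zero_prod_def\<close>)
    then show ?thesis by (cases A) simp
  qed
  have um_der: "((\<lambda>t. um k (fst A, snd A + t)) has_real_derivative E k A) (at 0)" if "j = n" for k A
    using v_der[of k "fst A" "snd A"] DERIV_shift[of "\<lambda>t. v k (fst A, t)" "E k A" 0 "snd A"] that
    by (simp add: v_def tspeed_def um_def add.commute)
  \<comment> \<open>For \<open>j = n\<close> the factor \<open>E\<close> is the
    \<open>t\<close>-derivative of \<open>um\<close>, so \<open>um ^ m * E\<close> is the derivative
    of a power. Moving this derivative to the test function removes the possibly unbounded factor;
    \<open>m = 1\<close> yields half of the flux and \<open>m = 2\<close> treats the error from the
    Jacobian.\<close>
  have parts: "(\<integral>A. f A * um k A ^ m * E k A \<partial>lborel) = -
      (1 / real (Suc m)) * (\<integral>A. partial_t f A * um k A ^ Suc m \<partial>lborel)"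
    if jn: "j = n" and f: "\<And>k. Ck k f" and fS: "\<And>A. A \<notin> S \<Longrightarrow> f A = 0" "\<And>A. A \<notin> S \<Longrightarrow> partial_t f A = 0"
        for f k m
  proof -
    note cf = Ck_continuous[OF f[of 0]] and cft = partial_continuous_on(2)[OF f]
    have i: "integrable lborel (\<lambda>A. f A * um k A ^ m * E k A)"
        "integrable lborel (\<lambda>A. partial_t f A * um k A ^ Suc m)"
      by (intro int continuous_intros cf cft cum cE; simp add: fS)+
    have "(\<integral>A. partial_t f A * um k A ^ Suc m + real (Suc m) * (f A * um k A ^ m * E k A) \<partial>lborel) = 0"
    proof (rule integral_directional_derivative_0[where v = "(0, 1)"
        and f = "\<lambda>A. f A * um k A ^ Suc m"])
      fix A
      have "((\<lambda>t. f (fst A, snd A + t) * um k (fst A, snd A + t) ^ Suc m) has_real_derivative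
          partial_t f A * um k A ^ Suc m + real (Suc m) * (f A * um k A ^ m * E k A)) (at 0)"
        using DERIV_mult[OF slice_der[OF f, of A] DERIV_power[OF um_der[OF jn, of k A], of "Suc m"]]
        by (simp add: partial_t_def mult_ac)
      then show "((\<lambda>s. f (A + s *\<^sub>R (0, 1)) * um k (A + s *\<^sub>R (0, 1)) ^ Suc m) has_real_derivative
          partial_t f A * um k A ^ Suc m + real (Suc m) * (f A * um k A ^ m * E k A)) (at 0)"
        by (cases A) simp
    next
      show "bounded {A. f A * um k A ^ Suc m \<noteq> 0}" by (rule bounded_subset[OF bS]) (use fS in auto)
    qed (intro continuous_intros cf cft cum cE)+
    then show ?thesis using i by (simp add: field_simps)
  qed
  have um_lim: "(\<lambda>k. um k A) \<longlonglongrightarrow> u A" for A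
    unfolding um_def by (rule tendsto_vmean[OF cu h(1,3) tendsto_const])
  have v_lim: "(\<lambda>k. v k A) \<longlonglongrightarrow> w A" for A
    using um_lim[of A] by (cases "j = n") (simp_all add: v_def tspeed_def w_def um_def)
  have s_lim: "(\<lambda>k. s k A) \<longlonglongrightarrow> snd A" for A
  proof -
    have "(\<lambda>k. snd A + h k * v k A) \<longlonglongrightarrow> snd A + 0 * w A" by (intro tendsto_intros h v_lim)
    then show ?thesis by (simp add: s_def)
  qed
  have G_lim: "(\<lambda>k. G k (fst A, s k A)) \<longlonglongrightarrow> u A" for A
  proof -
    have "(\<lambda>k. (fst A, s k A) + h k *\<^sub>R (axis (e j) 1, 0)) \<longlonglongrightarrow> (fst A, snd A) + 0 *\<^sub>R (axis (e j) 1, 0)"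
      by (intro tendsto_intros h s_lim)
    then show ?thesis unfolding G_def um_def c_def
      by (intro tendsto_vmean[OF cu h(1,3)]) (simp flip: zero_prod_def)
  qed
  have GB: "\<bar>G k A\<bar> \<le> B" for k A by (simp add: G_def um)
  have shift: "A - c k = A + (h k * - 1) *\<^sub>R (axis (e j) 1, 0)"
      "A - c k = A + (- h k) *\<^sub>R (axis (e j) 1, 0)" for A k
    by (simp_all add: c_def prod_eq_iff)
  have p_lim: "(\<lambda>k. p k A) \<longlonglongrightarrow> - partial_z e j \<psi> A" for A
  proof -
    have "(\<lambda>k. (\<psi> (A + (h k * - 1) *\<^sub>R (axis (e j) 1, 0)) - \<psi> A) / h k) \<longlonglongrightarrow>
        - 1 * frechet_derivative \<psi> (at A) (axis (e j) 1, 0)"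
      by (rule smooth_diffquot_tendsto[OF \<psi> h(1,3) tendsto_const])
    then show ?thesis unfolding p_def shift(1) partial_z_def by simp
  qed
  have pB: "\<bar>p k A\<bar> \<le> Cz" for k A
  proof -
    obtain \<theta> where "\<psi> (A + (- h k) *\<^sub>R (axis (e j) 1, 0)) - \<psi> A =
        - h k * frechet_derivative \<psi> (at (A + (\<theta> * - h k) *\<^sub>R (axis (e j) 1, 0))) (axis (e j) 1, 0)"
      using smooth_mean_value[OF \<psi>] by metis
    then have "p k A = - partial_z e j \<psi> (A + (\<theta> * - h k) *\<^sub>R (axis (e j) 1, 0))"
      unfolding p_def shift(2) partial_z_def using hn[of k] by simp
    then show ?thesis using Cz(2) by simp
  qed
  have qq: "(\<psi> (fst A, s k A) - \<psi> A) / h k = (\<psi> (A + (h k * v k A) *\<^sub>R (0, 1)) - \<psi> A) / h k" for k A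
    by (cases A) (simp add: s_def)
  have q_lim: "(\<lambda>k. q k A) \<longlonglongrightarrow> w A * partial_t \<psi> A * u A" for A
    unfolding q_def qq partial_t_def by (intro tendsto_mult smooth_diffquot_tendsto[OF \<psi> h(1,3) v_lim]
        G_lim)
  have qB: "\<bar>q k A\<bar> \<le> Ct * (B + norm (fst A)) * B" for k A
  proof -
    obtain \<theta> where "\<psi> (A + (h k * v k A) *\<^sub>R (0, 1)) - \<psi> A =
        h k * v k A * frechet_derivative \<psi> (at (A + (\<theta> * (h k * v k A)) *\<^sub>R (0, 1))) (0, 1)"
      using smooth_mean_value[OF \<psi>] by metis
    then have "q k A = partial_t \<psi> (A + (\<theta> * (h k * v k A)) *\<^sub>R (0, 1)) * v k A * G k (fst A, s k A)"
      unfolding q_def qq using hn[of k] by (simp add: partial_t_def)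
    then show ?thesis unfolding abs_mult using Ct vB GB B0 by (simp add: abs_mult mult_mono)
  qed
  have meas: "f \<in> borel_measurable borel" if "continuous_on UNIV f" for f :: "(real ^ 'k) \<times> real \<Rightarrow> real"
    using that by (rule borel_measurable_continuous_onI)
  have T1: "(\<lambda>k. \<integral>A. p k A * um k A \<partial>lborel) \<longlonglongrightarrow> (\<integral>A. - partial_z e j \<psi> A * u A \<partial>lborel)"
  proof (rule integral_dominated_bounded_support[where S = S and C = "Cz * B"])
    show "\<bar>p k A * um k A\<bar> \<le> Cz * B" for k A
      unfolding abs_mult by (intro mult_mono pB um Cz) simp
    show "(\<lambda>k. p k A * um k A) \<longlonglongrightarrow> - partial_z e j \<psi> A * u A" for A by (intro tendsto_mult p_lim um_lim)
    show "p k A * um k A = 0" if "A \<notin> S" for k A using that by (simp add: p_def \<psi>S)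
  qed (auto intro!: meas continuous_intros cp cum c\<psi>z cu bS)
  have T2: "(\<lambda>k. \<integral>A. \<psi> A * um k A * E k A \<partial>lborel) \<longlonglongrightarrow> (if j =
      n then - (1 / 2) * (\<integral>A. partial_t \<psi> A * (u A)\<^sup>2 \<partial>lborel) else 0)"
  proof (cases "j = n")
    case True
    have "(\<lambda>k. \<integral>A. partial_t \<psi> A * (um k A)\<^sup>2 \<partial>lborel) \<longlonglongrightarrow> (\<integral>A. partial_t \<psi> A * (u A)\<^sup>2 \<partial>lborel)"
    proof (rule integral_dominated_bounded_support[where S = S and C = "Ct * B\<^sup>2"])
      show "\<bar>partial_t \<psi> A * (um k A)\<^sup>2\<bar> \<le> Ct * B\<^sup>2" for k A
        unfolding abs_mult power_abs by (intro mult_mono power_mono um Ct) auto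
    qed (auto intro!: meas continuous_intros tendsto_intros cum c\<psi>t cu bS um_lim simp: \<psi>S)
    from tendsto_mult_left[OF this, of "- (1 / 2)"] show ?thesis
      using True parts[OF True \<psi> \<psi>S(1) \<psi>S(4), where m = 1] by (simp add: power2_eq_square)
  qed (simp add: E_eq)
  \<comment> \<open>The bounded but possibly oscillating Jacobian multiplies a factor that tends to
    zero pointwise, so its own limit does not matter.\<close>
  have T3a: "(\<lambda>k. \<integral>A. (q k A - v k A * um k A * partial_t \<psi> A) * Jk k A \<partial>lborel) \<longlonglongrightarrow>
      (\<integral>A. (0::real) \<partial>(lborel :: ((real ^ 'k) \<times> real) measure))"
  proof (rule integral_dominated_bounded_support[where S = S and C = "2 * (Ct * (B + R) * B) * L"])
    let ?x = "\<lambda>k A. q k A - v k A * um k A * partial_t \<psi> A"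
    have xK: "\<bar>Jk k A\<bar> \<le> L \<and> norm (fst A) \<le> R" if "?x k A \<noteq> 0" for k A
    proof -
      have "A \<in> K \<or> \<psi> (fst A, s k A) \<noteq> 0"
      proof (rule ccontr)
        assume "\<not> ?thesis"
        then have "\<psi> A = 0" "partial_t \<psi> A = 0" "\<psi> (fst A, s k A) = 0" using K\<psi> K\<psi>t by blast+
        then show False using that by (simp add: q_def)
      qed
      then show ?thesis using J[of A k] Kn sn unfolding Jk_def K_def s_def v_def by blast
    qed
    have JL: "\<bar>?x k A * Jk k A\<bar> \<le> \<bar>?x k A\<bar> * L" for k A
      unfolding abs_mult using xK[of k A] by (cases "?x k A = 0") (auto intro: mult_left_mono)
    show "\<bar>?x k A * Jk k A\<bar> \<le> 2 * (Ct * (B + R) * B) * L" for k A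
    proof (cases "?x k A = 0")
      case True
      show ?thesis unfolding True using Ct R B0 L by simp
    next
      case False
      note x = xK[OF False]
      have "\<bar>q k A\<bar> \<le> Ct * (B + R) * B"
        using qB[of k A] x Ct B0 by (meson add_left_mono mult_left_mono mult_right_mono order_trans)
      moreover have "\<bar>v k A * um k A * partial_t \<psi> A\<bar> \<le> (B + R) * B * Ct"
        unfolding abs_mult using vB[of k A] x B0 um Ct R by (intro mult_mono) auto
      moreover have "(B + R) * B * Ct = Ct * (B + R) * B" by (simp add: mult_ac)
      ultimately have "\<bar>?x k A\<bar> \<le> Ct * (B + R) * B + Ct * (B + R) * B"
        by (metis abs_triangle_ineq4 add_mono order_trans)
      then have "\<bar>?x k A\<bar> \<le> 2 * (Ct * (B + R) * B)" by (simp only: mult_2)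
      then show ?thesis using JL[of k A] mult_right_mono[OF _ L] by (meson order_trans)
    qed
    show "(\<lambda>k. ?x k A * Jk k A) \<longlonglongrightarrow> 0" for A
    proof (rule Lim_null_comparison[OF always_eventually])
      show "\<forall>k. norm (?x k A * Jk k A) \<le> \<bar>?x k A\<bar> * L" using JL by simp
      have "(\<lambda>k. ?x k A) \<longlonglongrightarrow> w A * partial_t \<psi> A * u A - w A * u A * partial_t \<psi> A"
        by (intro tendsto_intros q_lim v_lim um_lim)
      from tendsto_mult_right[OF tendsto_rabs[OF this], of L] show "(\<lambda>k. \<bar>?x k A\<bar> * L) \<longlonglongrightarrow> 0"
          by (simp add: mult_ac)
    qed
    show "?x k A * Jk k A = 0" if "A \<notin> S" for k A using that by (simp add: q_def \<psi>S)
  qed (auto intro!: meas continuous_intros cq cv cum c\<psi>t cJ bS)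
  \<comment> \<open>On the limiting part of \<open>q\<close> the Jacobian is written as
    \<open>1 + h * E\<close>. After integration by parts the second summand is \<open>h\<close>
    times a convergent integral: the Jacobian tends to 1 weakly.\<close>
  have T3b: "(\<lambda>k. \<integral>A. v k A * um k A * partial_t \<psi> A * Jk k A \<partial>lborel) \<longlonglongrightarrow>
      (\<integral>A. w A * u A * partial_t \<psi> A \<partial>lborel)"
  proof -
    have a: "(\<lambda>k. \<integral>A. v k A * um k A * partial_t \<psi> A \<partial>lborel) \<longlonglongrightarrow> (\<integral>A. w A * u A * partial_t \<psi> A \<partial>lborel)"
    proof (rule integral_dominated_bounded_support[where S = S and C = "(B + R) * B * Ct"])
      show "\<bar>v k A * um k A * partial_t \<psi> A\<bar> \<le> (B + R) * B * Ct" for k A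
      proof (cases "partial_t \<psi> A = 0")
        case False
        then have "norm (fst A) \<le> R" using K\<psi>t Kn by blast
        then show ?thesis unfolding abs_mult using vB[of k A] B0 um Ct R by (intro mult_mono) auto
      qed (use B0 Ct R in simp)
    qed (auto intro!: meas continuous_intros tendsto_intros cv cum c\<psi>t cu cw bS v_lim um_lim simp: \<psi>S)
    have b: "(\<lambda>k. h k * (\<integral>A. partial_t \<psi> A * v k A * um k A * E k A \<partial>lborel)) \<longlonglongrightarrow> 0"
    proof (cases "j = n")
      case True
      have v: "v k = um k" for k by (simp add: v_def tspeed_def[abs_def] um_def True)
      have "(\<lambda>k. \<integral>A. partial_t (partial_t \<psi>) A * um k A ^ 3 \<partial>lborel) \<longlonglongrightarrow>
          (\<integral>A. partial_t (partial_t \<psi>) A * u A ^ 3 \<partial>lborel)"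
      proof (rule integral_dominated_bounded_support[where S = S and C = "Ctt * B ^ 3"])
        show "\<bar>partial_t (partial_t \<psi>) A * um k A ^ 3\<bar> \<le> Ctt * B ^ 3" for k A
          unfolding abs_mult power_abs by (intro mult_mono power_mono um Ctt) auto
      qed (auto intro!: meas continuous_intros tendsto_intros cum c\<psi>tt cu bS um_lim simp: \<psi>S)
      then have "(\<lambda>k. h k * (- (1 / 3) * (\<integral>A. partial_t (partial_t \<psi>) A * um k A ^ 3 \<partial>lborel))) \<longlonglongrightarrow>
          0 * (- (1 / 3) * (\<integral>A. partial_t (partial_t \<psi>) A * u A ^ 3 \<partial>lborel))"
        by (intro tendsto_intros h)
      moreover have "(\<integral>A. partial_t \<psi> A * v k A * um k A * E k A \<partial>lborel) =
          - (1 / 3) * (\<integral>A. partial_t (partial_t \<psi>) A * um k A ^ 3 \<partial>lborel)" for k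
        using parts[OF True Ckt \<psi>S(4,5), of k 2] by (simp add: v power2_eq_square mult.assoc
            numeral_3_eq_3)
      ultimately show ?thesis by simp
    qed (simp add: E_eq)
    have "(\<integral>A. v k A * um k A * partial_t \<psi> A * Jk k A \<partial>lborel) =
        (\<integral>A. v k A * um k A * partial_t \<psi> A \<partial>lborel) +
        h k * (\<integral>A. partial_t \<psi> A * v k A * um k A * E k A \<partial>lborel)" for k
    proof -
      have i: "integrable lborel (\<lambda>A. v k A * um k A * partial_t \<psi> A)"
          "integrable lborel (\<lambda>A. partial_t \<psi> A * v k A * um k A * E k A)"
        by (intro int continuous_intros cv cum c\<psi>t cE; simp add: \<psi>S)+
      have "v k A * um k A * partial_t \<psi> A * Jk k A = v k A * um k A * partial_t \<psi> A +
          h k * (partial_t \<psi> A * v k A * um k A * E k A)" for A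
        using hn[of k] by (simp add: E_def field_simps)
      then show ?thesis using i by simp
    qed
    then show ?thesis using tendsto_add[OF a b] by simp
  qed
  have T3: "(\<lambda>k. \<integral>A. q k A * Jk k A \<partial>lborel) \<longlonglongrightarrow> (\<integral>A. w A * u A * partial_t \<psi> A \<partial>lborel)"
  proof -
    have "(\<integral>A. q k A * Jk k A \<partial>lborel) = (\<integral>A. (q k A - v k A * um k A * partial_t \<psi> A) * Jk k A \<partial>lborel)
        +
        (\<integral>A. v k A * um k A * partial_t \<psi> A * Jk k A \<partial>lborel)" for k
    proof -
      have "integrable lborel (\<lambda>A. (q k A - v k A * um k A * partial_t \<psi> A) * Jk k A)"
        "integrable lborel (\<lambda>A. v k A * um k A * partial_t \<psi> A * Jk k A)"
        by (intro int continuous_intros cq cv cum c\<psi>t cJ; simp add: q_def \<psi>S)+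
      then have "(\<integral>A. (q k A - v k A * um k A * partial_t \<psi> A) * Jk k A \<partial>lborel) +
          (\<integral>A. v k A * um k A * partial_t \<psi> A * Jk k A \<partial>lborel) =
          (\<integral>A. (q k A - v k A * um k A * partial_t \<psi> A) * Jk k A +
              v k A * um k A * partial_t \<psi> A * Jk k A \<partial>lborel)"
        by (rule Bochner_Integration.integral_add[symmetric])
      then show ?thesis by (simp add: left_diff_distrib)
    qed
    then show ?thesis using tendsto_add[OF T3a T3b] by simp
  qed
  \<comment> \<open>For \<open>j = n\<close> the contributions of the square of \<open>u\<close>
    have coefficients \<open>1 / 2\<close> and \<open>- 1\<close>; their sum \<open>- 1 / 2\<close>
    is the conservative flux.\<close>
  have "(\<integral>A. - partial_z e j \<psi> A * u A \<partial>lborel) - (if j =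
      n then - (1 / 2) * (\<integral>A. partial_t \<psi> A * (u A)\<^sup>2 \<partial>lborel) else 0) -
      (\<integral>A. w A * u A * partial_t \<psi> A \<partial>lborel) = - (\<integral>A. u A * partial_z e j \<psi> A +
          flux n e u j A * partial_t \<psi> A \<partial>lborel)"
  proof -
    have i: "integrable lborel (\<lambda>A. u A * partial_z e j \<psi> A)"
        "integrable lborel (\<lambda>A. flux n e u j A * partial_t \<psi> A)"
      by (rule integrable_continuous_bounded_support; intro continuous_intros cu c\<psi>z continuous_on_flux
          c\<psi>t bounded_subset[OF b\<psi>z] bounded_subset[OF b\<psi>t]; auto)+
    show ?thesis
      using i by (cases "j = n") (simp_all add: flux_def w_def power2_eq_square mult_ac)
  qed
  then show ?thesis using tendsto_diff[OF tendsto_diff[OF T1 T2] T3] unfolding decomp by simp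
qed

section \<open>Bounds for the difference quotients, uniform near compact sets\<close>

lemma vmean_cong:
  assumes "\<And>r. 0 \<le> r \<Longrightarrow> r \<le> h\<^sup>2 \<Longrightarrow> f (fst A, snd A + r) = g (fst A, snd A + r)"
  shows "vmean h f A = vmean h g A"
proof -
  have "(\<lambda>r. indicator {0..h\<^sup>2} r * f (fst A, snd A + r)) =
      (\<lambda>r. indicator {0..h\<^sup>2} r * g (fst A, snd A + r))"
    using assms by (auto simp: indicator_def)
  then show ?thesis by (simp add: vmean_def)
qed

text \<open>The mean value theorem is applied to the difference of the two antiderivatives, so both
  lines are compared at the same height \<open>r\<close>; separate mean values would give two
  unrelated heights.\<close>

lemma vmean_diff_le:
  assumes c: "continuous_on UNIV u" and h: "h \<noteq> 0"
    and le: "\<And>r. 0 \<le> r \<Longrightarrow> r \<le> h\<^sup>2 \<Longrightarrow> \<bar>u (z', s + r) - u (z, t + r)\<bar> \<le> \<delta>"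
  shows "\<bar>vmean h u (z', s) - vmean h u (z, t)\<bar> \<le> \<delta>"
proof -
  obtain F where F: "\<And>t. (F has_real_derivative u (z', t)) (at t)"
    "\<And>h t. h \<noteq> 0 \<Longrightarrow> vmean h u (z', t) = (F (t + h\<^sup>2) - F t) / h\<^sup>2"
    using vmean_antiderivative[OF c] by blast
  obtain G where G: "\<And>t. (G has_real_derivative u (z, t)) (at t)"
    "\<And>h t. h \<noteq> 0 \<Longrightarrow> vmean h u (z, t) = (G (t + h\<^sup>2) - G t) / h\<^sup>2"
    using vmean_antiderivative[OF c] by blast
  have h2: "h\<^sup>2 > 0" using h by simp
  have "((\<lambda>r. F (s + r) - G (t + r)) has_real_derivative u (z', s + r) - u (z, t + r)) (at r)" for r
  proof (rule DERIV_diff)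
    have "((\<lambda>r. c + r) has_real_derivative 1) (at r)" for c :: real
      by (auto intro!: derivative_eq_intros)
    from DERIV_chain2[OF F(1) this, of s] DERIV_chain2[OF G(1) this, of t]
    show "((\<lambda>r. F (s + r)) has_real_derivative u (z', s + r)) (at r)"
      "((\<lambda>r. G (t + r)) has_real_derivative u (z, t + r)) (at r)" by simp_all
  qed
  from MVT2[OF h2 this] obtain r where r: "0 < r" "r < h\<^sup>2"
    "F (s + h\<^sup>2) - G (t + h\<^sup>2) - (F (s + 0) - G (t + 0)) = (h\<^sup>2 - 0) * (u (z', s + r) - u (z, t + r))"
        by auto
  have "vmean h u (z', s) - vmean h u (z, t) = (F (s + h\<^sup>2) - G (t + h\<^sup>2) - (F (s + 0) - G (t +
      0))) / h\<^sup>2"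
    unfolding F(2)[OF h] G(2)[OF h] by (simp add: diff_divide_distrib)
  also have "\<dots> = u (z', s + r) - u (z, t + r)" unfolding r(3) using h2 by simp
  finally show ?thesis using le[of r] r by simp
qed

lemma borel_measurable_vmean:
  fixes f :: "'a::euclidean_space \<times> real \<Rightarrow> real"
  assumes f: "f \<in> borel_measurable borel"
  shows "vmean h f \<in> borel_measurable borel"
proof -
  have "(\<lambda>p::('a \<times> real) \<times> real. (fst (fst p), snd (fst p) + snd p)) \<in> borel_measurable borel"
    by (intro borel_measurable_continuous_onI continuous_intros)
  from measurable_compose[OF this f]
  have "(\<lambda>p::('a \<times> real) \<times> real. indicator {0..h\<^sup>2} (snd p) * f (fst (fst p), snd (fst p) +
      snd p)) \<in> borel_measurable (borel \<Otimes>\<^sub>M lborel)"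
    by (simp add: borel_prod[symmetric] cong: measurable_cong_sets) measurable
  then have "(\<lambda>A. \<integral>r. indicator {0..h\<^sup>2} r * f (fst A, snd A + r) \<partial>lborel) \<in> borel_measurable borel"
    using lborel.borel_measurable_lebesgue_integral[of "\<lambda>A r. indicator {0..h\<^sup>2} r * f (fst A, snd A +
        r)" borel]
    by (simp add: case_prod_beta')
  then show ?thesis unfolding vmean_def[abs_def] by measurable
qed

lemma borel_measurable_dquot:
  assumes f: "f \<in> borel_measurable borel"
  shows "dquot n e f h j \<in> borel_measurable borel"
proof -
  note v [measurable] = borel_measurable_vmean[OF f, of h]
  note [measurable] = f
  have d [measurable]: "(\<lambda>A::(real ^ 'a) \<times> real. drift n e j (fst A)) \<in> borel_measurable borel"
    by (intro borel_measurable_continuous_onI continuous_intros)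
  have t [measurable]: "tspeed n e f h j \<in> borel_measurable borel"
    unfolding tspeed_def[abs_def] by (cases "j = n") simp_all
  have sh: "(\<lambda>A::(real ^ 'a) \<times> real. (fst A, snd A + h\<^sup>2)) \<in> borel_measurable borel"
    by (intro borel_measurable_continuous_onI continuous_intros)
  have J [measurable]: "tjacobian n f h j \<in> borel_measurable borel"
    unfolding tjacobian_def[abs_def] using measurable_compose[OF sh f] by (cases "j = n") simp_all
  have c: "(\<lambda>A::(real ^ 'a) \<times> real. (fst A + h *\<^sub>R axis (e j) 1, snd A)) \<in> borel_measurable borel"
    "(\<lambda>A::(real ^ 'a) \<times> real. fst A + h *\<^sub>R axis (e j) 1) \<in> borel_measurable borel"
        "(snd :: (real ^ 'a) \<times> real \<Rightarrow> real) \<in> borel_measurable borel"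
    by (intro borel_measurable_continuous_onI continuous_intros)+
  have "(\<lambda>A. (fst A + h *\<^sub>R axis (e j) 1, snd A + h * tspeed n e f h j A)) \<in> borel_measurable borel"
    by (intro borel_measurable_Pair c borel_measurable_add borel_measurable_times t
        borel_measurable_const)
  from measurable_compose[OF this v] show ?thesis
    unfolding dquot_def[abs_def] by measurable
qed

lemma compactly_contained_thickening:
  fixes K :: "'a::euclidean_space set"
  assumes "compact K" "open \<omega>" "K \<subseteq> \<omega>"
  obtains \<delta> where "\<delta> > 0" "compactly_contained (\<Union>x\<in>K. ball x \<delta>) \<omega>"
proof -
  obtain \<epsilon> where \<epsilon>: "\<epsilon> > 0" "(\<Union>x\<in>K. ball x \<epsilon>) \<subseteq> \<omega>"
    using compact_subset_open_imp_ball_epsilon_subset[OF assms] by blast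
  let ?U = "\<Union>x\<in>K. ball x (\<epsilon> / 2)"
  have "closure ?U \<subseteq> (\<Union>x\<in>K. ball x \<epsilon>)"
  proof
    fix y assume "y \<in> closure ?U"
    then obtain y' where "y' \<in> ?U" "dist y' y < \<epsilon> / 2" using \<epsilon>(1) unfolding closure_approachable
        by (metis half_gt_zero)
    then obtain x where "x \<in> K" "dist x y' < \<epsilon> / 2" by auto
    then have "dist x y < \<epsilon>" using \<open>dist y' y < \<epsilon> / 2\<close> dist_triangle[of x y y'] by linarith
    then show "y \<in> (\<Union>x\<in>K. ball x \<epsilon>)" using \<open>x \<in> K\<close> by auto
  qed
  moreover have "bounded ?U"
  proof -
    obtain R where R: "\<And>x. x \<in> K \<Longrightarrow> norm x \<le> R" using compact_imp_bounded[OF assms(1)]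
        unfolding bounded_iff by blast
    show ?thesis
    proof (rule boundedI[of _ "R + \<epsilon> / 2"])
      fix y assume "y \<in> ?U"
      then obtain x where "x \<in> K" "dist x y < \<epsilon> / 2" by auto
      then show "norm y \<le> R + \<epsilon> / 2" using R[of x] norm_triangle_sub[of y x]
          by (simp add: dist_norm norm_minus_commute)
    qed
  qed
  ultimately have "compactly_contained ?U \<omega>"
    using \<epsilon>(2) by (auto simp: compactly_contained_def compact_closure)
  then show thesis using that[of "\<epsilon> / 2"] \<epsilon>(1) by simp
qed

lemma graph_dist_vertical: "graph_dist n e u (z, t) (z, t') = sqrt \<bar>t' - t\<bar>"
  by (simp add: graph_dist_def sigma_form_def)

text \<open>Of the drift form of \<open>sigma_form\<close> only the summand with index
  \<open>j\<close> survives. In particular, points joined by a characteristic of a linear field are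
  at graph distance exactly \<open>\<bar>h\<bar>\<close>.\<close>

lemma graph_dist_step:
  assumes num: "coord_numbering n e" and n: "n \<ge> 1" and j: "j \<in> {1..2 * n - 1}"
  shows "graph_dist n e u (z, t) (z + h *\<^sub>R axis (e j) 1, t') = \<bar>h\<bar> +
    sqrt \<bar>t' - t - h * (if j = n then (u (z, t) + u (z +
        h *\<^sub>R axis (e j) 1, t')) / 2 else drift n e j z)\<bar>"
proof -
  have nj: "n \<in> {1..2 * n - 1}" using n by auto
  have ax: "axis (e j) (1::real) $ e i = (if i = j then 1 else 0)" if "i \<in> {1..2 * n - 1}" for i
    using coord_numbering_inj[OF num that j] by (simp add: axis_def)
  have "sigma_form n e z (z + h *\<^sub>R axis (e j) 1) = - (\<Sum>i\<in>{1..2 * n - 1} - {n}.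
      if i = j then drift n e i z * h else 0)"
    unfolding sigma_form_eq_drift by (intro arg_cong[of _ _ uminus] sum.cong refl) (simp add: ax)
  also have "\<dots> = (if j = n then 0 else - drift n e j z * h)" using j by (simp add: sum.delta)
  finally have \<sigma>: "sigma_form n e z (z + h *\<^sub>R axis (e j) 1) = (if j =
      n then 0 else - drift n e j z * h)" .
  show ?thesis unfolding graph_dist_eq fst_conv snd_conv \<sigma> using ax[OF nj]
    by (cases "j = n") (simp_all add: algebra_simps add_divide_distrib)
qed

text \<open>For \<open>j \<noteq> n\<close> the compared points lie on a common characteristic. For
  \<open>j = n\<close> the transport uses the vertical mean of \<open>u\<close>, whereas the graph
  distance uses the average of the two end values; the discrepancy is at most
  \<open>h * (L * h + \<Delta> / 2)\<close> with the unknown difference \<Delta>, which is absorbed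
  as before.\<close>

lemma dquot_local_bounds:
  assumes num: "coord_numbering n e" and n: "n \<ge> 1" and j: "j \<in> {1..2 * n - 1}"
    and cu: "continuous_on UNIV u" and L: "L > 0"
    and lip: "\<And>X Y. X \<in> U \<Longrightarrow> Y \<in> U \<Longrightarrow> \<bar>u X - u Y\<bar> \<le> L * graph_dist n e u X Y"
    and h: "h > 0"
    and U: "\<And>r. 0 \<le> r \<Longrightarrow> r \<le> h\<^sup>2 \<Longrightarrow> (z, t + r) \<in> U"
      "\<And>r. 0 \<le> r \<Longrightarrow> r \<le> h\<^sup>2 \<Longrightarrow> (z + h *\<^sub>R axis (e j) 1, t + h * tspeed n e u h j (z, t) + r) \<in> U"
  shows "\<bar>tjacobian n u h j (z, t)\<bar> \<le> 1 + L"
    and "\<bar>dquot n e u h j (z, t)\<bar> \<le> 2 * (L + sqrt (L ^ 3 + (L\<^sup>2 / 2)\<^sup>2)) * (1 + L)"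
proof -
  \<comment> \<open>On a vertical line the graph distance is the square root of the length, so over
    length \<open>h\<^sup>2\<close> the oscillation is at most \<open>L * h\<close>. This bounds the
    Jacobian and compares \<open>u\<close> with its mean.\<close>
  have vert: "\<bar>u (z, t + r') - u (z, t + r)\<bar> \<le> L * h" if "0 \<le> r" "r \<le> h\<^sup>2" "0 \<le> r'" "r' \<le> h\<^sup>2" for r r'
  proof -
    have "\<bar>u (z, t + r') - u (z, t + r)\<bar> \<le> L * sqrt \<bar>r - r'\<bar>"
      using lip[OF U(1)[OF that(3,4)] U(1)[OF that(1,2)]] by (simp add: graph_dist_vertical)
    also have "sqrt \<bar>r - r'\<bar> \<le> sqrt (h\<^sup>2)" using that by (intro real_sqrt_le_mono) auto
    finally show ?thesis using h L by simp
  qed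
  show jac: "\<bar>tjacobian n u h j (z, t)\<bar> \<le> 1 + L"
  proof (cases "j = n")
    case True
    have "\<bar>u (z, t + h\<^sup>2) - u (z, t)\<bar> / h \<le> L" using vert[of 0 "h\<^sup>2"] h by (simp add: pos_divide_le_eq)
    then have "\<bar>(u (z, t + h\<^sup>2) - u (z, t)) / h\<bar> \<le> L" using h by simp
    then have "\<bar>1 + (u (z, t + h\<^sup>2) - u (z, t)) / h\<bar> \<le> 1 + L" by linarith
    then show ?thesis using True by (simp add: tjacobian_def)
  qed (use L in \<open>simp add: tjacobian_def\<close>)
  define M where "M = 2 * (L + sqrt (L ^ 3 + (L\<^sup>2 / 2)\<^sup>2))"
  have M: "M \<ge> 0" "L \<le> M" using L by (simp_all add: M_def)
  define s where "s = t + h * tspeed n e u h j (z, t)"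
  have diff: "\<bar>u (z + h *\<^sub>R axis (e j) 1, s + r) - u (z, t + r)\<bar> \<le> M * h" if r: "0 \<le> r" "r \<le> h\<^sup>2" for r
  proof -
    let ?a = "u (z, t + r)" and ?b = "u (z + h *\<^sub>R axis (e j) 1, s + r)"
    define \<Delta> where "\<Delta> = \<bar>?a - ?b\<bar>"
    have le: "\<Delta> \<le> L * graph_dist n e u (z, t + r) (z + h *\<^sub>R axis (e j) 1, s + r)"
      unfolding \<Delta>_def using lip[OF U(1)[OF r] U(2)[OF r]] by (simp add: s_def)
    have "\<Delta> \<le> M * h"
    proof (cases "j = n")
      case False
      then have "graph_dist n e u (z, t + r) (z + h *\<^sub>R axis (e j) 1, s + r) = h"
        using h by (simp add: graph_dist_step[OF num n j] s_def tspeed_def)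
      then have "\<Delta> \<le> L * h" using le by simp
      also have "\<dots> \<le> M * h" using M(2) h by (intro mult_right_mono) auto
      finally show ?thesis .
    next
      case True
      define x where "x = s + r - (t + r) - h * ((?a + ?b) / 2)"
      have x: "x = h * (vmean h u (z, t) - (?a + ?b) / 2)"
        by (simp add: x_def s_def tspeed_def True algebra_simps)
      have "\<bar>vmean h u (z, t) - ?a\<bar> \<le> L * h"
        by (rule vmean_close[OF cu]) (use h vert[OF r] in auto)
      moreover have "vmean h u (z, t) - (?a + ?b) / 2 = (vmean h u (z, t) - ?a) + (?a - ?b) / 2"
        by (simp add: field_simps)
      moreover have "\<bar>(?a - ?b) / 2\<bar> = \<Delta> / 2" by (simp add: \<Delta>_def)
      ultimately have "\<bar>vmean h u (z, t) - (?a + ?b) / 2\<bar> \<le> L * h + \<Delta> / 2"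
        using abs_triangle_ineq[of "vmean h u (z, t) - ?a" "(?a - ?b) / 2"] by simp
      then have xle: "\<bar>x\<bar> \<le> h * (L * h + \<Delta> / 2)" unfolding x abs_mult using h
          by (simp add: mult_left_mono)
      have "\<Delta> \<le> L * h + L * sqrt \<bar>x\<bar>"
      proof -
        have "graph_dist n e u (z, t + r) (z + h *\<^sub>R axis (e j) 1, s + r) = h + sqrt \<bar>x\<bar>"
          using graph_dist_step[OF num n j, of u z "t + r" h "s + r"] True h by (simp add: x_def)
        then show ?thesis using le by (simp add: distrib_left)
      qed
      moreover have "(L * sqrt \<bar>x\<bar>)\<^sup>2 \<le> L ^ 3 * h\<^sup>2 + (L\<^sup>2 / 2) * \<Delta> * h"
        using mult_left_mono[OF xle, of "L\<^sup>2"]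
        by (simp add: power_mult_distrib power2_eq_square power3_eq_cube algebra_simps)
      ultimately show ?thesis unfolding M_def
        by (rule absorb_quadratic) (use L h in \<open>auto simp: \<Delta>_def\<close>)
    qed
    then show ?thesis by (simp add: \<Delta>_def abs_minus_commute)
  qed
  have "\<bar>vmean h u (z + h *\<^sub>R axis (e j) 1, s) - vmean h u (z, t)\<bar> \<le> M * h"
    by (rule vmean_diff_le[OF cu]) (use h diff in auto)
  then have "\<bar>vmean h u (z + h *\<^sub>R axis (e j) 1, s) - vmean h u (z, t)\<bar> * \<bar>tjacobian n u h j (z, t)\<bar> \<le>
      (M * h) * (1 + L)"
    using jac M h by (intro mult_mono) auto
  then have "\<bar>vmean h u (z + h *\<^sub>R axis (e j) 1, s) - vmean h u (z, t)\<bar> * \<bar>tjacobian n u h j (z, t)\<bar> / h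
      \<le> (M * h) * (1 + L) / h"
    using h by (intro divide_right_mono) auto
  moreover have "\<bar>dquot n e u h j (z, t)\<bar> =
      \<bar>vmean h u (z + h *\<^sub>R axis (e j) 1, s) - vmean h u (z, t)\<bar> * \<bar>tjacobian n u h j (z, t)\<bar> / h"
    using h by (simp add: dquot_def s_def abs_mult)
  ultimately show "\<bar>dquot n e u h j (z, t)\<bar> \<le> 2 * (L + sqrt (L ^ 3 + (L\<^sup>2 / 2)\<^sup>2)) * (1 + L)"
    using h by (simp add: M_def)
qed

text \<open>The continuous extension \<open>u\<close> depends on \<open>K\<close>, but weak
  compactness must be applied to one sequence that serves all test functions. That sequence is built
  from the extension of \<open>\<phi>\<close> by zero, and for small \<open>h\<close> both give the
  same quotients near \<open>K\<close>. A neighbourhood of \<open>K\<close> is covered because a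
  point may lie outside \<open>K\<close> while its transported copy lies inside.\<close>

lemma local_extension:
  assumes num: "coord_numbering n e" and n: "n \<ge> 1" and op: "open \<omega>" and c\<phi>: "continuous_on \<omega> \<phi>"
    and lip: "locally_intrinsic_Lipschitz_on n e \<omega> \<phi>" and K: "compact K" "K \<subseteq> \<omega>"
  shows "\<exists>u B M \<delta> h0. continuous_on UNIV u \<and> (\<forall>A. \<bar>u A\<bar> \<le> B) \<and> (\<forall>A\<in>K. u A = \<phi> A) \<and> M > 0 \<and> \<delta> > 0 \<and>
      h0 > 0 \<and>
    (\<forall>h j A X. 0 < h \<longrightarrow> h \<le> h0 \<longrightarrow> j \<in> {1..2 * n - 1} \<longrightarrow> X \<in> K \<longrightarrow> dist X A < \<delta> \<longrightarrow>
      dquot n e (\<lambda>A. if A \<in> \<omega> then \<phi> A else 0) h j A = dquot n e u h j A \<and>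
      \<bar>dquot n e u h j A\<bar> \<le> M \<and> \<bar>tjacobian n u h j A\<bar> \<le> M)"
proof -
  obtain \<delta> where \<delta>: "\<delta> > 0" "compactly_contained (\<Union>x\<in>K. ball x \<delta>) \<omega>"
    using compactly_contained_thickening[OF K(1) op K(2)] by blast
  define U where "U = (\<Union>x\<in>K. ball x \<delta>)"
  have cU: "compact (closure U)" "closure U \<subseteq> \<omega>" using \<delta>(2)
      by (auto simp: U_def compactly_contained_def)
  have "open U" by (auto simp: U_def)
  obtain u B where u: "continuous_on UNIV u" "\<And>x. x \<in> closure U \<Longrightarrow> u x = \<phi> x" "\<And>x. \<bar>u x\<bar> \<le> B" "B \<ge> 0"
    using continuous_extension_bounded[OF cU(1) continuous_on_subset[OF c\<phi> cU(2)]] by blast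
  have uU: "u x = \<phi> x" "x \<in> \<omega>" if "x \<in> U" for x using u(2) cU(2) closure_subset that by blast+
  have "intrinsic_Lipschitz_on n e U \<phi>"
    using lip \<open>open U\<close> \<delta>(2) unfolding locally_intrinsic_Lipschitz_on_def U_def by blast
  then obtain L where L: "L > 0" "\<And>X Y. X \<in> U \<Longrightarrow> Y \<in> U \<Longrightarrow> \<bar>\<phi> X - \<phi> Y\<bar> \<le> L * graph_dist n e \<phi> X Y"
    unfolding intrinsic_Lipschitz_on_def by blast
  have lipu: "\<bar>u X - u Y\<bar> \<le> L * graph_dist n e u X Y" if "X \<in> U" "Y \<in> U" for X Y
  proof -
    have "graph_dist n e u X Y = graph_dist n e \<phi> X Y" unfolding graph_dist_eq using uU that by simp
    then show ?thesis using L(2)[OF that] uU that by simp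
  qed
  obtain R where R: "R > 0" "\<And>x. x \<in> K \<Longrightarrow> norm x \<le> R" using compact_imp_bounded[OF K(1)]
      unfolding bounded_pos by blast
  define V where "V = B + R + \<delta>"
  have V: "V > 0" using u(4) R \<delta> by (simp add: V_def)
  \<comment> \<open>All points that enter the quotient lie within \<open>h\<close> horizontally and
    \<open>h * V + h\<^sup>2\<close> vertically, hence within \<open>h * (2 + V)\<close> of
    \<open>A\<close>.\<close>
  define h0 where "h0 = min 1 (\<delta> / (4 * (2 + V)))"
  have h0: "h0 > 0" "h0 \<le> 1" using \<delta> V by (auto simp: h0_def)
  have "h0 \<le> \<delta> / (4 * (2 + V))" by (simp add: h0_def)
  then have h0V: "h0 * (2 + V) \<le> \<delta> / 4" using V by (simp add: pos_le_divide_eq algebra_simps)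
  define f where "f = (\<lambda>A. if A \<in> \<omega> then \<phi> A else 0)"
  have fu: "f x = u x" if "x \<in> U" for x using uU[OF that] by (simp add: f_def)
  define M where "M = 2 * (L + sqrt (L ^ 3 + (L\<^sup>2 / 2)\<^sup>2)) * (1 + L) + (1 + L)"
  have "2 * (L + sqrt (L ^ 3 + (L\<^sup>2 / 2)\<^sup>2)) * (1 + L) \<ge> 0" using L(1) by simp
  then have M: "M > 0" "2 * (L + sqrt (L ^ 3 + (L\<^sup>2 / 2)\<^sup>2)) * (1 + L) \<le> M" "1 + L \<le> M"
    using L(1) unfolding M_def by linarith+
  show ?thesis
  proof (rule exI[of _ u], rule exI[of _ B], rule exI[of _ M], rule exI[of _ "\<delta> / 2"], rule exI[of _
      h0],
      intro conjI allI impI ballI u(1,3) M(1) h0(1))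
    have "K \<subseteq> U" using \<delta>(1) by (force simp: U_def)
    then show "u A = \<phi> A" if "A \<in> K" for A using uU that by blast
    show "\<delta> / 2 > 0" using \<delta>(1) by simp
    fix h j A X assume h: "0 < h" "h \<le> h0" and j: "j \<in> {1..2 * n - 1}" and X: "X \<in> K" "dist X A < \<delta> / 2"
    obtain z t where A: "A = (z, t)" by (cases A)
    have h2: "h\<^sup>2 \<le> h" using h h0 by (simp add: power2_eq_square mult_le_one)
    have hV: "h * (2 + V) \<le> \<delta> / 4" using mult_right_mono[OF h(2), of "2 + V"] V h0V by linarith
    have near: "Y \<in> U" if "dist A Y \<le> \<delta> / 4" for Y
    proof -
      have "dist X Y < \<delta>" using X(2) that dist_triangle[of X Y A] \<delta>(1) by linarith
      then show ?thesis using X(1) by (auto simp: U_def)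
    qed
    have U1: "(z, t + r) \<in> U" if "0 \<le> r" "r \<le> h\<^sup>2" for r
    proof (rule near)
      have "h * 1 \<le> h * (2 + V)" using h V by (intro mult_left_mono) auto
      then show "dist A (z, t + r) \<le> \<delta> / 4" using that h2 hV
          by (simp add: A dist_prod_def dist_real_def)
    qed
    have vm: "vmean h f (z, t) = vmean h u (z, t)" by (rule vmean_cong) (use U1 fu in simp)
    have ts: "tspeed n e f h j (z, t) = tspeed n e u h j (z, t)" by (simp add: tspeed_def vm)
    have sp: "\<bar>tspeed n e u h j (z, t)\<bar> \<le> V"
    proof -
      have "norm z \<le> norm A" using norm_fst_le[of z t] by (simp add: A)
      also have "\<dots> \<le> R + \<delta>" using R(2)[OF X(1)] norm_triangle_sub[of A X] X(2) \<delta>(1)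
          by (simp add: dist_norm norm_minus_commute)
      finally have "\<bar>drift n e j z\<bar> \<le> V" using drift_le[of n e j z] norm_ge_zero[of z] u(4)
          unfolding V_def by linarith
      moreover have "\<bar>vmean h u (z, t)\<bar> \<le> V"
        using vmean_bounded[OF u(1) _ u(3), of h "(z, t)"] h R(1) \<delta>(1) by (simp add: V_def)
      ultimately show ?thesis by (simp add: tspeed_def)
    qed
    have U2: "(z + h *\<^sub>R axis (e j) 1, t + h * tspeed n e u h j (z, t) + r) \<in> U" if "0 \<le> r" "r \<le> h\<^sup>2"
        for r
    proof (rule near)
      have "dist A (z + h *\<^sub>R axis (e j) 1, t + h * tspeed n e u h j (z, t) + r) \<le>
          norm (h *\<^sub>R axis (e j) (1::real)) + \<bar>h * tspeed n e u h j (z, t) + r\<bar>"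
        using norm_Pair_le[of "- h *\<^sub>R axis (e j) (1::real)" "- (h * tspeed n e u h j (z, t) + r)"]
        by (simp add: A dist_norm algebra_simps)
      also have "\<dots> \<le> h + (h * V + h)"
      proof (intro add_mono)
        show "norm (h *\<^sub>R axis (e j) (1::real)) \<le> h" using h by simp
        have "\<bar>h * tspeed n e u h j (z, t)\<bar> \<le> h * V" unfolding abs_mult using h sp
            by (simp add: mult_left_mono)
        then show "\<bar>h * tspeed n e u h j (z, t) + r\<bar> \<le> h * V + h" using that h2 by linarith
      qed
      also have "\<dots> \<le> \<delta> / 4" using hV by (simp add: algebra_simps)
      finally show "dist A (z + h *\<^sub>R axis (e j) 1, t + h * tspeed n e u h j (z, t) + r) \<le> \<delta> / 4" .
    qed
    have vm2: "vmean h f (z + h *\<^sub>R axis (e j) 1, t + h * tspeed n e u h j (z, t)) =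
        vmean h u (z + h *\<^sub>R axis (e j) 1, t + h * tspeed n e u h j (z, t))"
      by (rule vmean_cong) (use U2 fu in simp)
    have "tjacobian n f h j (z, t) = tjacobian n u h j (z, t)"
      using fu[OF U1[of 0]] fu[OF U1[of "h\<^sup>2"]] by (simp add: tjacobian_def)
    then have "dquot n e f h j A = dquot n e u h j A" by (simp add: dquot_def A ts vm vm2)
    moreover have "\<bar>dquot n e u h j A\<bar> \<le> M" "\<bar>tjacobian n u h j A\<bar> \<le> M"
      using dquot_local_bounds[OF num n j u(1) L(1) lipu h(1) U1 U2] M(2,3) by (auto simp: A)
    ultimately show "dquot n e (\<lambda>A. if A \<in> \<omega> then \<phi> A else 0) h j A = dquot n e u h j A"
      "\<bar>dquot n e u h j A\<bar> \<le> M" "\<bar>tjacobian n u h j A\<bar> \<le> M" by (simp_all add: f_def)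
  qed
qed

section \<open>Locally intrinsic Lipschitz functions are distributional solutions\<close>

text \<open>The limit is computed for a continuous extension from the support of the test function
  and carried back to \<open>\<phi>\<close>. Finitely many indices are skipped, so that every step
  size is small enough for the two quotients to agree.\<close>

lemma dquot_weak_limit_near:
  fixes \<phi> :: "(real ^ 'k::finite) \<times> real \<Rightarrow> real"
  assumes num: "coord_numbering n e" and n: "n \<ge> 1" and op: "open \<omega>" and c\<phi>: "continuous_on \<omega> \<phi>"
    and lip: "locally_intrinsic_Lipschitz_on n e \<omega> \<phi>" and j: "j \<in> {1..2 * n - 1}"
    and \<psi>: "test_function \<omega> \<psi>" and h: "\<And>k. h k > 0" "h \<longlonglongrightarrow> 0"
  shows "(\<lambda>k. \<integral>A. dquot n e (\<lambda>A. if A \<in> \<omega> then \<phi> A else 0) (h k) j A * \<psi> A \<partial>lborel) \<longlonglongrightarrow>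
    - (LINT A|lebesgue_on \<omega>. \<phi> A * partial_z e j \<psi> A + flux n e \<phi> j A * partial_t \<psi> A)"
proof -
  define f where "f = (\<lambda>A. if A \<in> \<omega> then \<phi> A else 0)"
  define K where "K = closure {A. \<psi> A \<noteq> 0}"
  note t = test_function_facts[OF \<psi>]
  have K: "compact K" "K \<subseteq> \<omega>" using t(2,3) unfolding K_def by blast+
  have K\<psi>: "A \<in> K" if "\<psi> A \<noteq> 0" for A using that closure_subset[of "{A. \<psi> A \<noteq> 0}"] unfolding K_def
      by blast
  from local_extension[OF num n op c\<phi> lip K, folded f_def]
  obtain u B M \<delta> h0 where cu: "continuous_on UNIV u" and bu: "\<forall>A. \<bar>u A\<bar> \<le> B" and u\<phi>: "\<forall>A\<in>K. u A = \<phi> A"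
    and pos: "M > 0" "\<delta> > 0" "h0 > 0"
    and loc': "\<forall>h j A X. 0 < h \<longrightarrow> h \<le> h0 \<longrightarrow> j \<in> {1..2 * n - 1} \<longrightarrow> X \<in> K \<longrightarrow> dist X A < \<delta> \<longrightarrow>
      dquot n e f h j A = dquot n e u h j A \<and> \<bar>dquot n e u h j A\<bar> \<le> M \<and> \<bar>tjacobian n u h j A\<bar> \<le> M"
    by (elim exE conjE)
  note u = cu bu[rule_format] u\<phi>[rule_format] and loc = loc'[rule_format]
  obtain R where R: "R > 0" "\<And>A. A \<in> K \<Longrightarrow> norm A \<le> R" using compact_imp_bounded[OF K(1)]
      unfolding bounded_pos by blast
  have B0: "B \<ge> 0" using u(2)[of 0] by linarith
  \<comment> \<open>Ensures \<open>h1 * (B + R) < \<delta>\<close>: a point whose transported copy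
    lies in the support of \<open>\<psi>\<close> is itself within \<open>\<delta>\<close> of it,
    where the Jacobian is bounded.\<close>
  define h1 where "h1 = min (min 1 h0) (\<delta> / (2 * (1 + B + R)))"
  have h1: "h1 > 0" using pos B0 R by (simp add: h1_def)
  have "h1 \<le> \<delta> / (2 * (1 + B + R))" by (simp add: h1_def)
  then have "h1 * (2 * (1 + B + R)) \<le> \<delta>" using B0 R by (simp add: pos_le_divide_eq)
  then have h1V: "h1 * (B + R) < \<delta>" using pos(2) h1 B0 R by (simp add: algebra_simps)
  have "\<forall>\<^sub>F k in sequentially. h k < h1" by (rule order_tendstoD(2)[OF h(2) h1])
  then obtain N where N: "\<And>k. k \<ge> N \<Longrightarrow> h k < h1" unfolding eventually_sequentially by blast
  define g where "g k = h (k + N)" for k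
  have g: "g k > 0" "g k \<le> 1" "g k \<le> h0" "g k < h1" for k
    using h(1)[of "k + N"] N[of "k + N"] by (auto simp: g_def h1_def)
  have g0: "g \<longlonglongrightarrow> 0" unfolding g_def by (rule LIMSEQ_ignore_initial_segment[OF h(2)])
  have "(\<lambda>k. \<integral>A. dquot n e u (g k) j A * \<psi> A \<partial>lborel) \<longlonglongrightarrow>
    - (\<integral>A. u A * partial_z e j \<psi> A + flux n e u j A * partial_t \<psi> A \<partial>lborel)"
  proof (rule dquot_weak_limit[OF num j u(1,2) t(1) t(4) g(1,2) g0, where L = M])
    fix k A
    assume "A \<in> closure {A. \<psi> A \<noteq> 0} \<or> \<psi> (fst A, snd A + g k * tspeed n e u (g k) j A) \<noteq> 0"
    then show "\<bar>tjacobian n u (g k) j A\<bar> \<le> M"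
    proof
      assume "A \<in> closure {A. \<psi> A \<noteq> 0}"
      then show ?thesis using loc[OF g(1,3) j, of A A] pos(2) by (simp add: K_def)
    next
      let ?Y = "(fst A, snd A + g k * tspeed n e u (g k) j A)"
      assume "\<psi> ?Y \<noteq> 0"
      then have Y: "?Y \<in> K" by (rule K\<psi>)
      have "norm (fst A) \<le> R" using R(2)[OF Y] norm_fst_le[of "fst A" "snd ?Y"] by simp
      then have "\<bar>tspeed n e u (g k) j A\<bar> \<le> B + R"
        using drift_le[of n e j "fst A"] norm_ge_zero[of "fst A"] B0 R(1) vmean_bounded[OF u(1) _ u(2),
            of "g k" A] g(1)[of k]
        by (auto simp: tspeed_def)
      then have "\<bar>g k * tspeed n e u (g k) j A\<bar> \<le> h1 * (B + R)"
        unfolding abs_mult using g(1,4)[of k] by (intro mult_mono) auto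
      moreover have "dist ?Y A = \<bar>g k * tspeed n e u (g k) j A\<bar>"
          by (simp add: dist_prod_def dist_real_def)
      ultimately have "dist ?Y A < \<delta>" using h1V by linarith
      then show ?thesis using loc[OF g(1,3) j Y] by blast
    qed
  qed (use pos in simp)
  moreover have "(\<integral>A. dquot n e u (g k) j A * \<psi> A \<partial>lborel) = (\<integral>A. dquot n e f (g k) j A * \<psi> A \<partial>lborel)"
      for k
  proof (rule Bochner_Integration.integral_cong[OF refl])
    fix A show "dquot n e u (g k) j A * \<psi> A = dquot n e f (g k) j A * \<psi> A"
      using loc[OF g(1)[of k] g(3)[of k] j K\<psi>[of A], of A] pos(2) by (cases "\<psi> A = 0") auto
  qed
  moreover have "(\<integral>A. u A * partial_z e j \<psi> A + flux n e u j A * partial_t \<psi> A \<partial>lborel) =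
      (LINT A|lebesgue_on \<omega>. \<phi> A * partial_z e j \<psi> A + flux n e \<phi> j A * partial_t \<psi> A)"
    by (rule integral_flux_extension[symmetric, OF op \<psi> u(1)]) (use u(3) in \<open>simp add: K_def\<close>)
  ultimately have "(\<lambda>k. \<integral>A. dquot n e f (h (k + N)) j A * \<psi> A \<partial>lborel) \<longlonglongrightarrow>
      - (LINT A|lebesgue_on \<omega>. \<phi> A * partial_z e j \<psi> A + flux n e \<phi> j A * partial_t \<psi> A)"
    by (simp add: g_def)
  then show ?thesis unfolding f_def by (rule LIMSEQ_offset)
qed

text \<open>
  The difference quotients are bounded only locally. Dividing them on the \<open>m\<close>-th layer of a compact
  exhaustion by their bound on that layer puts them into the unit ball of \<open>L\<^sup>\<infinity>\<close>.
\<close>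

lemma component_solution_exists:
  fixes \<phi> :: "(real ^ 'k::finite) \<times> real \<Rightarrow> real"
  assumes num: "coord_numbering n e" and n: "n \<ge> 1" and op: "open \<omega>" and c\<phi>: "continuous_on \<omega> \<phi>"
    and lip: "locally_intrinsic_Lipschitz_on n e \<omega> \<phi>" and j: "j \<in> {1..2 * n - 1}"
  shows "\<exists>w. w \<in> borel_measurable borel \<and> (\<forall>K. compact K \<longrightarrow> K \<subseteq> \<omega> \<longrightarrow> (\<exists>C. \<forall>A\<in>K. \<bar>w A\<bar> \<le> C)) \<and>
    (\<forall>\<psi>. test_function \<omega> \<psi> \<longrightarrow>
      (LINT A|lebesgue_on \<omega>. \<phi> A * partial_z e j \<psi> A + flux n e \<phi> j A * partial_t \<psi> A) =
        - (LINT A|lebesgue_on \<omega>. w A * \<psi> A))"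
proof -
  define f where "f = (\<lambda>A. if A \<in> \<omega> then \<phi> A else 0)"
  have fm: "f \<in> borel_measurable borel"
  proof -
    have "(\<lambda>A. indicator \<omega> A *\<^sub>R \<phi> A) \<in> borel_measurable borel"
      by (rule borel_measurable_continuous_on_indicator[OF _ c\<phi>]) (use op in simp)
    moreover have "f = (\<lambda>A. indicator \<omega> A *\<^sub>R \<phi> A)" by (auto simp: f_def indicator_def)
    ultimately show ?thesis by simp
  qed
  define h where "h k = 1 / real (Suc k)" for k
  have h: "h k > 0" "h \<longlonglongrightarrow> 0" for k
    unfolding h_def[abs_def] using LIMSEQ_inverse_real_of_nat by (simp_all add: inverse_eq_divide)
  define d where "d k = dquot n e f (h k) j" for k
  have dm [measurable]: "d k \<in> borel_measurable borel" for k unfolding d_def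
      by (rule borel_measurable_dquot[OF fm])
  obtain C :: "nat \<Rightarrow> ((real ^ 'k) \<times> real) set" where C: "\<And>m. compact (C m)" "\<And>m. C m \<subseteq> \<omega>"
      "\<Union>(range C) = \<omega>"
    "\<And>K. compact K \<Longrightarrow> K \<subseteq> \<omega> \<Longrightarrow> \<exists>N. \<forall>m\<ge>N. K \<subseteq> C m"
    using open_Union_compact_subsets[OF op] by metis
  have "\<exists>M>0. \<exists>N. \<forall>k\<ge>N. \<forall>A\<in>C m. \<bar>d k A\<bar> \<le> M" for m
  proof -
    from local_extension[OF num n op c\<phi> lip C(1,2), of m, folded f_def]
    obtain u M \<delta> h0 where pos: "M > 0" "\<delta> > 0" "h0 > 0" and loc':
      "\<forall>h j A X. 0 < h \<longrightarrow> h \<le> h0 \<longrightarrow> j \<in> {1..2 * n - 1} \<longrightarrow> X \<in> C m \<longrightarrow> dist X A < \<delta> \<longrightarrow>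
        dquot n e f h j A = dquot n e u h j A \<and> \<bar>dquot n e u h j A\<bar> \<le> M \<and> \<bar>tjacobian n u h j A\<bar> \<le> M"
      by (elim exE conjE)
    have loc: "\<bar>dquot n e f h j A\<bar> \<le> M" if "0 < h" "h \<le> h0" "A \<in> C m" for h A
      using loc'[rule_format, OF that(1,2) j that(3), of A] pos(2) by simp
    have "\<forall>\<^sub>F k in sequentially. h k < h0" by (rule order_tendstoD(2)[OF h(2) pos(3)])
    then obtain N where N: "\<And>k. k \<ge> N \<Longrightarrow> h k < h0" unfolding eventually_sequentially by blast
    have "\<bar>d k A\<bar> \<le> M" if "k \<ge> N" "A \<in> C m" for k A
      using loc[OF h(1) less_imp_le[OF N[OF that(1)]] that(2)] by (simp add: d_def)
    then show ?thesis using pos(1) by blast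
  qed
  then obtain M N where M: "\<And>m. M m > 0" and N: "\<And>m k A. k \<ge> N m \<Longrightarrow> A \<in> C m \<Longrightarrow> \<bar>d k A\<bar> \<le> M m" by metis
  \<comment> \<open>The first layer containing \<open>A\<close>. Off \<open>\<omega>\<close> no
    layer does and the value is some fixed number, which is harmless as test functions vanish
    there.\<close>
  define rk where "rk A = (LEAST m. A \<in> C m)" for A
  have rk: "A \<in> C (rk A)" "rk A \<le> m" if "A \<in> C m" for A m
    using that LeastI[of "\<lambda>m. A \<in> C m" m] Least_le[of "\<lambda>m. A \<in> C m" m] by (simp_all add: rk_def)
  have Cm: "C m \<in> sets borel" for m using C(1) by (simp add: borel_compact)
  have rkm: "rk \<in> measurable borel (count_space UNIV)"
    unfolding rk_def[abs_def] by (rule measurable_Least) (use Cm in \<open>simp add: pred_def\<close>)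
  have Mm [measurable]: "(\<lambda>A. M (rk A)) \<in> borel_measurable borel"
    by (rule measurable_compose[OF rkm]) simp
  \<comment> \<open>The truncation secures the bound 1 for all \<open>k\<close> and all points; on
    each layer it is inactive from some index on, so it does not affect the limit.\<close>
  define v where "v k A = max (- 1) (min 1 (d k A / M (rk A)))" for k A
  have vm: "v k \<in> borel_measurable borel" for k unfolding v_def[abs_def] by measurable
  have v1: "\<bar>v k A\<bar> \<le> 1" for k A by (simp add: v_def abs_le_iff)
  have "\<exists>r g. strict_mono (r :: nat \<Rightarrow> nat) \<and> g \<in> borel_measurable borel \<and> (\<forall>A. \<bar>g A\<bar> \<le> 1) \<and>
    (\<forall>f. integrable lborel f \<longrightarrow> (\<lambda>k. \<integral>A. v (r k) A * f A \<partial>lborel) \<longlonglongrightarrow> (\<integral>A. g A * f A \<partial>lborel))"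
  proof (rule weak_star_compactness[of v, OF vm v1])
    fix r :: "nat \<Rightarrow> nat" and g
    assume "strict_mono r" "g \<in> borel_measurable borel" "\<And>x. \<bar>g x\<bar> \<le> 1"
      "\<And>f. integrable lborel f \<Longrightarrow> (\<lambda>k. \<integral>x. v (r k) x * f x \<partial>lborel) \<longlonglongrightarrow> (\<integral>x. g x * f x \<partial>lborel)"
    then show ?thesis by (intro exI[of _ r] exI[of _ g]) simp
  qed
  then obtain r g where rg: "strict_mono (r :: nat \<Rightarrow> nat)"
      and gm [measurable]: "g \<in> borel_measurable borel"
    and g1': "\<forall>A. \<bar>g A\<bar> \<le> 1" and glim': "\<forall>f. integrable lborel f \<longrightarrow>
      (\<lambda>k. \<integral>A. v (r k) A * f A \<partial>lborel) \<longlonglongrightarrow> (\<integral>A. g A * f A \<partial>lborel)"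
    by (elim exE conjE)
  note g1 = g1'[rule_format] and glim = glim'[rule_format]
  define w where "w A = M (rk A) * g A" for A
  \<comment> \<open>A sum, because \<open>M\<close> need not be monotone and a point of
    \<open>C m\<close> may belong to any earlier layer.\<close>
  define MM where "MM m = (\<Sum>i\<le>m. M i)" for m
  have MM: "M (rk A) \<le> MM m" if "A \<in> C m" for A m
    unfolding MM_def using rk(2)[OF that] M by (intro member_le_sum) (auto simp: less_imp_le)
  have wm [measurable]: "w \<in> borel_measurable borel" unfolding w_def[abs_def] by measurable
  have wC: "\<bar>w A\<bar> \<le> MM m" if "A \<in> C m" for A m
  proof -
    have "\<bar>w A\<bar> \<le> M (rk A) * 1" unfolding w_def abs_mult using M[of "rk A"] g1[of A]
        by (intro mult_mono) auto
    then show ?thesis using MM[OF that] by simp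
  qed
  have wK: "\<exists>c. \<forall>A\<in>K. \<bar>w A\<bar> \<le> c" if K: "compact K" "K \<subseteq> \<omega>" for K
  proof -
    obtain m where "K \<subseteq> C m" using C(4)[OF K] by blast
    then show ?thesis using wC by blast
  qed
  have eq: "(LINT A|lebesgue_on \<omega>. \<phi> A * partial_z e j \<psi> A + flux n e \<phi> j A * partial_t \<psi> A) =
      - (LINT A|lebesgue_on \<omega>. w A * \<psi> A)" if \<psi>: "test_function \<omega> \<psi>" for \<psi>
  proof -
    note t = test_function_facts[OF \<psi>]
    obtain m where m: "closure {A. \<psi> A \<noteq> 0} \<subseteq> C m" using C(4)[OF t(2,3)] by blast
    have m\<psi>: "A \<in> C m" if "\<psi> A \<noteq> 0" for A using that m closure_subset[of "{A. \<psi> A \<noteq> 0}"] by blast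
    have c\<psi>: "continuous_on UNIV \<psi>" by (rule Ck_continuous[OF t(1)])
    then have [measurable]: "\<psi> \<in> borel_measurable borel" by (rule borel_measurable_continuous_onI)
    have "integrable lborel (\<lambda>A. M (rk A) * \<psi> A)"
    proof (rule Bochner_Integration.integrable_bound)
      show "integrable lborel (\<lambda>A. MM m * \<psi> A)"
        by (intro integrable_mult_right integrable_continuous_bounded_support c\<psi> t(4))
      show "AE A in lborel. norm (M (rk A) * \<psi> A) \<le> norm (MM m * \<psi> A)"
      proof (rule AE_I2)
        fix A show "norm (M (rk A) * \<psi> A) \<le> norm (MM m * \<psi> A)"
        proof (cases "\<psi> A = 0")
          case False
          then show ?thesis using MM[OF m\<psi>[OF False]] M[of "rk A"]
              by (auto simp: abs_mult intro!: mult_right_mono)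
        qed simp
      qed
    qed measurable
    from glim[OF this] have lim: "(\<lambda>k. \<integral>A. v (r k) A * (M (rk A) * \<psi> A) \<partial>lborel) \<longlonglongrightarrow>
        (\<integral>A. w A * \<psi> A \<partial>lborel)"
      by (simp add: w_def mult_ac)
    have ev: "\<forall>\<^sub>F k in sequentially. (\<integral>A. v (r k) A * (M (rk A) * \<psi> A) \<partial>lborel) =
        (\<integral>A. d (r k) A * \<psi> A \<partial>lborel)"
    proof (rule eventually_sequentiallyI[of "\<Sum>i\<le>m. N i"])
      fix k assume k: "(\<Sum>i\<le>m. N i) \<le> k"
      show "(\<integral>A. v (r k) A * (M (rk A) * \<psi> A) \<partial>lborel) = (\<integral>A. d (r k) A * \<psi> A \<partial>lborel)"
      proof (rule Bochner_Integration.integral_cong[OF refl])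
        fix A show "v (r k) A * (M (rk A) * \<psi> A) = d (r k) A * \<psi> A"
        proof (cases "\<psi> A = 0")
          case False
          note A = m\<psi>[OF False]
          have "N (rk A) \<le> (\<Sum>i\<le>m. N i)" using rk(2)[OF A] by (intro member_le_sum) auto
          then have "N (rk A) \<le> r k" using k seq_suble[OF rg, of k] by linarith
          then have "\<bar>d (r k) A\<bar> \<le> M (rk A)" using N rk(1)[OF A] by blast
          then have "\<bar>d (r k) A / M (rk A)\<bar> \<le> 1" using M[of "rk A"] by simp
          then have "- 1 \<le> d (r k) A / M (rk A)" "d (r k) A / M (rk A) \<le> 1" by linarith+
          then have "v (r k) A = d (r k) A / M (rk A)" by (simp add: v_def)
          then show ?thesis using M[of "rk A"] by simp
        qed simp
      qed
    qed
    have "(\<lambda>k. \<integral>A. d (r k) A * \<psi> A \<partial>lborel) \<longlonglongrightarrow> (\<integral>A. w A * \<psi> A \<partial>lborel)"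
      using Lim_transform_eventually[OF lim ev] .
    moreover have "(\<lambda>k. \<integral>A. d (r k) A * \<psi> A \<partial>lborel) \<longlonglongrightarrow>
        - (LINT A|lebesgue_on \<omega>. \<phi> A * partial_z e j \<psi> A + flux n e \<phi> j A * partial_t \<psi> A)"
      using LIMSEQ_subseq_LIMSEQ[OF dquot_weak_limit_near[OF num n op c\<phi> lip j \<psi> h] rg]
      by (simp add: o_def d_def f_def)
    ultimately have "(\<integral>A. w A * \<psi> A \<partial>lborel) =
        - (LINT A|lebesgue_on \<omega>. \<phi> A * partial_z e j \<psi> A + flux n e \<phi> j A * partial_t \<psi> A)"
      by (rule LIMSEQ_unique)
    moreover have "(LINT A|lebesgue_on \<omega>. w A * \<psi> A) = (\<integral>A. w A * \<psi> A \<partial>lborel)"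
    proof (rule integral_lebesgue_on_eq_lborel[OF op])
      fix A assume "A \<notin> \<omega>"
      then have "\<psi> A = 0" using m\<psi> C(2) by blast
      then show "w A * \<psi> A = 0" by simp
    qed simp_all
    ultimately show ?thesis by simp
  qed
  show ?thesis using wm wK eq by blast
qed

text \<open>The scalar components are assembled into a vector through the inverse of the coordinate
  numbering. Their bounds hold at every point of a compact set, so the sum of the component bounds
  works without an exceptional set.\<close>

lemma locally_intrinsic_Lipschitz_imp_solution:
  fixes \<phi> :: "(real ^ 'k::finite) \<times> real \<Rightarrow> real"
  assumes num: "coord_numbering n e" and n: "n \<ge> 1" and op: "open \<omega>" and c\<phi>: "continuous_on \<omega> \<phi>"
    and lip: "locally_intrinsic_Lipschitz_on n e \<omega> \<phi>"
  shows "\<exists>w. Linfty_loc \<omega> w \<and> distributional_solution n e \<omega> \<phi> w"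
proof -
  have "\<forall>j\<in>{1..2 * n - 1}. \<exists>w. w \<in> borel_measurable borel \<and>
    (\<forall>K. compact K \<longrightarrow> K \<subseteq> \<omega> \<longrightarrow> (\<exists>C. \<forall>A\<in>K. \<bar>w A\<bar> \<le> C)) \<and>
    (\<forall>\<psi>. test_function \<omega> \<psi> \<longrightarrow>
      (LINT A|lebesgue_on \<omega>. \<phi> A * partial_z e j \<psi> A + flux n e \<phi> j A * partial_t \<psi> A) =
        - (LINT A|lebesgue_on \<omega>. w A * \<psi> A))"
    using component_solution_exists[OF num n op c\<phi> lip] by blast
  from bchoice[OF this] obtain w where w': "\<forall>j\<in>{1..2 * n - 1}. w j \<in> borel_measurable borel \<and>
    (\<forall>K. compact K \<longrightarrow> K \<subseteq> \<omega> \<longrightarrow> (\<exists>C. \<forall>A\<in>K. \<bar>w j A\<bar> \<le> C)) \<and>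
    (\<forall>\<psi>. test_function \<omega> \<psi> \<longrightarrow>
      (LINT A|lebesgue_on \<omega>. \<phi> A * partial_z e j \<psi> A + flux n e \<phi> j A * partial_t \<psi> A) =
        - (LINT A|lebesgue_on \<omega>. w j A * \<psi> A))" ..
  have w: "w j \<in> borel_measurable borel"
    "compact K \<Longrightarrow> K \<subseteq> \<omega> \<Longrightarrow> \<exists>C. \<forall>A\<in>K. \<bar>w j A\<bar> \<le> C"
    "test_function \<omega> \<psi> \<Longrightarrow>
      (LINT A|lebesgue_on \<omega>. \<phi> A * partial_z e j \<psi> A + flux n e \<phi> j A * partial_t \<psi> A) =
        - (LINT A|lebesgue_on \<omega>. w j A * \<psi> A)" if "j \<in> {1..2 * n - 1}" for j K \<psi>
    using bspec[OF w' that] by blast+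
  define i where "i = inv_into {1..2 * n - 1} e"
  have i: "i k \<in> {1..2 * n - 1}" for k
    unfolding i_def using num by (intro inv_into_into) (auto simp: coord_numbering_def bij_betw_def)
  have ie: "i (e j) = j" if "j \<in> {1..2 * n - 1}" for j
    unfolding i_def using num that by (intro inv_into_f_f) (auto simp: coord_numbering_def bij_betw_def)
  define W where "W A = (\<chi> k. w (i k) A)" for A
  have W: "W A $ e j = w j A" if "j \<in> {1..2 * n - 1}" for A j using ie[OF that] by (simp add: W_def)
  have "W \<in> borel_measurable borel"
  proof (rule borel_measurable_euclidean_space[THEN iffD2], rule ballI)
    fix b :: "real ^ 'k" assume "b \<in> Basis"
    then obtain k where "b = axis k 1" by (auto simp: Basis_vec_def)
    then have "(\<lambda>A. W A \<bullet> b) = w (i k)" by (auto simp: W_def inner_axis)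
    then show "(\<lambda>A. W A \<bullet> b) \<in> borel_measurable borel" using w(1)[OF i] by simp
  qed
  then have "W \<in> borel_measurable lborel" by simp
  then have "W \<in> borel_measurable lebesgue" by (rule measurable_completion)
  then have Wm: "W \<in> borel_measurable (lebesgue_on \<omega>)" by (rule measurable_restrict_space1)
  have "Linfty_loc \<omega> W"
    unfolding Linfty_loc_def
  proof (intro conjI allI impI Wm)
    fix \<omega>' assume "open \<omega>' \<and> compactly_contained \<omega>' \<omega>"
    then have K: "compact (closure \<omega>')" "closure \<omega>' \<subseteq> \<omega>" by (auto simp: compactly_contained_def)
    have "\<forall>k. \<exists>C. \<forall>A\<in>closure \<omega>'. \<bar>w (i k) A\<bar> \<le> C" using w(2)[OF i K] by blast
    from choice[OF this] obtain C where C: "\<forall>k. \<forall>A\<in>closure \<omega>'. \<bar>w (i k) A\<bar> \<le> C k" ..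
    have "norm (W A) \<le> (\<Sum>k\<in>UNIV. C k)" if "A \<in> \<omega>'" for A
    proof -
      have "norm (W A) \<le> (\<Sum>k\<in>UNIV. \<bar>W A $ k\<bar>)" by (rule norm_le_l1_cart)
      also have "\<dots> \<le> (\<Sum>k\<in>UNIV. C k)"
        using C that closure_subset by (intro sum_mono) (auto simp: W_def)
      finally show ?thesis .
    qed
    then have "AE x in lebesgue_on \<omega>'. norm (W x) \<le> (\<Sum>k\<in>UNIV. C k)" by (intro AE_I2) simp
    then show "\<exists>C. AE x in lebesgue_on \<omega>'. norm (W x) \<le> C" by (rule exI)
  qed
  moreover have "distributional_solution n e \<omega> \<phi> W"
    unfolding distributional_solution_iff_flux[OF n] using w(3) W by simp
  ultimately show ?thesis by blast
qed

theorem theorem1p1: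
  fixes n :: nat
    and e :: "nat \<Rightarrow> 'k::finite"
    and \<omega> :: "((real ^ 'k) \<times> real) set"
    and \<phi> :: "(real ^ 'k) \<times> real \<Rightarrow> real"
  assumes "n \<ge> 1"
    and "coord_numbering n e"
    and "open \<omega>"
    and "continuous_on \<omega> \<phi>"
  shows "locally_intrinsic_Lipschitz_on n e \<omega> \<phi> \<longleftrightarrow>
    (\<exists>w :: (real ^ 'k) \<times> real \<Rightarrow> real ^ 'k.
      Linfty_loc \<omega> w \<and> distributional_solution n e \<omega> \<phi> w)"
  using locally_intrinsic_Lipschitz_imp_solution[OF assms(2,1,3,4)]
    solution_imp_locally_intrinsic_Lipschitz[OF assms] by blast

end
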